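(* Let $0\le d\le n$ be integers and let $U_{i,n}$ denote the uniform matroid of rank $i$ on $n$ elements. The $h$-polynomial of the augmented Bergman complex $\Delta_{U_{d,n}}$ of $U_{d,n}$ satisfies \[ x^{d}\,h(\Delta_{U_{d,n}},x^{-1})=\sum_{i=0}^{d}\binom{n-i-1}{d-i}\,\mathrm{H}_{U_{i,n}}(x), \] where $\mathrm{H}_M(x)$ stands for the Hilbert--Poincar\'e series of the augmented Chow ring of a matroid $M$.
   Context: Binomial coefficients: $\binom{a}{0}=1$ for every integer $a$ (including $a=-1$, which occurs for $i=d=n$). $h$-polynomial. For a $(d-1)$-dimensional simplicial complex $\Delta$, $h(\Delta,x)=\sum_{F\in\Delta}x^{|F|}(1-x)^{d-|F|}$ (sum over all faces, including the empty face). Augmented Bergman complex. Let $M$ be a matroid on a finite set $E$ with lattice of flats $\mathcal{L}(M)$. Let $U=\{u_i : i\in E\}$ and $V_M=\{v_F : F\in\mathcal{L}(M)\setminus\{E\}\}$ be disjoint sets in one-to-one correspondence with $E$ and with the set of proper flats $\mathcal{L}(M)\setminus\{E\}$, respectively. The augmented Bergman complex $\Delta_M$ is the simplicial complex on $U\cup V_M$ whose faces are the sets $\{u_i: i\in S\}\cup\{v_{F_1},\dots,v_{F_k}\}$, where $S$ is an independent set of $M$, $F_1,\dots,F_k$ are proper flats, and either $k\ge1$ and $S\subseteq F_1\subset\cdots\subset F_k$ (strict inclusions between the $F_j$), or $k=0$ and $S$ is an arbitrary independent set. Its dimension is $\mathrm{rk}(M)-1$. Augmented Chow ring. For a loopless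 matroid $M$ on $E$, the augmented Chow ring is the graded ring \[ \mathrm{CH}(M)=\mathbb{Q}[x_F: F\in\mathcal{L}(M)\setminus\{E\};\ y_i: i\in E]/(\mathcal{I}+\mathcal{J}), \] with all variables in degree one, where $\mathcal{I}$ is generated by the linear forms $y_i-\sum_{F\not\ni i}x_F$ for $i\in E$ (sum over proper flats $F$ not containing $i$), and $\mathcal{J}$ is generated by the products $x_Fx_G$ for incomparable proper flats $F,G$ and $y_ix_F$ for proper flats $F$ and $i\in E\setminus F$. Its Hilbert--Poincar\'e series is $\mathrm{H}_M(x)=\sum_{j\ge0}\dim_{\mathbb{Q}}\mathrm{CH}^j(M)\,x^j$, a polynomial. If $M$ has loops, $\mathrm{H}_M(x)$ is defined as $\mathrm{H}_{M'}(x)$, where $M'$ is obtained from $M$ by deleting all loops; in particular $\mathrm{H}_{U_{0,n}}(x)=1$. *)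

theory Defs
  imports
    "HOL-Library.Poly_Mapping"
    "HOL-Algebra.Embedded_Algebras"
    "HOL-Algebra.QuotRing"
    "HOL-Computational_Algebra.Formal_Laurent_Series"
begin

section \<open>Matroids\<close>

record 'a matroid =
  ground :: "'a set"
  indep :: "'a set set"

locale matroid =
  fixes M :: "'a matroid"
  assumes finite_ground: "finite (ground M)"
    and indep_ground: "S \<in> indep M \<Longrightarrow> S \<subseteq> ground M"
    and indep_empty: "{} \<in> indep M"
    and indep_subset: "S \<in> indep M \<Longrightarrow> T \<subseteq> S \<Longrightarrow> T \<in> indep M"
    and indep_augment: "S \<in> indep M \<Longrightarrow> T \<in> indep M \<Longrightarrow> card S < card T
          \<Longrightarrow> \<exists>e\<in>T - S. insert e S \<in> indep M"

definition mrank :: "'a matroid \<Rightarrow> 'a set \<Rightarrow> nat" where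
  "mrank M X = Max (card ` {S \<in> indep M. S \<subseteq> X})"

definition mclosure :: "'a matroid \<Rightarrow> 'a set \<Rightarrow> 'a set" where
  "mclosure M X = {e \<in> ground M. mrank M (insert e X) = mrank M X}"

definition flats :: "'a matroid \<Rightarrow> 'a set set" where
  "flats M = {F. F \<subseteq> ground M \<and> mclosure M F = F}"

definition proper_flats :: "'a matroid \<Rightarrow> 'a set set" where
  "proper_flats M = flats M - {ground M}"

definition loops :: "'a matroid \<Rightarrow> 'a set" where
  "loops M = {e \<in> ground M. {e} \<notin> indep M}"

definition delete :: "'a matroid \<Rightarrow> 'a set \<Rightarrow> 'a matroid" where
  "delete M T = \<lparr>ground = ground M - T, indep = {S \<in> indep M. S \<inter> T = {}}\<rparr>"

definition uniform_matroid :: "nat \<Rightarrow> nat \<Rightarrow> nat matroid" where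
  "uniform_matroid r n = \<lparr>ground = {1..n}, indep = {S. S \<subseteq> {1..n} \<and> card S \<le> r}\<rparr>"

lemma matroid_delete:
  assumes "matroid M"
  shows "matroid (delete M T)"
proof -
  interpret matroid M by fact
  show ?thesis
  proof
    show "finite (ground (delete M T))" "{} \<in> indep (delete M T)"
      by (simp_all add: delete_def finite_ground indep_empty)
    show "A \<subseteq> ground (delete M T)" if "A \<in> indep (delete M T)" for A
      using that indep_ground[of A] by (auto simp: delete_def)
    show "B \<in> indep (delete M T)" if "A \<in> indep (delete M T)" "B \<subseteq> A" for A B
      using that indep_subset[of A B] by (auto simp: delete_def)
    show "\<exists>e\<in>B - A. insert e A \<in> indep (delete M T)"
      if "A \<in> indep (delete M T)" "B \<in> indep (delete M T)" "card A < card B" for A B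
      using that indep_augment[of A B] by (fastforce simp: delete_def)
  qed
qed

lemma matroid_uniform: "matroid (uniform_matroid r n)"
proof
  fix S T :: "nat set"
  assume S: "S \<in> indep (uniform_matroid r n)" and T: "T \<in> indep (uniform_matroid r n)"
    and less: "card S < card T"
  have fin: "finite S" using S by (simp add: uniform_matroid_def finite_subset[of S "{1..n}"])
  then have "\<not> T \<subseteq> S" using less card_mono[of S T] by linarith
  then obtain e where e: "e \<in> T - S" by blast
  have "insert e S \<in> indep (uniform_matroid r n)"
    using S T e less fin by (auto simp: uniform_matroid_def)
  with e show "\<exists>e\<in>T - S. insert e S \<in> indep (uniform_matroid r n)" by blast
next
  fix S T :: "nat set"
  assume S: "S \<in> indep (uniform_matroid r n)" and sub: "T \<subseteq> S"
  have "finite S" using S by (simp add: uniform_matroid_def finite_subset[of S "{1..n}"])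
  then show "T \<in> indep (uniform_matroid r n)"
    using S sub card_mono[of S T] by (auto simp: uniform_matroid_def)
qed (auto simp: uniform_matroid_def)


section \<open>The augmented Bergman complex and its h-polynomial\<close>

datatype 'a bergman_vertex = UVert 'a | VVert "'a set"

text \<open>The list \<open>Fs\<close> is the flag \<open>[F\<^sub>1, \<dots>, F\<^sub>k]\<close>, possibly empty.\<close>

definition augmented_bergman :: "'a matroid \<Rightarrow> 'a bergman_vertex set set" where
  "augmented_bergman M =
     {UVert ` S \<union> VVert ` set Fs | S Fs.
        S \<in> indep M \<and> set Fs \<subseteq> proper_flats M \<and> sorted_wrt (\<subset>) Fs \<and>
        (Fs \<noteq> [] \<longrightarrow> S \<subseteq> hd Fs)}"

text \<open>For a finite complex of dimension \<open>d - 1\<close>, \<open>d\<close> is the maximal number of vertices of a face.\<close>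

definition h_polynomial :: "'v set set \<Rightarrow> rat poly" where
  "h_polynomial \<Delta> =
     (let d = Max (card ` \<Delta>)
      in \<Sum>F\<in>\<Delta>. [:0, 1:] ^ card F * (1 - [:0, 1:]) ^ (d - card F))"


section \<open>Polynomial rings over the rationals\<close>

text \<open>
  A polynomial is a finitely supported map from monomials to coefficients; a monomial is a
  finitely supported map from variables to exponents.
\<close>

type_synonym 'v rat_mpoly = "('v \<Rightarrow>\<^sub>0 nat) \<Rightarrow>\<^sub>0 rat"

definition Const :: "rat \<Rightarrow> 'v rat_mpoly" where
  "Const c = Poly_Mapping.single 0 c"

definition Var :: "'v \<Rightarrow> 'v rat_mpoly" where
  "Var v = Poly_Mapping.single (Poly_Mapping.single v 1) 1"

definition rat_poly_ring :: "'v set \<Rightarrow> 'v rat_mpoly ring" where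
  "rat_poly_ring V =
     \<lparr>carrier = {p. \<forall>m\<in>Poly_Mapping.keys p. Poly_Mapping.keys m \<subseteq> V},
      monoid.mult = (*), one = 1, zero = 0, add = (+)\<rparr>"

definition mono_degree :: "('v \<Rightarrow>\<^sub>0 nat) \<Rightarrow> nat" where
  "mono_degree m = (\<Sum>v\<in>Poly_Mapping.keys m. Poly_Mapping.lookup m v)"

definition homogeneous :: "nat \<Rightarrow> 'v rat_mpoly \<Rightarrow> bool" where
  "homogeneous j p \<longleftrightarrow> (\<forall>m\<in>Poly_Mapping.keys p. mono_degree m = j)"

lemma cring_rat_poly_ring: "cring (rat_poly_ring V :: 'v rat_mpoly ring)"
proof (rule cringI)
  let ?C = "{p :: 'v rat_mpoly. \<forall>m\<in>Poly_Mapping.keys p. Poly_Mapping.keys m \<subseteq> V}"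
  have add: "p + q \<in> ?C" if "p \<in> ?C" "q \<in> ?C" for p q
    using that Poly_Mapping.keys_add[of p q] by blast
  have mult: "p * q \<in> ?C" if p: "p \<in> ?C" and q: "q \<in> ?C" for p q
  proof clarify
    fix m v assume "m \<in> Poly_Mapping.keys (p * q)" and v: "v \<in> Poly_Mapping.keys m"
    then obtain a b where "a \<in> Poly_Mapping.keys p" "b \<in> Poly_Mapping.keys q" "m = a + b"
      using Poly_Mapping.keys_mult[of p q] by blast
    with v p q show "v \<in> V" using Poly_Mapping.keys_add[of a b] by blast
  qed
  show "abelian_group (rat_poly_ring V :: 'v rat_mpoly ring)"
  proof (rule abelian_groupI)
    fix p :: "'v rat_mpoly" assume "p \<in> carrier (rat_poly_ring V)"
    then show "\<exists>q\<in>carrier (rat_poly_ring V). q \<oplus>\<^bsub>rat_poly_ring V\<^esub> p = \<zero>\<^bsub>rat_poly_ring V\<^esub>"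
      by (intro bexI[of _ "- p"]) (simp_all add: rat_poly_ring_def)
  next
    fix p q :: "'v rat_mpoly"
    assume "p \<in> carrier (rat_poly_ring V)" "q \<in> carrier (rat_poly_ring V)"
    then show "p \<oplus>\<^bsub>rat_poly_ring V\<^esub> q \<in> carrier (rat_poly_ring V)"
      using add[of p q] by (simp add: rat_poly_ring_def)
  qed (simp_all add: rat_poly_ring_def add_ac)
  show "comm_monoid (rat_poly_ring V :: 'v rat_mpoly ring)"
  proof (rule comm_monoidI)
    fix p q :: "'v rat_mpoly"
    assume "p \<in> carrier (rat_poly_ring V)" "q \<in> carrier (rat_poly_ring V)"
    then show "p \<otimes>\<^bsub>rat_poly_ring V\<^esub> q \<in> carrier (rat_poly_ring V)"
      using mult[of p q] by (simp add: rat_poly_ring_def)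
  qed (simp_all add: rat_poly_ring_def mult_ac)
qed (simp add: rat_poly_ring_def distrib_right)


section \<open>The augmented Chow ring\<close>

datatype 'a chow_var = XVar "'a set" | YVar 'a

definition chow_poly_ring :: "'a matroid \<Rightarrow> 'a chow_var rat_mpoly ring" where
  "chow_poly_ring M = rat_poly_ring (XVar ` proper_flats M \<union> YVar ` ground M)"

definition chow_linear_rels :: "'a matroid \<Rightarrow> 'a chow_var rat_mpoly set" where
  "chow_linear_rels M =
     {Var (YVar i) - (\<Sum>F\<in>{F \<in> proper_flats M. i \<notin> F}. Var (XVar F)) | i. i \<in> ground M}"

definition chow_product_rels :: "'a matroid \<Rightarrow> 'a chow_var rat_mpoly set" where
  "chow_product_rels M =
     {Var (XVar F) * Var (XVar G) | F G.
        F \<in> proper_flats M \<and> G \<in> proper_flats M \<and> \<not> F \<subseteq> G \<and> \<not> G \<subseteq> F} \<union>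
     {Var (YVar i) * Var (XVar F) | i F. F \<in> proper_flats M \<and> i \<in> ground M - F}"

definition chow_ideal :: "'a matroid \<Rightarrow> 'a chow_var rat_mpoly set" where
  "chow_ideal M = Idl\<^bsub>chow_poly_ring M\<^esub> (chow_linear_rels M \<union> chow_product_rels M)"

definition chow_ring :: "'a matroid \<Rightarrow> 'a chow_var rat_mpoly set ring" where
  "chow_ring M = chow_poly_ring M Quot chow_ideal M"

definition chow_class :: "'a matroid \<Rightarrow> 'a chow_var rat_mpoly \<Rightarrow> 'a chow_var rat_mpoly set" where
  "chow_class M p = chow_ideal M +>\<^bsub>chow_poly_ring M\<^esub> p"

text \<open>The copy of the rational numbers inside the augmented Chow ring.\<close>

definition chow_scalars :: "'a matroid \<Rightarrow> 'a chow_var rat_mpoly set set" where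
  "chow_scalars M = chow_class M ` range Const"

definition chow_graded :: "'a matroid \<Rightarrow> nat \<Rightarrow> 'a chow_var rat_mpoly set set" where
  "chow_graded M j = chow_class M ` {p \<in> carrier (chow_poly_ring M). homogeneous j p}"

text \<open>Loops are deleted first, which changes nothing for a loopless matroid.\<close>

definition chow_hilbert_series :: "'a matroid \<Rightarrow> rat fps" where
  "chow_hilbert_series M =
     (let M' = delete M (loops M)
      in Abs_fps (\<lambda>j. of_nat
           (ring.dim (chow_ring M') (chow_scalars M') (chow_graded M' j))))"

end

theory Submission
  imports Defs
begin

text \<open>
  For a proper flat \<open>F\<close> write \<open>x\<^sub>F\<close> for its variable and, for \<open>A \<subseteq> E\<close>,
  let \<open>\<eta>\<^sub>A\<close> be the sum of the \<open>x\<^sub>F\<close> over the proper flats \<open>F\<close> not containing \<open>A\<close>, so that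
  \<open>y\<^sub>i = \<eta>({i})\<close>. The relations give
  \<open>(\<eta>\<^sub>A - \<eta>\<^bsub>A \<union> B\<^esub>) (\<eta>\<^sub>B - \<eta>\<^bsub>A \<union> B\<^esub>) = 0\<close> and
  \<open>(\<eta>\<^sub>A - \<eta>\<^sub>B) \<eta>\<^sub>B\<^sup>k = 0\<close> for \<open>A \<subseteq> B\<close> and \<open>k \<ge> rk B - rk A\<close>. Straightening with these, the ring is spanned by
  the monomials in the \<open>\<eta>\<close> of nonempty flats that form a chain
  \<open>F\<^sub>1 \<subset> \<dots> \<subset> F\<^sub>k\<close> with exponents \<open>a\<^sub>1 \<le> rk F\<^sub>1\<close> and
  \<open>a\<^sub>j < rk F\<^sub>j - rk F\<^bsub>j-1\<^esub>\<close> otherwise.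

  They are independent because of the degree map: on monomials of degree \<open>d\<close> in the \<open>\<eta>\<^sub>A\<close> it is \<open>1\<close> if
  the sets \<open>A\<close> satisfy Hall's condition and \<open>0\<close> otherwise. Submodularity shows that
  this functional vanishes on the ideal, and suitable products of differences
  \<open>\<eta>(F\<^sub>j) - \<eta>(F\<^bsub>j-1\<^esub>)\<close> pair unitriangularly with the monomials.

  Removing the largest member of a chain gives recursions for both sides of the identity; the two
  recursively defined sequences are related by the binomial transform.
\<close>

section \<open>The identity between the two recursions\<close>

text \<open>Spanning bounds the dimensions of the graded pieces only from above; a lower bound needs
  a functional that vanishes on an ideal known only by its generators. The functional is therefore
  defined on the free monoid algebra of multisets of sets, where the variables are sent, and the
  elements all of whose multiples have degree 0 are considered. They form an ideal, so that
  generators suffice, and degrees below \<open>d\<close> are reached although the functional lives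
  in degree \<open>d\<close> only.

  Hall's condition enters because \<open>d\<close> subsets of \<open>E\<close> have distinct
  representatives exactly when it holds, and every \<open>d\<close>-subset of \<open>E\<close> is a
  basis of the uniform matroid.

  Below a proper flat the uniform matroid is Boolean, so both recursions concern Boolean chains, and
  the rank \<open>d\<close> matters only at the top. Their solutions are the Eulerian and the
  binomial Eulerian polynomials. The identity is proved over a field with \<open>x\<close> different
  from \<open>1\<close>, because a factor \<open>x - 1\<close> is cancelled; the Laurent variable is
  such an \<open>x\<close> and is moreover invertible.\<close>

lemma binomial_convolution:
  fixes b :: "nat \<Rightarrow> 'a::comm_ring_1"
  shows "(\<Sum>s\<le>r. of_nat (r choose s) * (\<Sum>q\<le>s. of_nat (s choose q) * b q) * y ^ (r - s)) =
         (\<Sum>q\<le>r. of_nat (r choose q) * b q * (1 + y) ^ (r - q))"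
proof -
  have "(\<Sum>s\<le>r. of_nat (r choose s) * (\<Sum>q\<le>s. of_nat (s choose q) * b q) * y ^ (r - s)) =
        (\<Sum>s\<le>r. \<Sum>q\<le>s. of_nat (r choose s) * (of_nat (s choose q) * b q) * y ^ (r - s))"
    by (simp add: sum_distrib_left sum_distrib_right mult.assoc)
  also have "\<dots> = (\<Sum>q\<le>r. \<Sum>s\<in>{q..r}. of_nat (r choose s) * (of_nat (s choose q) * b q) * y ^ (r - s))"
    unfolding sum.Sigma[OF finite_atMost ballI[OF finite_atMost]] sum.Sigma[OF finite_atMost ballI[OF finite_atLeastAtMost]]
    by (rule sum.reindex_bij_witness[of _ prod.swap prod.swap]) auto
  \<comment> \<open>Trinomial revision factors the coefficient, and the sum over \<open>s\<close>
    becomes a binomial expansion. For exponential generating functions this says that the factors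
    exp(t) and exp(yt) multiply to exp((1+y)t).\<close>
  also have "\<dots> = (\<Sum>q\<le>r. of_nat (r choose q) * b q * (1 + y) ^ (r - q))"
  proof (rule sum.cong[OF refl])
    fix q assume "q \<in> {..r}"
    then have q: "q \<le> r" by simp
    have "(\<Sum>s\<in>{q..r}. of_nat (r choose s) * (of_nat (s choose q) * b q) * y ^ (r - s)) =
          (\<Sum>k\<le>r - q. of_nat (r choose (q + k)) * (of_nat ((q + k) choose q) * b q) * y ^ (r - (q + k)))"
      using q by (intro sum.reindex_bij_witness[of _ "\<lambda>k. q + k" "\<lambda>s. s - q"]) auto
    also have "\<dots> = (\<Sum>k\<le>r - q. of_nat (r choose q) * b q * (of_nat ((r - q) choose k) * 1 ^ k * y ^ (r - q - k)))"
    proof (rule sum.cong[OF refl])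
      fix k assume k: "k \<in> {..r - q}"
      then have "(r choose (q + k)) * ((q + k) choose q) = (r choose q) * ((r - q) choose k)"
        using choose_mult[of q "q + k" r] q by simp
      then have "of_nat (r choose (q + k)) * of_nat ((q + k) choose q) =
          (of_nat (r choose q) * of_nat ((r - q) choose k) :: 'a)"
        by (metis of_nat_mult)
      then show "of_nat (r choose (q + k)) * (of_nat ((q + k) choose q) * b q) * y ^ (r - (q + k)) =
          of_nat (r choose q) * b q * (of_nat ((r - q) choose k) * 1 ^ k * y ^ (r - q - k))"
        by (simp add: mult_ac)
    qed
    also have "\<dots> = of_nat (r choose q) * b q * (1 + y) ^ (r - q)"
      by (simp add: binomial_ring sum_distrib_left)
    finally show "(\<Sum>s\<in>{q..r}. of_nat (r choose s) * (of_nat (s choose q) * b q) * y ^ (r - s)) =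
          of_nat (r choose q) * b q * (1 + y) ^ (r - q)" .
  qed
  finally show ?thesis .
qed

text \<open>Multiplication by \<open>x - 1\<close> turns the geometric sum in the recurrence of
  \<open>b\<close> into \<open>x ^ (r - s) - x\<close>. The part with \<open>- x\<close> collects to
  the transform \<open>B\<close>; the part with \<open>x ^ (r - s)\<close> is the transform of
  \<open>B\<close> itself with weights \<open>(x - 1) ^ (r - s)\<close>. Hence \<open>B\<close>
  satisfies the recurrence of \<open>c\<close> multiplied by \<open>x - 1\<close>.\<close>

lemma binomial_transform_of_recurrence:
  fixes x :: "'a::field"
  assumes b: "\<And>r. b r = x ^ r + (\<Sum>s<r. of_nat (r choose s) * b s * (x * (\<Sum>k<r - s - 1. x ^ k)))"
    and c: "\<And>r. c r = x ^ r + (\<Sum>s<r. of_nat (r choose s) * c s * (x - 1) ^ (r - s - 1))"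
    and x: "x \<noteq> 1"
  shows "c r = (\<Sum>s\<le>r. of_nat (r choose s) * b s)"
proof -
  define B where "B r = (\<Sum>s\<le>r. of_nat (r choose s) * b s)" for r
  have geo: "(x - 1) * (x * (\<Sum>k<r - s - 1. x ^ k)) = x ^ (r - s) - x" if "s < r" for r s
  proof -
    have "(x - 1) * (x * (\<Sum>k<r - s - 1. x ^ k)) = x * (x ^ (r - s - 1) - 1)"
      by (simp add: power_diff_1_eq mult_ac)
    also have "\<dots> = x ^ (r - s) - x"
      using that by (cases "r - s") (auto simp: algebra_simps)
    finally show ?thesis .
  qed
  have upto: "(\<Sum>s\<le>r. f s) = (\<Sum>s<r. f s) + f r" for f :: "nat \<Rightarrow> 'a" and r
    by (simp add: lessThan_Suc_atMost[symmetric])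
  have B: "x * B r = (x - 1) * x ^ r + (\<Sum>s\<le>r. of_nat (r choose s) * b s * x ^ (r - s))" for r
  proof -
    have "(x - 1) * b r = (x - 1) * x ^ r +
        (\<Sum>s<r. of_nat (r choose s) * b s * ((x - 1) * (x * (\<Sum>k<r - s - 1. x ^ k))))"
      by (subst b) (simp add: distrib_left sum_distrib_left mult_ac)
    also have "\<dots> = (x - 1) * x ^ r + (\<Sum>s<r. of_nat (r choose s) * b s * (x ^ (r - s) - x))"
      by (intro arg_cong2[of _ _ _ _ "(+)"] sum.cong refl, subst geo) auto
    finally have "(x - 1) * b r = (x - 1) * x ^ r
        + (\<Sum>s<r. of_nat (r choose s) * b s * x ^ (r - s)) - x * (\<Sum>s<r. of_nat (r choose s) * b s)"
      by (simp add: right_diff_distrib sum_subtractf sum_distrib_left mult_ac)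
    then show ?thesis by (simp add: B_def upto algebra_simps)
  qed
  \<comment> \<open>The convolution is used at \<open>y = x - 1\<close>, where
    \<open>1 + y = x\<close>. The term \<open>s = r\<close> of the sum is \<open>B r\<close>, and
    moving it to the left changes the factor \<open>x\<close> into \<open>x - 1\<close>.\<close>
  have rec: "(x - 1) * B r = (x - 1) * x ^ r + (\<Sum>s<r. of_nat (r choose s) * B s * (x - 1) ^ (r - s))" for r
  proof -
    have "(\<Sum>s\<le>r. of_nat (r choose s) * B s * (x - 1) ^ (r - s)) =
        (\<Sum>s\<le>r. of_nat (r choose s) * b s * x ^ (r - s))"
      using binomial_convolution[of r b "x - 1"] unfolding B_def by simp
    then show ?thesis
      using B[of r] upto[of "\<lambda>s. of_nat (r choose s) * B s * (x - 1) ^ (r - s)" r]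
      by (simp add: algebra_simps)
  qed
  have "c r = B r"
  proof (induction r rule: less_induct)
    case (less r)
    have "(x - 1) * c r = (x - 1) * x ^ r + (\<Sum>s<r. of_nat (r choose s) * c s * ((x - 1) * (x - 1) ^ (r - s - 1)))"
      by (subst c) (simp add: distrib_left sum_distrib_left mult_ac)
    also have "(\<Sum>s<r. of_nat (r choose s) * c s * ((x - 1) * (x - 1) ^ (r - s - 1))) =
        (\<Sum>s<r. of_nat (r choose s) * B s * (x - 1) ^ (r - s))"
    proof (rule sum.cong[OF refl])
      fix s assume "s \<in> {..<r}"
      then have "s < r" by simp
      then have "(x - 1) * (x - 1) ^ (r - s - 1) = (x - 1) ^ (r - s)"
        by (metis power_Suc Suc_pred' diff_diff_left zero_less_diff diff_Suc_1 plus_1_eq_Suc Suc_diff_Suc diff_Suc_eq_diff_pred)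
      then show "of_nat (r choose s) * c s * ((x - 1) * (x - 1) ^ (r - s - 1)) =
          of_nat (r choose s) * B s * (x - 1) ^ (r - s)"
        using less[OF \<open>s < r\<close>] by simp
    qed
    finally have "(x - 1) * c r = (x - 1) * B r" by (simp only: rec)
    then show ?case using x by simp
  qed
  then show ?thesis by (simp add: B_def)
qed

text \<open>The rule for partial binomial sums with top \<open>d + (n - d)\<close>, taken at
  \<open>1\<close> and \<open>x - 1\<close>, whose sum is \<open>x\<close>. The generalized binomial
  keeps the formula uniform for \<open>i = d = n\<close>, where the upper entry is \<open>-1\<close>
  and the value is \<open>1\<close>.\<close>

lemma truncated_binomial_sum:
  fixes x :: "'a::field_char_0"
  assumes "d \<le> n"
  shows "(\<Sum>s\<le>d. of_nat (n choose s) * (x - 1) ^ (d - s)) =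
         (\<Sum>i\<le>d. ((of_nat n - of_nat i - 1) gchoose (d - i)) * x ^ i)"
proof -
  have "(\<Sum>s\<le>d. of_nat (n choose s) * (x - 1) ^ (d - s)) =
        (\<Sum>k\<le>d. (of_nat d + (of_nat n - of_nat d) gchoose k) * 1 ^ k * (x - 1) ^ (d - k))"
    by (simp add: binomial_gbinomial)
  also have "\<dots> = (\<Sum>k\<le>d. (of_nat k + (of_nat n - of_nat d) - 1 gchoose k) * x ^ (d - k))"
    by (subst gbinomial_partial_sum_poly_xpos) simp
  also have "\<dots> = (\<Sum>i\<le>d. ((of_nat n - of_nat i - 1) gchoose (d - i)) * x ^ i)"
    by (rule sum.reindex_bij_witness[of _ "\<lambda>i. d - i" "\<lambda>i. d - i"])
       (auto simp: of_nat_diff algebra_simps)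
  finally show ?thesis .
qed

text \<open>Parallel summation, read from \<open>i = d\<close> downwards; it lowers the rank in the
  coefficients from \<open>d\<close> to \<open>d - 1\<close>.\<close>

lemma gchoose_sum:
  assumes "l < d" "d \<le> n"
  shows "(\<Sum>i=Suc l..d. ((of_nat n - of_nat i - 1 :: 'a::field_char_0) gchoose (d - i))) =
         ((of_nat n - of_nat l - 1) gchoose (d - 1 - l))"
proof -
  have "(\<Sum>i=Suc l..d. ((of_nat n - of_nat i - 1 :: 'a) gchoose (d - i))) =
        (\<Sum>k\<le>d - 1 - l. ((of_nat n - of_nat d - 1) + of_nat k gchoose k))"
    using assms by (intro sum.reindex_bij_witness[of _ "\<lambda>k. d - k" "\<lambda>i. d - i"])
      (auto simp: of_nat_diff algebra_simps)
  also have "\<dots> = (of_nat n - of_nat d - 1 + of_nat (d - 1 - l) + 1 gchoose (d - 1 - l))"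
    by (rule gbinomial_parallel_sum)
  finally show ?thesis using assms by (simp add: of_nat_diff algebra_simps)
qed

text \<open>After expansion of the geometric sums the coefficient of \<open>x ^ k\<close> collects
  all \<open>i > k\<close>, and parallel summation makes it the coefficient for rank
  \<open>d - 1\<close>. Geometric sums are what the multiplicities of the top flat produce on the
  Chow side.\<close>

lemma truncated_binomial_sum_geometric:
  fixes x :: "'a::field_char_0"
  assumes "d \<le> n"
  shows "(\<Sum>r<d. of_nat (n choose r) * (x - 1) ^ (d - r - 1)) =
         (\<Sum>i\<le>d. ((of_nat n - of_nat i - 1) gchoose (d - i)) * (\<Sum>k<i. x ^ k))"
proof (cases d)
  case 0 then show ?thesis by simp
next
  case (Suc e)
  have "(\<Sum>i\<le>d. ((of_nat n - of_nat i - 1) gchoose (d - i)) * (\<Sum>k<i. x ^ k)) =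
        (\<Sum>i\<le>d. \<Sum>k<i. ((of_nat n - of_nat i - 1) gchoose (d - i)) * x ^ k)"
    by (simp add: sum_distrib_left)
  also have "\<dots> = (\<Sum>k<d. \<Sum>i=Suc k..d. ((of_nat n - of_nat i - 1) gchoose (d - i)) * x ^ k)"
    unfolding sum.Sigma[OF finite_atMost ballI[OF finite_lessThan]] sum.Sigma[OF finite_lessThan ballI[OF finite_atLeastAtMost]]
    by (rule sum.reindex_bij_witness[of _ prod.swap prod.swap]) auto
  also have "\<dots> = (\<Sum>k<d. ((of_nat n - of_nat k - 1) gchoose (d - 1 - k)) * x ^ k)"
    by (rule sum.cong[OF refl], subst sum_distrib_right[symmetric], subst gchoose_sum)
       (use assms in auto)
  also have "\<dots> = (\<Sum>r<d. of_nat (n choose r) * (x - 1) ^ (d - r - 1))"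
    using truncated_binomial_sum[of e n x] Suc assms by (simp add: lessThan_Suc_atMost)
  finally show ?thesis by simp
qed

text \<open>Apart from the pure powers of \<open>x\<close>, both sides are compared as combinations
  of the terms \<open>of_nat (n choose s) * b s\<close>. The left side gets this shape by writing
  \<open>c\<close> as the transform of \<open>b\<close>; the coefficient of such a term is then a
  truncated binomial sum for \<open>n - s\<close> and \<open>d - s\<close>.\<close>

theorem chain_sum_identity:
  fixes x :: "'a::field_char_0"
  assumes b: "\<And>r. b r = x ^ r + (\<Sum>s<r. of_nat (r choose s) * b s * (x * (\<Sum>k<r - s - 1. x ^ k)))"
    and c: "\<And>r. c r = x ^ r + (\<Sum>s<r. of_nat (r choose s) * c s * (x - 1) ^ (r - s - 1))"
    and x: "x \<noteq> 1" and dn: "d \<le> n"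
  shows "(\<Sum>s\<le>d. of_nat (n choose s) * (x - 1) ^ (d - s)) +
           (\<Sum>r<d. of_nat (n choose r) * c r * (x - 1) ^ (d - r - 1)) =
         (\<Sum>i\<le>d. ((of_nat n - of_nat i - 1) gchoose (d - i)) *
           (x ^ i + (\<Sum>r<i. of_nat (n choose r) * b r * (\<Sum>k<i - r. x ^ k))))"
proof -
  let ?g = "\<lambda>i. (of_nat n - of_nat i - 1 :: 'a) gchoose (d - i)"
  have "(\<Sum>r<d. of_nat (n choose r) * c r * (x - 1) ^ (d - r - 1)) =
        (\<Sum>r<d. \<Sum>s\<le>r. of_nat (n choose s) * b s * (of_nat ((n - s) choose (r - s)) * (x - 1) ^ (d - r - 1)))"
  proof (rule sum.cong[OF refl])
    fix r assume r: "r \<in> {..<d}"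
    have "of_nat (n choose r) * c r * (x - 1) ^ (d - r - 1) =
        (\<Sum>s\<le>r. of_nat (n choose r) * of_nat (r choose s) * b s * (x - 1) ^ (d - r - 1))"
      unfolding binomial_transform_of_recurrence[OF b c x, of r]
      by (simp add: sum_distrib_left sum_distrib_right mult.assoc)
    also have "\<dots> = (\<Sum>s\<le>r. of_nat (n choose s) * b s * (of_nat ((n - s) choose (r - s)) * (x - 1) ^ (d - r - 1)))"
    proof (rule sum.cong[OF refl])
      fix s assume s: "s \<in> {..r}"
      have "(n choose r) * (r choose s) = (n choose s) * ((n - s) choose (r - s))"
        using choose_mult[of s r n] r s dn by simp
      then have "of_nat (n choose r) * of_nat (r choose s) = (of_nat (n choose s) * of_nat ((n - s) choose (r - s)) :: 'a)"
        by (metis of_nat_mult)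
      then show "of_nat (n choose r) * of_nat (r choose s) * b s * (x - 1) ^ (d - r - 1) =
         of_nat (n choose s) * b s * (of_nat ((n - s) choose (r - s)) * (x - 1) ^ (d - r - 1))"
        by (simp add: mult_ac)
    qed
    finally show "of_nat (n choose r) * c r * (x - 1) ^ (d - r - 1) =
      (\<Sum>s\<le>r. of_nat (n choose s) * b s * (of_nat ((n - s) choose (r - s)) * (x - 1) ^ (d - r - 1)))" .
  qed
  also have "\<dots> = (\<Sum>s<d. \<Sum>r\<in>{s..<d}. of_nat (n choose s) * b s * (of_nat ((n - s) choose (r - s)) * (x - 1) ^ (d - r - 1)))"
    unfolding sum.Sigma[OF finite_lessThan ballI[OF finite_atMost]] sum.Sigma[OF finite_lessThan ballI[OF finite_atLeastLessThan]]
    by (rule sum.reindex_bij_witness[of _ prod.swap prod.swap]) auto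
  also have "\<dots> = (\<Sum>s<d. of_nat (n choose s) * b s * (\<Sum>i=Suc s..d. ?g i * (\<Sum>k<i - s. x ^ k)))"
  proof (rule sum.cong[OF refl])
    fix s assume "s \<in> {..<d}"
    then have s: "s < d" by simp
    have "(\<Sum>r\<in>{s..<d}. of_nat (n choose s) * b s * (of_nat ((n - s) choose (r - s)) * (x - 1) ^ (d - r - 1))) =
       of_nat (n choose s) * b s * (\<Sum>r<d - s. of_nat ((n - s) choose r) * (x - 1) ^ (d - s - r - 1))"
      unfolding sum_distrib_left
      by (rule sum.reindex_bij_witness[of _ "\<lambda>r. s + r" "\<lambda>r. r - s"]) auto
    also have "(\<Sum>r<d - s. of_nat ((n - s) choose r) * (x - 1) ^ (d - s - r - 1)) =
        (\<Sum>i\<le>d - s. ((of_nat (n - s) - of_nat i - 1) gchoose (d - s - i)) * (\<Sum>k<i. x ^ k))"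
      by (rule truncated_binomial_sum_geometric) (use dn in auto)
    \<comment> \<open>The term \<open>i = 0\<close> has an empty geometric sum; without it the shift
      by \<open>s\<close> is a bijection onto the range from \<open>Suc s\<close> to
      \<open>d\<close>.\<close>
    also have "\<dots> = (\<Sum>i\<in>{1..d - s}. ((of_nat (n - s) - of_nat i - 1) gchoose (d - s - i)) * (\<Sum>k<i. x ^ k))"
      by (rule sum.mono_neutral_right) (auto simp: Suc_le_eq)
    also have "\<dots> = (\<Sum>i=Suc s..d. ?g i * (\<Sum>k<i - s. x ^ k))"
      using s dn by (intro sum.reindex_bij_witness[of _ "\<lambda>r. r - s" "\<lambda>r. s + r"])
        (auto simp: of_nat_diff algebra_simps)
    finally show "(\<Sum>r\<in>{s..<d}. of_nat (n choose s) * b s * (of_nat ((n - s) choose (r - s)) * (x - 1) ^ (d - r - 1))) =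
       of_nat (n choose s) * b s * (\<Sum>i=Suc s..d. ?g i * (\<Sum>k<i - s. x ^ k))" .
  qed
  also have "\<dots> = (\<Sum>s<d. \<Sum>i=Suc s..d. ?g i * (of_nat (n choose s) * b s * (\<Sum>k<i - s. x ^ k)))"
    by (rule sum.cong[OF refl], subst sum_distrib_left, rule sum.cong[OF refl], simp only: mult_ac)
  also have "\<dots> = (\<Sum>i\<le>d. \<Sum>s<i. ?g i * (of_nat (n choose s) * b s * (\<Sum>k<i - s. x ^ k)))"
    unfolding sum.Sigma[OF finite_atMost ballI[OF finite_lessThan]] sum.Sigma[OF finite_lessThan ballI[OF finite_atLeastAtMost]]
    by (rule sum.reindex_bij_witness[of _ prod.swap prod.swap]) auto
  finally show ?thesis
    unfolding truncated_binomial_sum[OF dn]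
    by (simp add: distrib_left sum.distrib sum_distrib_left)
qed

section \<open>Faces of the augmented Bergman complex\<close>

lemma mrank_uniform:
  assumes "X \<subseteq> {1..n}"
  shows "mrank (uniform_matroid d n) X = min d (card X)"
  unfolding mrank_def
proof (rule Max_eqI)
  have fin: "finite X" using assms finite_subset by blast
  have "{S \<in> indep (uniform_matroid d n). S \<subseteq> X} \<subseteq> Pow X" by auto
  then show "finite (card ` {S \<in> indep (uniform_matroid d n). S \<subseteq> X})"
    using fin finite_subset by blast
  show "y \<le> min d (card X)" if "y \<in> card ` {S \<in> indep (uniform_matroid d n). S \<subseteq> X}" for y
    using that fin by (auto simp: uniform_matroid_def card_mono)
  obtain S where "S \<subseteq> X" "card S = min d (card X)"
    using obtain_subset_with_card_n[of "min d (card X)" X] by auto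
  then show "min d (card X) \<in> card ` {S \<in> indep (uniform_matroid d n). S \<subseteq> X}"
    using assms by (auto simp: uniform_matroid_def intro!: image_eqI[of _ _ S])
qed

text \<open>A set with fewer than \<open>d\<close> elements gains rank with every new element, while
  one with at least \<open>d\<close> elements already spans. \<open>d \<le> n\<close> keeps the
  ground set out of the sets of size below \<open>d\<close>.\<close>

lemma proper_flats_uniform:
  assumes "d \<le> n"
  shows "proper_flats (uniform_matroid d n) = {F. F \<subseteq> {1..n} \<and> card F < d}"
proof -
  let ?M = "uniform_matroid d n"
  have g: "ground ?M = {1..n}" by (simp add: uniform_matroid_def)
  have cl: "mclosure ?M F = (if card F < d then F else {1..n})" if F: "F \<subseteq> {1..n}" for F
  proof -
    have fin: "finite F" using F finite_subset by blast
    have "mrank ?M (insert e F) = mrank ?M F \<longleftrightarrow> e \<in> F \<or> d \<le> card F" if "e \<in> {1..n}" for e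
    proof -
      have "insert e F \<subseteq> {1..n}" using that F by blast
      then show ?thesis
        using fin F by (auto simp: mrank_uniform card_insert_if min_def)
    qed
    then show ?thesis using F by (auto simp: mclosure_def g)
  qed
  have "{1..n} \<noteq> F" if "card F < d" for F using that assms by auto
  then show ?thesis
    unfolding proper_flats_def flats_def g using cl by (auto split: if_splits)
qed

lemma chain_Union_mem:
  assumes "finite C" "C \<noteq> {}" "chain_subset C"
  shows "\<Union>C \<in> C"
proof -
  obtain M where M: "M \<in> C" "\<And>B. B \<in> C \<Longrightarrow> M \<subseteq> B \<Longrightarrow> M = B"
    using finite_has_maximal[OF assms(1,2)] by metis
  then have "B \<subseteq> M" if "B \<in> C" for B using assms(3) that unfolding chain_subset_def by blast
  then have "\<Union>C = M" using M by blast
  with M show ?thesis by simp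
qed

lemma chain_subset_mono: "chain_subset C \<Longrightarrow> D \<subseteq> C \<Longrightarrow> chain_subset D"
  unfolding chain_subset_def by blast

lemma chain_sorted_list:
  assumes "finite C" "chain_subset C"
  shows "\<exists>Fs. set Fs = C \<and> sorted_wrt (\<subset>) Fs"
  using assms
proof (induction C rule: finite_psubset_induct)
  case (psubset C)
  show ?case
  proof (cases "C = {}")
    case True then show ?thesis by (intro exI[of _ "[]"]) auto
  next
    case False
    let ?M = "\<Union>C"
    have M: "?M \<in> C" using chain_Union_mem psubset False by blast
    then obtain Fs where Fs: "set Fs = C - {?M}" "sorted_wrt (\<subset>) Fs"
      using psubset.IH[of "C - {?M}"] psubset.prems chain_subset_mono[of C "C - {?M}"] by blast
    then have "set (Fs @ [?M]) = C \<and> sorted_wrt (\<subset>) (Fs @ [?M])"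
      using M by (auto simp: sorted_wrt_append)
    then show ?thesis by blast
  qed
qed

text \<open>Cardinality is injective on a chain of finite sets.\<close>

lemma card_chain_le:
  assumes "chain_subset C" "\<And>A. A \<in> C \<Longrightarrow> finite A \<and> m \<le> card A \<and> card A < d"
  shows "card C \<le> d - m"
proof -
  have "inj_on card C"
    using assms unfolding inj_on_def chain_subset_def by (metis card_subset_eq)
  then have "card C = card (card ` C)" by (simp add: card_image)
  also have "\<dots> \<le> card {m..<d}" by (rule card_mono) (use assms in auto)
  finally show ?thesis by simp
qed

lemma sum_subsets_by_card:
  fixes f :: "nat \<Rightarrow> 'a::comm_ring_1"
  assumes "finite A" "finite K"
  shows "(\<Sum>B | B \<subseteq> A \<and> card B \<in> K. f (card B)) = (\<Sum>k\<in>K. of_nat (card A choose k) * f k)"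
proof -
  have "(\<Sum>B | B \<subseteq> A \<and> card B \<in> K. f (card B)) =
      (\<Sum>k\<in>K. \<Sum>B\<in>{B \<in> {B. B \<subseteq> A \<and> card B \<in> K}. card B = k}. f (card B))"
    using assms by (intro sum.group[symmetric]) auto
  also have "\<dots> = (\<Sum>k\<in>K. of_nat (card A choose k) * f k)"
  proof (rule sum.cong[OF refl])
    fix k assume k: "k \<in> K"
    have "(\<Sum>B\<in>{B \<in> {B. B \<subseteq> A \<and> card B \<in> K}. card B = k}. f (card B)) =
        (\<Sum>B | B \<subseteq> A \<and> card B = k. f k)"
      by (rule sum.cong) (use k in auto)
    also have "\<dots> = of_nat (card A choose k) * f k"
      using n_subsets[OF assms(1), of k] by simp
    finally show "(\<Sum>B\<in>{B \<in> {B. B \<subseteq> A \<and> card B \<in> K}. card B = k}. f (card B)) =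
      of_nat (card A choose k) * f k" .
  qed
  finally show ?thesis .
qed

text \<open>The binomial Eulerian polynomials \<open>1\<close>, \<open>1 + x\<close>,
  \<open>1 + 3 x + x^2\<close>, and so on. \<open>chain_poly x r\<close> is the reversed
  h-polynomial of the augmented Bergman complex of the Boolean matroid on \<open>r\<close>
  elements.\<close>

fun chain_poly :: "'a::comm_ring_1 \<Rightarrow> nat \<Rightarrow> 'a" where
  "chain_poly x r = x ^ r + (\<Sum>s<r. of_nat (r choose s) * chain_poly x s * (x - 1) ^ (r - s - 1))"

declare chain_poly.simps [simp del]

text \<open>The member \<open>F\<close> is an artificial top: without it, the pairs are exactly the
  faces of the augmented Bergman complex of the Boolean matroid on \<open>F\<close>. Keeping it lets
  flags be grouped by their largest member.\<close>

definition flags_to :: "'a set \<Rightarrow> ('a set \<times> 'a set set) set" where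
  "flags_to F = {(S, C). C \<subseteq> Pow F \<and> F \<in> C \<and> chain_subset C \<and> (\<forall>G\<in>C. S \<subseteq> G)}"

lemma finite_flags_to: "finite F \<Longrightarrow> finite (flags_to F)"
  by (rule finite_subset[of _ "Pow F \<times> Pow (Pow F)"]) (auto simp: flags_to_def)

text \<open>The first summand comes from the flags with \<open>F\<close> as only member and
  \<open>S\<close> an arbitrary subset. In all others \<open>G\<close> is the second largest member,
  and removing \<open>F\<close> leaves a flag to \<open>G\<close> at the price of one factor
  \<open>u\<close>.\<close>

lemma flags_to_sum_rec:
  fixes u :: "'a::field"
  assumes "finite F"
  shows "(\<Sum>(S, C)\<in>flags_to F. u ^ (card S + card C)) =
     u * (1 + u) ^ card F + u * (\<Sum>G | G \<subset> F. \<Sum>(S, C)\<in>flags_to G. u ^ (card S + card C))"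
proof -
  let ?f = "\<lambda>(S, C). u ^ (card S + card C)"
  define X0 where "X0 = (\<lambda>S. (S, {F})) ` Pow F"
  define X1 where "X1 = flags_to F - X0"
  have sub: "X0 \<subseteq> flags_to F" by (auto simp: X0_def flags_to_def chain_subset_def)
  have "sum ?f (flags_to F) = sum ?f X1 + sum ?f X0"
    unfolding X1_def by (rule sum.subset_diff[OF sub finite_flags_to[OF assms]])
  moreover have "sum ?f X0 = u * (1 + u) ^ card F"
  proof -
    have "sum ?f X0 = (\<Sum>S\<in>Pow F. u ^ (card S + 1))"
      unfolding X0_def by (subst sum.reindex) (auto simp: inj_on_def)
    also have "\<dots> = u * (\<Sum>S | S \<subseteq> F \<and> card S \<in> {..card F}. u ^ card S)"
      using assms by (auto simp: sum_distrib_left card_mono intro!: sum.cong)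
    also have "\<dots> = u * (1 + u) ^ card F"
      using binomial_ring[of u 1 "card F"]
      by (subst sum_subsets_by_card[OF assms]) (auto simp: add.commute)
    finally show ?thesis .
  qed
  moreover have "sum ?f X1 = u * (\<Sum>G | G \<subset> F. sum ?f (flags_to G))"
  proof -
    have fin: "finite {G. G \<subset> F}" using assms by (auto intro: finite_subset[of _ "Pow F"])
    have finG: "finite G" if "G \<subset> F" for G using that assms finite_subset by blast
    have "(\<Sum>G | G \<subset> F. sum ?f (flags_to G)) = (\<Sum>(G, p)\<in>Sigma {G. G \<subset> F} flags_to. ?f p)"
      using fin finG finite_flags_to by (subst sum.Sigma) auto
    then have "u * (\<Sum>G | G \<subset> F. sum ?f (flags_to G)) = (\<Sum>(G, p)\<in>Sigma {G. G \<subset> F} flags_to. u * ?f p)"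
      by (simp add: sum_distrib_left case_prod_unfold)
    also have "\<dots> = sum ?f X1"
    proof (rule sum.reindex_bij_witness[of _ "\<lambda>(S, C). (\<Union>(C - {F}), (S, C - {F}))" "\<lambda>(G, (S, C)). (S, insert F C)"])
      fix a assume a': "a \<in> Sigma {G. G \<subset> F} flags_to"
      obtain G S C where a: "a = (G, S, C)" by (cases a) auto
      have G: "G \<subset> F" and "(S, C) \<in> flags_to G" using a' a by simp_all
      then have C: "C \<subseteq> Pow G" "G \<in> C" "chain_subset C" "\<forall>H\<in>C. S \<subseteq> H"
        unfolding flags_to_def by simp_all
      have F: "F \<notin> C" using G C by auto
      have "finite C" using C finG[OF G] finite_subset by blast
      have U: "\<Union>C = G" using C by auto
      show "(case (case a of (G, S, C) \<Rightarrow> (S, insert F C)) of (S, C) \<Rightarrow> (\<Union>(C - {F}), S, C - {F})) = a"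
        using a F U by simp
      have CF: "\<forall>H\<in>C. H \<subseteq> F" using C(1) G by auto
      then have "insert F C \<subseteq> Pow F" by auto
      moreover have "S \<subseteq> F" using C(2,4) CF by auto
      moreover have "chain_subset (insert F C)" using C(3) CF unfolding chain_subset_def by simp
      moreover have "insert F C \<noteq> {F}" using C(2) G by auto
      ultimately show "(case a of (G, S, C) \<Rightarrow> (S, insert F C)) \<in> X1"
        using a C(4) unfolding X1_def X0_def flags_to_def by auto
      show "(case (case a of (G, S, C) \<Rightarrow> (S, insert F C)) of (S, C) \<Rightarrow> u ^ (card S + card C)) =
          (case a of (G, p) \<Rightarrow> u * (case p of (S, C) \<Rightarrow> u ^ (card S + card C)))"
        using a F \<open>finite C\<close> by simp
    next
      fix b assume b1: "b \<in> X1"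
      obtain S C where b: "b = (S, C)" by (cases b) auto
      have SC: "(S, C) \<in> flags_to F" "(S, C) \<notin> X0" using b1 b by (simp_all add: X1_def)
      have C: "C \<subseteq> Pow F" "F \<in> C" "chain_subset C" "\<forall>H\<in>C. S \<subseteq> H"
        using SC(1) by (simp_all add: flags_to_def)
      have "C \<noteq> {F}"
      proof
        assume "C = {F}"
        then have "(S, C) \<in> X0" using C(4) by (simp add: X0_def)
        with SC(2) show False by simp
      qed
      then have ne: "C - {F} \<noteq> {}" using C(2) by auto
      have "finite C" using C(1) assms finite_subset[of C "Pow F"] by simp
      moreover have ch: "chain_subset (C - {F})" by (rule chain_subset_mono[OF C(3)]) simp
      ultimately have U: "\<Union>(C - {F}) \<in> C - {F}"
        using chain_Union_mem[of "C - {F}"] ne by simp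
      define G where "G = \<Union>(C - {F})"
      have "G \<subset> F" using C(1) U unfolding G_def[symmetric] by auto
      moreover have "(S, C - {F}) \<in> flags_to G"
        using U C(4) ch unfolding flags_to_def G_def[symmetric] by (auto simp: G_def)
      ultimately show "(case b of (S, C) \<Rightarrow> (\<Union>(C - {F}), S, C - {F})) \<in> Sigma {G. G \<subset> F} flags_to"
        using b by (simp flip: G_def)
      show "(case (case b of (S, C) \<Rightarrow> (\<Union>(C - {F}), S, C - {F})) of (G, S, C) \<Rightarrow> (S, insert F C)) = b"
        using b C(2) by (simp add: insert_absorb)
    qed
    finally show ?thesis by simp
  qed
  ultimately show ?thesis by simp
qed

text \<open>Since \<open>card F + 1\<close> is the largest value of \<open>card S + card C\<close>,
  the prefactor clears all denominators. With \<open>u\<close> the inverse of \<open>x - 1\<close>,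
  the product of \<open>x - 1\<close> and \<open>1 + u\<close> is \<open>x\<close>, whence the
  summand \<open>x ^ card F\<close>.\<close>

lemma flags_to_sum:
  fixes x :: "'a::field"
  assumes "finite F" "x \<noteq> 1"
  shows "(x - 1) ^ (card F + 1) * (\<Sum>(S, C)\<in>flags_to F. inverse (x - 1) ^ (card S + card C)) =
         chain_poly x (card F)"
  using assms(1)
proof (induction F rule: finite_psubset_induct)
  case (psubset F)
  let ?t = "x - 1"
  let ?s = "\<lambda>F::'b set. \<Sum>(S, C)\<in>flags_to F. inverse ?t ^ (card S + card C)"
  have t: "?t \<noteq> 0" using assms by simp
  have ps: "{G. G \<subset> F} = {G. G \<subseteq> F \<and> card G \<in> {..<card F}}"
    using psubset_card_mono[OF psubset.hyps] by auto
  have cancel: "?t ^ (k + 1) * (inverse ?t * a + inverse ?t * b) = ?t ^ k * a + ?t ^ k * b" for k a b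
      proof -
    have "?t ^ (k + 1) * (inverse ?t * a + inverse ?t * b) = (?t * inverse ?t) * (?t ^ k * a + ?t ^ k * b)"
      by (simp only: power_add power_one_right distrib_left mult_ac)
    also have "?t * inverse ?t = 1" using t by simp
    finally show ?thesis by simp
  qed
  have "?t ^ (card F + 1) * ?s F = (?t * (1 + inverse ?t)) ^ card F
      + (\<Sum>G | G \<subset> F. ?t ^ card F * ?s G)"
    unfolding flags_to_sum_rec[OF psubset.hyps] cancel
    unfolding power_mult_distrib sum_distrib_left[of "?t ^ card F" _ "{G. G \<subset> F}"] ..
  also have "?t * (1 + inverse ?t) = x" using t by (simp add: distrib_left)
  also have "(\<Sum>G | G \<subset> F. ?t ^ card F * ?s G) =
      (\<Sum>G | G \<subset> F. ?t ^ (card F - card G - 1) * chain_poly x (card G))"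
  proof (rule sum.cong[OF refl])
    fix G assume "G \<in> {G. G \<subset> F}"
    then have G: "G \<subset> F" by simp
    then have "card G < card F" using psubset_card_mono psubset.hyps by blast
    then have "card F = (card F - card G - 1) + (card G + 1)" by simp
    then have "?t ^ card F = ?t ^ (card F - card G - 1) * ?t ^ (card G + 1)"
      by (metis power_add)
    then show "?t ^ card F * ?s G = ?t ^ (card F - card G - 1) * chain_poly x (card G)"
      using psubset.IH[OF G] by (simp only: mult.assoc)
  qed
  also have "\<dots> = (\<Sum>s<card F. of_nat (card F choose s) * (?t ^ (card F - s - 1) * chain_poly x s))"
    unfolding ps using sum_subsets_by_card[OF psubset.hyps, of "{..<card F}" "\<lambda>s. ?t ^ (card F - s - 1) * chain_poly x s"]
    by simp
  finally show ?case by (subst chain_poly.simps) (simp add: mult_ac)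
qed

text \<open>The flag is kept as a set rather than as a list, so that a face determines its pair and
  sums over faces become sums over pairs.\<close>

definition bergman_pairs :: "nat \<Rightarrow> nat \<Rightarrow> (nat set \<times> nat set set) set" where
  "bergman_pairs d n = {(S, C). S \<subseteq> {1..n} \<and> card S \<le> d \<and> C \<subseteq> {F. F \<subseteq> {1..n} \<and> card F < d} \<and>
      chain_subset C \<and> (\<forall>F\<in>C. S \<subseteq> F)}"

definition bergman_face :: "nat set \<times> nat set set \<Rightarrow> nat bergman_vertex set" where
  "bergman_face = (\<lambda>(S, C). UVert ` S \<union> VVert ` C)"

lemma finite_bergman_pairs: "finite (bergman_pairs d n)"
  by (rule finite_subset[of _ "Pow {1..n} \<times> Pow (Pow {1..n})"]) (auto simp: bergman_pairs_def)

lemma augmented_bergman_uniform: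
  assumes "d \<le> n"
  shows "augmented_bergman (uniform_matroid d n) = bergman_face ` bergman_pairs d n"
proof (intro equalityI subsetI)
  fix X assume "X \<in> augmented_bergman (uniform_matroid d n)"
  then obtain S Fs where X: "X = UVert ` S \<union> VVert ` set Fs" and S: "S \<subseteq> {1..n}" "card S \<le> d"
    and Fs: "set Fs \<subseteq> {F. F \<subseteq> {1..n} \<and> card F < d}" "sorted_wrt (\<subset>) Fs" "Fs \<noteq> [] \<longrightarrow> S \<subseteq> hd Fs"
    unfolding augmented_bergman_def proper_flats_uniform[OF assms] by (auto simp: uniform_matroid_def)
  have "chain_subset (set Fs)"
    using Fs(2) by (induction Fs) (auto simp: chain_subset_def)
  moreover have "\<forall>F\<in>set Fs. S \<subseteq> F"
    using Fs(2,3) by (cases Fs) auto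
  ultimately show "X \<in> bergman_face ` bergman_pairs d n"
    using X S Fs(1) by (auto simp: bergman_face_def bergman_pairs_def intro!: image_eqI[of _ _ "(S, set Fs)"])
next
  fix X assume "X \<in> bergman_face ` bergman_pairs d n"
  then obtain S C where X: "X = UVert ` S \<union> VVert ` C" and S: "S \<subseteq> {1..n}" "card S \<le> d"
    and C: "C \<subseteq> {F. F \<subseteq> {1..n} \<and> card F < d}" "chain_subset C" "\<forall>F\<in>C. S \<subseteq> F"
    by (auto simp: bergman_face_def bergman_pairs_def)
  have "finite C" using C(1) by (rule finite_subset) auto
  then obtain Fs where Fs: "set Fs = C" "sorted_wrt (\<subset>) Fs" using chain_sorted_list C(2) by blast
  moreover have "Fs \<noteq> [] \<longrightarrow> S \<subseteq> hd Fs" using C(3) Fs(1) by auto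
  ultimately show "X \<in> augmented_bergman (uniform_matroid d n)"
    unfolding augmented_bergman_def proper_flats_uniform[OF assms]
    using X S C by (intro CollectI exI[of _ S] exI[of _ Fs]) (auto simp: uniform_matroid_def)
qed

lemma inj_bergman_face: "inj bergman_face"
  unfolding bergman_face_def inj_def by (auto simp: set_eq_iff image_iff)

lemma card_bergman_face: "finite S \<Longrightarrow> finite C \<Longrightarrow> card (bergman_face (S, C)) = card S + card C"
  unfolding bergman_face_def prod.case
  by (subst card_Un_disjoint) (auto simp: card_image inj_on_def)

text \<open>The members of \<open>C\<close> have distinct cardinalities between
  \<open>card S\<close> and \<open>d - 1\<close>. The bound gives the dimension of the complex and
  makes the natural-number difference \<open>d - (card S + card C)\<close> exact.\<close>

lemma bergman_pairs_finite:
  assumes "(S, C) \<in> bergman_pairs d n" shows "finite S" "finite C" "card S + card C \<le> d"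
proof -
  have S: "S \<subseteq> {1..n}" "card S \<le> d" and C: "C \<subseteq> {F. F \<subseteq> {1..n} \<and> card F < d}" "chain_subset C" "\<forall>F\<in>C. S \<subseteq> F"
    using assms by (auto simp: bergman_pairs_def)
  show "finite S" using S(1) finite_subset by blast
  show "finite C" using C(1) by (rule finite_subset) auto
  have "card C \<le> d - card S"
  proof (rule card_chain_le[OF C(2)])
    fix A assume "A \<in> C"
    then have "A \<subseteq> {1..n}" "card A < d" "S \<subseteq> A" using C by auto
    then show "finite A \<and> card S \<le> card A \<and> card A < d" using finite_subset card_mono by blast
  qed
  then show "card S + card C \<le> d" using S(2) by linarith
qed

lemma flags_to_bergman_pairs:
  assumes "(S, C) \<in> flags_to G" "G \<subseteq> {1..n}" "card G < d"
  shows "(S, C) \<in> bergman_pairs d n"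
proof -
  have C: "C \<subseteq> Pow G" "G \<in> C" "chain_subset C" "\<forall>H\<in>C. S \<subseteq> H"
    using assms(1) by (auto simp: flags_to_def)
  have fin: "finite G" using assms(2) finite_subset by blast
  have H: "H \<subseteq> {1..n} \<and> card H < d" if "H \<subseteq> G" for H
    using card_mono[OF fin that] that assms(2,3) by auto
  have "S \<subseteq> G" using C by blast
  from H[OF this] have "S \<subseteq> {1..n}" "card S \<le> d" by auto
  then show ?thesis
    using H C unfolding bergman_pairs_def by auto
qed

lemma Max_card_bergman:
  assumes "d \<le> n"
  shows "Max (card ` augmented_bergman (uniform_matroid d n)) = d"
proof (rule Max_eqI)
  show "finite (card ` augmented_bergman (uniform_matroid d n))"
    by (simp add: augmented_bergman_uniform[OF assms] finite_bergman_pairs)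
  show "y \<le> d" if "y \<in> card ` augmented_bergman (uniform_matroid d n)" for y
    using that bergman_pairs_finite card_bergman_face
    by (auto simp: augmented_bergman_uniform[OF assms])
  have "({1..d}, {}) \<in> bergman_pairs d n"
    using assms by (auto simp: bergman_pairs_def chain_subset_def)
  moreover have "card (bergman_face ({1..d}, {})) = d" by (subst card_bergman_face) auto
  ultimately show "d \<in> card ` augmented_bergman (uniform_matroid d n)"
    unfolding augmented_bergman_uniform[OF assms] by (metis image_eqI)
qed

text \<open>Faces without flats give the first sum. The others are grouped by their largest flat, of
  cardinality \<open>r\<close>; all its subsets are flats, so what lies below it does not depend on
  \<open>d\<close> and is counted by \<open>chain_poly x r\<close>.\<close>

lemma bergman_pairs_sum:
  fixes x :: "'a::field"
  assumes x: "x \<noteq> 1"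
  shows "(\<Sum>(S, C)\<in>bergman_pairs d n. (x - 1) ^ (d - (card S + card C))) =
     (\<Sum>s\<le>d. of_nat (n choose s) * (x - 1) ^ (d - s)) +
     (\<Sum>r<d. of_nat (n choose r) * chain_poly x r * (x - 1) ^ (d - r - 1))"
proof -
  let ?t = "x - 1"
  let ?f = "\<lambda>(S, C). ?t ^ (d - (card S + card C))"
  have t: "?t \<noteq> 0" using x by simp
  define X0 :: "(nat set \<times> nat set set) set" where
    "X0 = (\<lambda>S. (S, {})) ` {S. S \<subseteq> {1..n} \<and> card S \<in> {..d}}"
  define X1 where "X1 = bergman_pairs d n - X0"
  have sub: "X0 \<subseteq> bergman_pairs d n" by (auto simp: X0_def bergman_pairs_def chain_subset_def)
  have "sum ?f (bergman_pairs d n) = sum ?f X1 + sum ?f X0"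
    unfolding X1_def by (rule sum.subset_diff[OF sub finite_bergman_pairs])
  moreover have "sum ?f X0 = (\<Sum>s\<le>d. of_nat (n choose s) * ?t ^ (d - s))"
    using sum_subsets_by_card[of "{1..n}" "{..d}" "\<lambda>s. ?t ^ (d - s)"]
    unfolding X0_def by (subst sum.reindex) (auto simp: inj_on_def)
  moreover have "sum ?f X1 = (\<Sum>r<d. of_nat (n choose r) * chain_poly x r * ?t ^ (d - r - 1))"
  proof -
    have finG: "finite G" if "G \<subseteq> {1..n}" for G :: "nat set" using that finite_subset by blast
    have "(\<Sum>G | G \<subseteq> {1..n} \<and> card G \<in> {..<d}. sum ?f (flags_to G)) =
        (\<Sum>(G, p)\<in>Sigma {G. G \<subseteq> {1..n} \<and> card G \<in> {..<d}} flags_to. ?f p)"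
      using finG finite_flags_to by (subst sum.Sigma) auto
    also have "\<dots> = sum ?f X1"
    proof (rule sum.reindex_bij_witness[of _ "\<lambda>(S, C). (\<Union>C, (S, C))" snd])
      fix a assume a': "a \<in> Sigma {G. G \<subseteq> {1..n} \<and> card G \<in> {..<d}} flags_to"
      obtain G S C where a: "a = (G, S, C)" by (cases a) auto
      have G: "G \<subseteq> {1..n}" "card G < d" and SC: "(S, C) \<in> flags_to G" using a' a by simp_all
      have C: "C \<subseteq> Pow G" "G \<in> C" using SC unfolding flags_to_def by simp_all
      from SC
      have "(S, C) \<in> bergman_pairs d n" using flags_to_bergman_pairs G by blast
      moreover have "C \<noteq> {}" using C(2) by blast
      ultimately show "snd a \<in> X1"
        using a unfolding X1_def X0_def by auto
      have "\<Union>C = G" using C by auto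
      then show "(case snd a of (S, C) \<Rightarrow> (\<Union>C, (S, C))) = a" using a by simp
      show "?f (snd a) = (case a of (G, p) \<Rightarrow> ?f p)" using a by simp
    next
      fix b assume "b \<in> X1"
      then obtain S C where b: "b = (S, C)" "(S, C) \<in> bergman_pairs d n" and ne: "C \<noteq> {}"
        unfolding X1_def X0_def bergman_pairs_def by force
      have C: "chain_subset C" "\<forall>F\<in>C. S \<subseteq> F" "C \<subseteq> {F. F \<subseteq> {1..n} \<and> card F < d}"
        using b by (auto simp: bergman_pairs_def)
      have U: "\<Union>C \<in> C" using chain_Union_mem[OF bergman_pairs_finite(2)[OF b(2)] ne C(1)] .
      show "(case b of (S, C) \<Rightarrow> (\<Union>C, (S, C))) \<in> Sigma {G. G \<subseteq> {1..n} \<and> card G \<in> {..<d}} flags_to"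
        using b(1) U C unfolding flags_to_def by auto
      show "snd (case b of (S, C) \<Rightarrow> (\<Union>C, (S, C))) = b" using b by simp
    qed
    finally have "sum ?f X1 = (\<Sum>G | G \<subseteq> {1..n} \<and> card G \<in> {..<d}. sum ?f (flags_to G))" by simp
    also have "\<dots> = (\<Sum>G | G \<subseteq> {1..n} \<and> card G \<in> {..<d}. ?t ^ (d - card G - 1) * chain_poly x (card G))"
    proof (rule sum.cong[OF refl])
      fix G assume "G \<in> {G. G \<subseteq> {1..n} \<and> card G \<in> {..<d}}"
      then have G: "G \<subseteq> {1..n}" "card G < d" by auto
      have "sum ?f (flags_to G) = (\<Sum>(S, C)\<in>flags_to G. ?t ^ d * inverse ?t ^ (card S + card C))"
      proof (rule sum.cong[OF refl], clarify)
        fix S C assume "(S, C) \<in> flags_to G"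
        then have "(S, C) \<in> bergman_pairs d n"
          using flags_to_bergman_pairs G by blast
        then have "card S + card C \<le> d" by (rule bergman_pairs_finite)
        then show "?t ^ (d - (card S + card C)) = ?t ^ d * inverse ?t ^ (card S + card C)"
          using t by (simp add: power_diff divide_inverse power_inverse)
      qed
      also have "\<dots> = ?t ^ d * (\<Sum>(S, C)\<in>flags_to G. inverse ?t ^ (card S + card C))"
        by (simp add: sum_distrib_left case_prod_unfold)
      \<comment> \<open>The factor \<open>?t ^ (card G + 1)\<close> is the normalization of the
        flags to \<open>G\<close>; only the other factor depends on \<open>d\<close>.\<close>
      also have "?t ^ d = ?t ^ (d - card G - 1) * ?t ^ (card G + 1)"
      proof -
        have "d = (d - card G - 1) + (card G + 1)" using G by simp
        then show ?thesis by (metis power_add)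
      qed
      also have "\<dots> * (\<Sum>(S, C)\<in>flags_to G. inverse ?t ^ (card S + card C)) =
          ?t ^ (d - card G - 1) * chain_poly x (card G)"
        unfolding mult.assoc flags_to_sum[OF finG[OF G(1)] x] ..
      finally show "sum ?f (flags_to G) = ?t ^ (d - card G - 1) * chain_poly x (card G)" .
    qed
    also have "\<dots> = (\<Sum>r<d. of_nat (n choose r) * (?t ^ (d - r - 1) * chain_poly x r))"
      using sum_subsets_by_card[of "{1..n}" "{..<d}" "\<lambda>r. ?t ^ (d - r - 1) * chain_poly x r"] by simp
    finally show ?thesis by (simp add: mult_ac)
  qed
  ultimately show ?thesis by (simp add: add.commute)
qed

section \<open>Evaluation of the h-polynomial at the inverse of the Laurent variable\<close>

lemma map_poly_fls_const_add: "map_poly fls_const (p + q) = map_poly fls_const p + map_poly fls_const q"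
  for p q :: "rat poly"
  by (simp add: poly_eq_iff coeff_map_poly fls_plus_const)

lemma map_poly_fls_const_mult: "map_poly fls_const (p * q) = map_poly fls_const p * map_poly fls_const q"
  for p q :: "rat poly"
proof (induction p)
  case (pCons a p)
  have "map_poly fls_const (smult a q) = smult (fls_const a) (map_poly fls_const q)"
    by (simp add: poly_eq_iff coeff_map_poly)
  moreover have "map_poly fls_const (pCons 0 (p * q)) = pCons 0 (map_poly fls_const (p * q))"
    by (simp add: map_poly_pCons)
  ultimately show ?case
    by (simp add: map_poly_fls_const_add map_poly_pCons pCons.IH)
qed simp

lemma map_poly_fls_const_power: "map_poly fls_const (p ^ k) = map_poly fls_const p ^ k"
  for p :: "rat poly"
  by (induction k) (simp_all add: map_poly_fls_const_mult map_poly_1')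

lemma map_poly_fls_const_sum: "map_poly fls_const (sum p A) = (\<Sum>a\<in>A. map_poly fls_const (p a :: rat poly))"
  by (induction A rule: infinite_finite_induct) (simp_all add: map_poly_fls_const_add)

lemma fls_X_neq_1: "(fls_X :: rat fls) \<noteq> 1"
proof
  assume "(fls_X :: rat fls) = 1"
  then have "fls_subdegree (fls_X :: rat fls) = fls_subdegree 1" by simp
  then show False by simp
qed

text \<open>Reversal clears denominators face by face: a face with \<open>m\<close> vertices
  contributes \<open>x ^ d\<close> times \<open>x ^ (-m)\<close> times
  \<open>(1 - 1 / x) ^ (d - m)\<close>, which is \<open>(x - 1) ^ (d - m)\<close>.\<close>

theorem reversed_h_polynomial_uniform:
  assumes "d \<le> n"
  shows "fls_X ^ d * poly (map_poly fls_const
             (h_polynomial (augmented_bergman (uniform_matroid d n)))) (inverse fls_X) =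
     (\<Sum>s\<le>d. of_nat (n choose s) * (fls_X - 1) ^ (d - s)) +
     (\<Sum>r<d. of_nat (n choose r) * chain_poly fls_X r * (fls_X - 1) ^ (d - r - 1))"
proof -
  let ?X = "fls_X :: rat fls"
  have h: "h_polynomial (augmented_bergman (uniform_matroid d n)) =
      (\<Sum>(S, C)\<in>bergman_pairs d n. [:0, 1:] ^ (card S + card C) * (1 - [:0, 1:]) ^ (d - (card S + card C)))"
  proof -
    have "h_polynomial (augmented_bergman (uniform_matroid d n)) =
      (\<Sum>p\<in>bergman_pairs d n. [:0, 1:] ^ card (bergman_face p) * (1 - [:0, 1:]) ^ (d - card (bergman_face p)))"
      unfolding h_polynomial_def Let_def Max_card_bergman[OF assms]
      unfolding augmented_bergman_uniform[OF assms]
      by (subst sum.reindex) (auto intro: inj_on_subset[OF inj_bergman_face])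
    also have "\<dots> = (\<Sum>(S, C)\<in>bergman_pairs d n. [:0, 1:] ^ (card S + card C) * (1 - [:0, 1:]) ^ (d - (card S + card C)))"
      by (rule sum.cong) (auto simp: card_bergman_face bergman_pairs_finite)
    finally show ?thesis .
  qed
  have lin: "map_poly fls_const (1 - [:0, (1::rat):]) = 1 - [:0, 1:]" "map_poly fls_const [:0, (1::rat):] = [:0, 1:]"
    by (simp_all add: one_pCons map_poly_pCons)
  have "?X ^ d * poly (map_poly fls_const (h_polynomial (augmented_bergman (uniform_matroid d n)))) (inverse ?X) =
     (\<Sum>(S, C)\<in>bergman_pairs d n. ?X ^ d * (inverse ?X ^ (card S + card C) * (1 - inverse ?X) ^ (d - (card S + card C))))"
    unfolding h map_poly_fls_const_sum case_prod_unfold map_poly_fls_const_mult map_poly_fls_const_power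
      lin poly_sum sum_distrib_left poly_mult poly_power
    by (simp only: poly_pCons poly_diff poly_1 poly_0 mult_zero_right add_0_left add_0_right mult_1_right)
  also have "\<dots> = (\<Sum>(S, C)\<in>bergman_pairs d n. (?X - 1) ^ (d - (card S + card C)))"
  proof (rule sum.cong[OF refl], clarify)
    fix S C assume "(S, C) \<in> bergman_pairs d n"
    then have le: "card S + card C \<le> d" by (rule bergman_pairs_finite)
    let ?m = "card S + card C"
    have "?X ^ d = ?X ^ (d - ?m) * ?X ^ ?m" using le by (simp flip: power_add)
    then have "?X ^ d * (inverse ?X ^ ?m * (1 - inverse ?X) ^ (d - ?m)) =
        (?X * inverse ?X) ^ ?m * (?X * (1 - inverse ?X)) ^ (d - ?m)"
      by (simp only: power_mult_distrib mult_ac)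
    also have "?X * inverse ?X = 1" by (rule right_inverse) simp
    also have "?X * (1 - inverse ?X) = ?X - ?X * inverse ?X" by (simp only: right_diff_distrib mult_1_right)
    also have "?X * inverse ?X = 1" by (rule right_inverse) simp
    also have "1 ^ ?m * (?X - 1) ^ (d - ?m) = (?X - 1) ^ (d - ?m)" by (simp only: power_one mult_1_left)
    finally show "?X ^ d * (inverse ?X ^ ?m * (1 - inverse ?X) ^ (d - ?m)) = (?X - 1) ^ (d - ?m)" .
  qed
  also note bergman_pairs_sum[OF fls_X_neq_1]
  finally show ?thesis .
qed

section \<open>Normal multisets of flats\<close>

lemma finite_bounded_multisets:
  assumes "finite X"
  shows "finite {Q. set_mset Q \<subseteq> X \<and> (\<forall>A\<in>#Q. count Q A \<le> k)}"
proof -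
  have "finite {f. \<forall>A. (A \<in> X \<longrightarrow> f A \<in> {..k}) \<and> (A \<notin> X \<longrightarrow> f A = 0)}"
    by (rule finite_set_of_finite_funs) (use assms in auto)
  then have "finite (count -` {f. \<forall>A. (A \<in> X \<longrightarrow> f A \<in> {..k}) \<and> (A \<notin> X \<longrightarrow> f A = 0)})"
    by (rule finite_vimageI) (simp add: inj_def multiset_eq_iff)
  then show ?thesis
  proof (rule finite_subset[rotated], intro subsetI)
    fix Q assume Q: "Q \<in> {Q. set_mset Q \<subseteq> X \<and> (\<forall>A\<in>#Q. count Q A \<le> k)}"
    have "count Q A \<le> k" for A using Q by (cases "A \<in># Q") (auto simp: not_in_iff)
    moreover have "count Q A = 0" if "A \<notin> X" for A using Q that by (auto simp: not_in_iff[symmetric])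
    ultimately show "Q \<in> count -` {f. \<forall>A. (A \<in> X \<longrightarrow> f A \<in> {..k}) \<and> (A \<notin> X \<longrightarrow> f A = 0)}" by simp
  qed
qed

text \<open>On a flat \<open>A\<close> of the uniform matroid of rank \<open>d\<close> the rank is \<open>min (card A) d\<close>. For a chain, bounding
  the multiplicity of \<open>B\<close> by every smaller member amounts to bounding it by its predecessor.\<close>

definition normal_msets :: "nat \<Rightarrow> 'a set \<Rightarrow> 'a set multiset set" where
  "normal_msets d E = {Q. (\<forall>A\<in>#Q. A \<noteq> {} \<and> A \<subseteq> E \<and> (card A < d \<or> A = E)) \<and>
     chain_subset (set_mset Q) \<and>
     (\<forall>A\<in>#Q. count Q A \<le> min (card A) d) \<and>
     (\<forall>A\<in>#Q. \<forall>B\<in>#Q. A \<subset> B \<longrightarrow> count Q B + card A < min (card B) d)}"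

text \<open>With \<open>card F\<close> as rank this concerns the Boolean matroid on
  \<open>F\<close>. For nonempty \<open>F\<close> the condition on the union says that
  \<open>F\<close> itself occurs; for empty \<open>F\<close> only the empty multiset
  remains.\<close>

definition normal_msets_to :: "'a set \<Rightarrow> 'a set multiset set" where
  "normal_msets_to F = {Q \<in> normal_msets (card F) F. \<Union>(set_mset Q) = F}"

text \<open>The largest multiplicity of the top set over a chain whose largest other member has
  \<open>s\<close> elements. Without such a member, encoded by \<open>s = 0\<close>, the bound is
  the full rank; otherwise it is strict below the rank difference.\<close>

definition top_mult :: "nat \<Rightarrow> nat \<Rightarrow> nat" where
  "top_mult d s = (if s = 0 then d else d - s - 1)"

lemma finite_normal_msets: "finite E \<Longrightarrow> finite (normal_msets d E)"
  by (rule finite_subset[OF _ finite_bounded_multisets[of "Pow E" d]]) (auto simp: normal_msets_def)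

lemma normal_msetsI:
  assumes "\<And>A. A \<in># Q \<Longrightarrow> A \<noteq> {} \<and> A \<subseteq> E \<and> (card A < d \<or> A = E)"
    and "\<And>A B. A \<in># Q \<Longrightarrow> B \<in># Q \<Longrightarrow> A \<subseteq> B \<or> B \<subseteq> A"
    and "\<And>A. A \<in># Q \<Longrightarrow> count Q A \<le> min (card A) d"
    and "\<And>A B. A \<in># Q \<Longrightarrow> B \<in># Q \<Longrightarrow> A \<subset> B \<Longrightarrow> count Q B + card A < min (card B) d"
  shows "Q \<in> normal_msets d E"
  using assms unfolding normal_msets_def chain_subset_def by simp

lemma normal_msetsD:
  assumes "Q \<in> normal_msets d E"
  shows "\<And>A. A \<in># Q \<Longrightarrow> A \<noteq> {} \<and> A \<subseteq> E \<and> (card A < d \<or> A = E)"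
    and "chain_subset (set_mset Q)"
    and "\<And>A B. A \<in># Q \<Longrightarrow> B \<in># Q \<Longrightarrow> A \<subseteq> B \<or> B \<subseteq> A"
    and "\<And>A. A \<in># Q \<Longrightarrow> count Q A \<le> min (card A) d"
    and "\<And>A B. A \<in># Q \<Longrightarrow> B \<in># Q \<Longrightarrow> A \<subset> B \<Longrightarrow> count Q B + card A < min (card B) d"
  using assms unfolding normal_msets_def chain_subset_def by simp_all

lemma normal_msets_empty: "normal_msets d {} = {{#}}"
proof (intro equalityI subsetI)
  fix Q :: "'a set multiset" assume Q: "Q \<in> normal_msets d {}"
  have "A \<notin># Q" for A using normal_msetsD(1)[OF Q, of A] by auto
  then show "Q \<in> {{#}}" by (auto intro: multiset_eqI simp: not_in_iff)
next
  fix Q :: "'a set multiset" assume "Q \<in> {{#}}"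
  then show "Q \<in> normal_msets d {}"
    by (simp add: normal_msets_def chain_subset_def)
qed

text \<open>Below \<open>G\<close> all cardinalities are less than \<open>d\<close>, so rank is
  cardinality there and the lower part is normal for the Boolean matroid on \<open>G\<close>. Among
  the bounds on the copies of \<open>E\<close>, the one against \<open>G\<close> is the
  strongest.\<close>

lemma normal_msets_split:
  assumes E: "finite E" "d \<le> card E" "0 < d" and Q: "Q \<in> normal_msets d E"
  defines "Q' \<equiv> filter_mset (\<lambda>A. A \<noteq> E) Q"
  defines "G \<equiv> \<Union>(set_mset Q')"
  shows "G \<subseteq> E" "card G < d" "Q' \<in> normal_msets_to G" "count Q E \<le> top_mult d (card G)"
    "Q = Q' + replicate_mset (count Q E) E"
proof -
  note D = normal_msetsD[OF Q]
  have mem: "A \<in># Q' \<longleftrightarrow> A \<in># Q \<and> A \<noteq> E" for A by (simp add: Q'_def)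
  have small: "card A < d" if "A \<in># Q'" for A using D(1)[of A] that mem by blast
  have G_in: "G \<in># Q'" if "Q' \<noteq> {#}"
  proof -
    have "chain_subset (set_mset Q')" by (rule chain_subset_mono[OF D(2)]) (auto simp: mem)
    then show ?thesis unfolding G_def using chain_Union_mem[of "set_mset Q'"] that by simp
  qed
  show GE: "G \<subseteq> E" unfolding G_def using D(1) mem by blast
  then have finG: "finite G" using E(1) finite_subset by blast
  show Gd: "card G < d"
  proof (cases "Q' = {#}")
    case True then show ?thesis using E by (simp add: G_def)
  next
    case False then show ?thesis using small G_in by blast
  qed
  have sub: "A \<subseteq> G" if "A \<in># Q'" for A using that unfolding G_def by auto
  have cnt: "count Q' A = count Q A" if "A \<in># Q'" for A using that mem by (simp add: Q'_def)
  have "Q' \<in> normal_msets (card G) G"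
  proof (rule normal_msetsI)
    fix A assume A: "A \<in># Q'"
    show "A \<noteq> {} \<and> A \<subseteq> G \<and> (card A < card G \<or> A = G)"
      using D(1)[of A] A mem sub[OF A] psubset_card_mono[OF finG, of A] by auto
    show "count Q' A \<le> min (card A) (card G)"
      using D(4)[of A] A mem sub[OF A] card_mono[OF finG, of A] cnt[OF A] by auto
  next
    fix A B assume AB: "A \<in># Q'" "B \<in># Q'"
    then show "A \<subseteq> B \<or> B \<subseteq> A" using D(3) mem by blast
    assume "A \<subset> B"
    then have "count Q B + card A < min (card B) d" using D(5) AB mem by blast
    then show "count Q' B + card A < min (card B) (card G)"
      using cnt[OF AB(2)] card_mono[OF finG sub[OF AB(2)]] by simp
  qed
  then show "Q' \<in> normal_msets_to G" by (simp add: normal_msets_to_def G_def)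
  show "count Q E \<le> top_mult d (card G)"
  proof (cases "E \<in># Q")
    case False then show ?thesis by (simp add: not_in_iff)
  next
    case EQ: True
    show ?thesis
    proof (cases "Q' = {#}")
      case True
      then have "G = {}" by (simp add: G_def)
      then show ?thesis using D(4)[OF EQ] by (simp add: top_mult_def)
    next
      case False
      then have "G \<in># Q" "G \<noteq> E" using G_in mem by auto
      then have "G \<subset> E" "G \<noteq> {}" using GE D(1)[of G] by auto
      then have "count Q E + card G < min (card E) d" using D(5)[OF \<open>G \<in># Q\<close> EQ] by simp
      moreover have "card G \<noteq> 0" using \<open>G \<noteq> {}\<close> finG by simp
      ultimately have "count Q E + card G < d" "card G \<noteq> 0" by simp_all
      moreover from this have "count Q E \<le> d - card G - 1" by linarith
      ultimately show ?thesis by (simp add: top_mult_def)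
    qed
  qed
  show "Q = Q' + replicate_mset (count Q E) E"
    by (rule multiset_eqI) (auto simp: Q'_def)
qed

text \<open>The bound on \<open>a\<close> against \<open>G\<close> implies those against all members
  of \<open>Q'\<close>, which are subsets of \<open>G\<close>.\<close>

lemma normal_msets_join:
  assumes E: "finite E" "d \<le> card E" and G: "G \<subseteq> E" "card G < d"
    and Q': "Q' \<in> normal_msets_to G" and a: "a \<le> top_mult d (card G)"
  defines "Q \<equiv> Q' + replicate_mset a E"
  shows "Q \<in> normal_msets d E" "filter_mset (\<lambda>A. A \<noteq> E) Q = Q'" "\<Union>(set_mset Q') = G" "count Q E = a"
proof -
  have Qn: "Q' \<in> normal_msets (card G) G" and U: "\<Union>(set_mset Q') = G"
    using Q' by (simp_all add: normal_msets_to_def)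
  note D = normal_msetsD[OF Qn]
  have finG: "finite G" using G(1) E(1) finite_subset by blast
  have GE: "G \<noteq> E" using G E by auto
  have small: "A \<subseteq> G \<and> card A \<le> card G \<and> A \<noteq> E \<and> A \<noteq> {}" if "A \<in># Q'" for A
    using D(1)[OF that] card_mono[OF finG, of A] G(1) GE by auto
  have EQ': "E \<notin># Q'" using small by blast
  have mem: "A \<in># Q \<longleftrightarrow> A \<in># Q' \<or> (A = E \<and> 0 < a)" for A by (auto simp: Q_def)
  have ad: "a \<le> d" using a by (auto simp: top_mult_def split: if_splits)
  show "count Q E = a" using EQ' by (simp add: Q_def not_in_iff)
  have cnt: "count Q A = count Q' A" if "A \<noteq> E" for A using that by (simp add: Q_def)
  show "Q \<in> normal_msets d E"
  proof (rule normal_msetsI)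
    fix A assume A: "A \<in># Q"
    show "A \<noteq> {} \<and> A \<subseteq> E \<and> (card A < d \<or> A = E)"
      using A mem small[of A] G E by force
    show "count Q A \<le> min (card A) d"
    proof (cases "A = E")
      case True then show ?thesis using \<open>count Q E = a\<close> ad E by simp
    next
      case False
      then have "A \<in># Q'" using A mem by simp
      then show ?thesis using D(4)[of A] cnt[OF False] G(2) by simp
    qed
  next
    fix A B assume AB: "A \<in># Q" "B \<in># Q"
    show "A \<subseteq> B \<or> B \<subseteq> A"
      using AB mem D(3) small G(1) by (metis subset_trans order_refl)
    assume lt: "A \<subset> B"
    show "count Q B + card A < min (card B) d"
    proof (cases "B = E")
      case True
      then have "A \<in># Q'" using AB lt mem by auto
      then have "card A \<le> card G" "A \<noteq> {}" "A \<subseteq> G" using small by auto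
      then have "card G \<noteq> 0" using finG by auto
      then show ?thesis using True \<open>count Q E = a\<close> a \<open>card A \<le> card G\<close> G(2) E(2)
        by (auto simp: top_mult_def)
    next
      case False
      then have B: "B \<in># Q'" using AB mem by simp
      then have "A \<noteq> E" using lt small G(1) by auto
      then have "A \<in># Q'" using AB mem by simp
      then show ?thesis using D(5)[OF _ B lt] cnt[OF False] G(2) by simp
    qed
  qed
  show "filter_mset (\<lambda>A. A \<noteq> E) Q = Q'"
    using EQ' by (intro multiset_eqI) (auto simp: Q_def not_in_iff)
  show "\<Union>(set_mset Q') = G" by (rule U)
qed

text \<open>The weight \<open>f\<close> has two uses: the constant \<open>1\<close> counts all
  normal multisets, the indicator of a positive multiplicity only those whose largest member is
  \<open>E\<close>.\<close>

lemma normal_msets_sum: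
  fixes x :: "'b::comm_ring_1"
  assumes E: "finite E" "d \<le> card E" "0 < d"
  shows "(\<Sum>Q\<in>normal_msets d E. f (count Q E) * x ^ size Q) =
     (\<Sum>G | G \<subseteq> E \<and> card G \<in> {..<d}. (\<Sum>Q\<in>normal_msets_to G. x ^ size Q) *
        (\<Sum>a\<le>top_mult d (card G). f a * x ^ a))"
proof -
  let ?G = "{G. G \<subseteq> E \<and> card G \<in> {..<d}}"
  have finG: "finite ?G" using E by simp
  have finB: "finite (normal_msets_to G)" if "G \<in> ?G" for G
    using that E(1) finite_subset[of G E] finite_normal_msets[of G] by (simp add: normal_msets_to_def)
  have "(\<Sum>G\<in>?G. (\<Sum>Q\<in>normal_msets_to G. x ^ size Q) * (\<Sum>a\<le>top_mult d (card G). f a * x ^ a)) =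
      (\<Sum>G\<in>?G. \<Sum>(Q, a)\<in>normal_msets_to G \<times> {..top_mult d (card G)}. x ^ size Q * (f a * x ^ a))"
    by (simp add: sum_product sum.cartesian_product)
  also have "\<dots> = (\<Sum>(G, Q, a)\<in>Sigma ?G (\<lambda>G. normal_msets_to G \<times> {..top_mult d (card G)}). x ^ size Q * (f a * x ^ a))"
    using finG finB by (subst sum.Sigma) auto
  also have "\<dots> = (\<Sum>Q\<in>normal_msets d E. f (count Q E) * x ^ size Q)"
  proof (rule sum.reindex_bij_witness[of _
        "\<lambda>Q. (\<Union>(set_mset (filter_mset (\<lambda>A. A \<noteq> E) Q)), filter_mset (\<lambda>A. A \<noteq> E) Q, count Q E)"
        "\<lambda>(G, Q, a). Q + replicate_mset a E"])
    fix p assume p: "p \<in> Sigma ?G (\<lambda>G. normal_msets_to G \<times> {..top_mult d (card G)})"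
    obtain G Q a where pe: "p = (G, Q, a)" by (cases p) auto
    have G: "G \<subseteq> E" "card G < d" and Q: "Q \<in> normal_msets_to G" and a: "a \<le> top_mult d (card G)"
      using p pe by simp_all
    note J = normal_msets_join[OF E(1,2) G Q a]
    show "(case p of (G, Q, a) \<Rightarrow> Q + replicate_mset a E) \<in> normal_msets d E" using J(1) pe by simp
    show "(\<Union>(set_mset (filter_mset (\<lambda>A. A \<noteq> E) (case p of (G, Q, a) \<Rightarrow> Q + replicate_mset a E))),
        filter_mset (\<lambda>A. A \<noteq> E) (case p of (G, Q, a) \<Rightarrow> Q + replicate_mset a E),
        count (case p of (G, Q, a) \<Rightarrow> Q + replicate_mset a E) E) = p"
      unfolding pe prod.case J(2,3,4) ..
    show "f (count (case p of (G, Q, a) \<Rightarrow> Q + replicate_mset a E) E) *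
          x ^ size (case p of (G, Q, a) \<Rightarrow> Q + replicate_mset a E) =
        (case p of (G, Q, a) \<Rightarrow> x ^ size Q * (f a * x ^ a))"
      unfolding pe prod.case J(4) by (simp add: power_add mult_ac)
  next
    fix Q assume Q: "Q \<in> normal_msets d E"
    note S = normal_msets_split[OF E Q]
    show "(case (\<Union>(set_mset (filter_mset (\<lambda>A. A \<noteq> E) Q)), filter_mset (\<lambda>A. A \<noteq> E) Q, count Q E) of
        (G, Q, a) \<Rightarrow> Q + replicate_mset a E) = Q"
      using S(5) by simp
    show "(\<Union>(set_mset (filter_mset (\<lambda>A. A \<noteq> E) Q)), filter_mset (\<lambda>A. A \<noteq> E) Q, count Q E)
        \<in> Sigma ?G (\<lambda>G. normal_msets_to G \<times> {..top_mult d (card G)})"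
      using S(1-4) by simp
  qed
  finally show ?thesis by simp
qed

text \<open>The Eulerian polynomials \<open>1\<close>, \<open>x\<close>, \<open>x + x^2\<close>,
  \<open>x + 4 x^2 + x^3\<close>, and so on, where \<open>x\<close> marks descents plus one for
  \<open>r > 0\<close>. The last factor lists the positive multiplicities of the top set over a set
  of \<open>s\<close> elements; \<open>x ^ r\<close> is the additional multiplicity allowed over the
  empty chain.\<close>

fun eul_poly :: "'a::comm_ring_1 \<Rightarrow> nat \<Rightarrow> 'a" where
  "eul_poly x r = x ^ r + (\<Sum>s<r. of_nat (r choose s) * eul_poly x s * (x * (\<Sum>k<r - s - 1. x ^ k)))"

declare eul_poly.simps [simp del]

lemma eul_poly_0 [simp]: "eul_poly x 0 = 1"
  by (subst eul_poly.simps) simp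

lemma normal_msets_to_sum:
  fixes x :: "'b::comm_ring_1"
  assumes "finite F"
  shows "(\<Sum>Q\<in>normal_msets_to F. x ^ size Q) = eul_poly x (card F)"
  using assms
proof (induction F rule: finite_psubset_induct)
  case (psubset F)
  show ?case
  proof (cases "F = {}")
    case True
    have "normal_msets_to {} = {{#} :: 'a set multiset}"
      by (auto simp: normal_msets_to_def normal_msets_empty)
    then show ?thesis using True by simp
  next
    case False
    let ?r = "card F"
    have r: "0 < ?r" using False psubset.hyps by (simp add: card_gt_0_iff)
    have "normal_msets_to F = {Q \<in> normal_msets ?r F. 0 < count Q F}"
    proof (intro equalityI subsetI)
      fix Q assume Q: "Q \<in> normal_msets_to F"
      then have Qn: "Q \<in> normal_msets ?r F" and U: "\<Union>(set_mset Q) = F" by (simp_all add: normal_msets_to_def)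
      have "set_mset Q \<noteq> {}" using U False by auto
      then have "F \<in># Q" using chain_Union_mem[of "set_mset Q"] normal_msetsD(2)[OF Qn] U by simp
      then show "Q \<in> {Q \<in> normal_msets ?r F. 0 < count Q F}" using Qn by (simp add: count_greater_zero_iff)
    next
      fix Q assume "Q \<in> {Q \<in> normal_msets ?r F. 0 < count Q F}"
      then have Qn: "Q \<in> normal_msets ?r F" and "F \<in># Q" by (auto simp: count_greater_zero_iff)
      then have "\<Union>(set_mset Q) = F" using normal_msetsD(1)[OF Qn] by auto
      then show "Q \<in> normal_msets_to F" using Qn by (simp add: normal_msets_to_def)
    qed
    then have "(\<Sum>Q\<in>normal_msets_to F. x ^ size Q) =
        (\<Sum>Q\<in>normal_msets ?r F. of_bool (0 < count Q F) * x ^ size Q)"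
      using finite_normal_msets[OF psubset.hyps, of ?r]
      by (simp add: sum.inter_filter of_bool_def if_distrib[of "\<lambda>u. u * _"] cong: if_cong)
    also have "\<dots> = (\<Sum>G | G \<subseteq> F \<and> card G \<in> {..<?r}. (\<Sum>Q\<in>normal_msets_to G. x ^ size Q) *
        (\<Sum>a\<le>top_mult ?r (card G). of_bool (0 < a) * x ^ a))"
      by (rule normal_msets_sum[OF psubset.hyps order_refl r])
    also have "\<dots> = (\<Sum>G | G \<subseteq> F \<and> card G \<in> {..<?r}. eul_poly x (card G) *
        (x * (\<Sum>k<top_mult ?r (card G). x ^ k)))"
    proof (rule sum.cong[OF refl])
      fix G assume G: "G \<in> {G. G \<subseteq> F \<and> card G \<in> {..<?r}}"
      then have "G \<subset> F" by auto
      moreover have "(\<Sum>a\<le>m. of_bool (0 < a) * x ^ a) = x * (\<Sum>k<m. x ^ k)" for m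
        by (induction m) (simp_all add: distrib_left)
      ultimately show "(\<Sum>Q\<in>normal_msets_to G. x ^ size Q) * (\<Sum>a\<le>top_mult ?r (card G). of_bool (0 < a) * x ^ a) =
          eul_poly x (card G) * (x * (\<Sum>k<top_mult ?r (card G). x ^ k))"
        using psubset.IH[of G] by simp
    qed
    also have "\<dots> = (\<Sum>s<?r. of_nat (?r choose s) * (eul_poly x s * (x * (\<Sum>k<top_mult ?r s. x ^ k))))"
      by (rule sum_subsets_by_card[OF psubset.hyps finite_lessThan])
    \<comment> \<open>At \<open>s = 0\<close> the multiplicity may reach \<open>?r\<close> instead
      of \<open>?r - 1\<close>; the additional term is the free summand of the recurrence.\<close>
    also have "\<dots> = (\<Sum>s<?r. (if s = 0 then x ^ ?r else 0) +
        of_nat (?r choose s) * eul_poly x s * (x * (\<Sum>k<?r - s - 1. x ^ k)))"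
    proof (rule sum.cong[OF refl])
      fix s assume "s \<in> {..<?r}"
      obtain m where m: "?r = Suc m" using r by (cases ?r) auto
      show "of_nat (?r choose s) * (eul_poly x s * (x * (\<Sum>k<top_mult ?r s. x ^ k))) =
         (if s = 0 then x ^ ?r else 0) + of_nat (?r choose s) * eul_poly x s * (x * (\<Sum>k<?r - s - 1. x ^ k))"
        unfolding m by (auto simp: top_mult_def algebra_simps)
    qed
    also have "\<dots> = x ^ ?r + (\<Sum>s<?r. of_nat (?r choose s) * eul_poly x s * (x * (\<Sum>k<?r - s - 1. x ^ k)))"
      using r by (simp add: sum.distrib)
    also have "\<dots> = eul_poly x ?r" by (subst (2) eul_poly.simps) simp
    finally show ?thesis .
  qed
qed

text \<open>Here \<open>E\<close> may be absent, so its multiplicity starts at \<open>0\<close> and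
  the geometric sums run up to \<open>x ^ (d - r - 1)\<close> from \<open>1\<close>. The summand
  \<open>x ^ d\<close> is again the additional multiplicity over the empty chain.\<close>

theorem normal_msets_hilbert:
  fixes x :: "'b::comm_ring_1"
  assumes E: "finite E" "d \<le> card E" "0 < d"
  shows "(\<Sum>Q\<in>normal_msets d E. x ^ size Q) =
    x ^ d + (\<Sum>r<d. of_nat (card E choose r) * eul_poly x r * (\<Sum>k<d - r. x ^ k))"
proof -
  have fin: "finite G" if "G \<subseteq> E" for G using that E(1) finite_subset by blast
  have "(\<Sum>Q\<in>normal_msets d E. x ^ size Q) = (\<Sum>G | G \<subseteq> E \<and> card G \<in> {..<d}. eul_poly x (card G) *
        (\<Sum>a\<le>top_mult d (card G). x ^ a))"
    using normal_msets_sum[OF E, of "\<lambda>_. 1" x] normal_msets_to_sum[OF fin, of _ x] by simp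
  also have "\<dots> = (\<Sum>r<d. of_nat (card E choose r) * (eul_poly x r * (\<Sum>a\<le>top_mult d r. x ^ a)))"
    by (rule sum_subsets_by_card[OF E(1) finite_lessThan])
  also have "\<dots> = (\<Sum>r<d. (if r = 0 then x ^ d else 0) +
      of_nat (card E choose r) * eul_poly x r * (\<Sum>k<d - r. x ^ k))"
  proof (rule sum.cong[OF refl])
    fix r assume r: "r \<in> {..<d}"
    have upto: "(\<Sum>a\<le>m. x ^ a) = (\<Sum>k<Suc m. x ^ k)" for m by (simp only: lessThan_Suc_atMost)
    show "of_nat (card E choose r) * (eul_poly x r * (\<Sum>a\<le>top_mult d r. x ^ a)) =
        (if r = 0 then x ^ d else 0) + of_nat (card E choose r) * eul_poly x r * (\<Sum>k<d - r. x ^ k)"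
    proof (cases "r = 0")
      case True then show ?thesis by (simp add: upto top_mult_def add.commute)
    next
      case False
      then have "Suc (top_mult d r) = d - r" using r by (auto simp: top_mult_def)
      then have "(\<Sum>a\<le>top_mult d r. x ^ a) = (\<Sum>k<d - r. x ^ k)" by (simp only: upto)
      then show ?thesis using False by (simp add: mult.assoc)
    qed
  qed
  also have "\<dots> = x ^ d + (\<Sum>r<d. of_nat (card E choose r) * eul_poly x r * (\<Sum>k<d - r. x ^ k))"
    using E(3) by (simp add: sum.distrib)
  finally show ?thesis .
qed

section \<open>Linear functionals and substitution homomorphisms\<close>

lemma poly_mapping_sum_single:
  fixes p :: "'k \<Rightarrow>\<^sub>0 'b::comm_monoid_add"
  shows "p = (\<Sum>k\<in>Poly_Mapping.keys p. Poly_Mapping.single k (Poly_Mapping.lookup p k))"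
proof (rule poly_mapping_eqI)
  fix k
  show "Poly_Mapping.lookup p k =
    Poly_Mapping.lookup (\<Sum>k\<in>Poly_Mapping.keys p. Poly_Mapping.single k (Poly_Mapping.lookup p k)) k"
    by (simp add: lookup_sum lookup_single when_def in_keys_iff)
qed

lemma poly_mapping_add_induct [case_names zero single add]:
  fixes p :: "'k \<Rightarrow>\<^sub>0 'b::comm_monoid_add"
  assumes "P 0" "\<And>k a. P (Poly_Mapping.single k a)" "\<And>p q. P p \<Longrightarrow> P q \<Longrightarrow> P (p + q)"
  shows "P p"
proof -
  have "P (\<Sum>k\<in>K. Poly_Mapping.single k (Poly_Mapping.lookup p k))" if "finite K" for K
    using that by (induction K) (auto intro: assms)
  then show ?thesis by (subst poly_mapping_sum_single) simp
qed

definition lin :: "('k \<Rightarrow> rat) \<Rightarrow> ('k \<Rightarrow>\<^sub>0 rat) \<Rightarrow> rat" where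
  "lin c p = (\<Sum>k\<in>Poly_Mapping.keys p. Poly_Mapping.lookup p k * c k)"

lemma lin_0 [simp]: "lin c 0 = 0" by (simp add: lin_def)

lemma lin_add: "lin c (p + q) = lin c p + lin c q"
  unfolding lin_def by (rule setsum_keys_plus_distrib) (simp_all add: distrib_right)

lemma lin_single [simp]: "lin c (Poly_Mapping.single k a) = a * c k"
  by (simp add: lin_def)

lemma lin_uminus: "lin c (- p) = - lin c p"
  using lin_add[of c p "- p"] by (simp add: eq_neg_iff_add_eq_0 add.commute)

lemma lin_diff: "lin c (p - q) = lin c p - lin c q"
  using lin_add[of c p "- q"] by (simp add: lin_uminus)

lemma lin_sum: "lin c (sum f A) = (\<Sum>a\<in>A. lin c (f a))"
  by (induction A rule: infinite_finite_induct) (simp_all add: lin_add)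

lemma lin_single_mult: "lin c (Poly_Mapping.single m a * p) = a * lin (\<lambda>k. c (m + k)) p"
proof (induction p rule: poly_mapping_add_induct)
  case (add p q) then show ?case by (simp add: distrib_left lin_add)
qed (simp_all add: mult_single)

definition monom_eval :: "('v \<Rightarrow> 'b::comm_ring_1) \<Rightarrow> ('v \<Rightarrow>\<^sub>0 nat) \<Rightarrow> 'b" where
  "monom_eval \<theta> m = (\<Prod>v\<in>Poly_Mapping.keys m. \<theta> v ^ Poly_Mapping.lookup m v)"

lemma monom_eval_superset:
  assumes "finite S" "Poly_Mapping.keys m \<subseteq> S"
  shows "monom_eval \<theta> m = (\<Prod>v\<in>S. \<theta> v ^ Poly_Mapping.lookup m v)"
  unfolding monom_eval_def by (rule prod.mono_neutral_left) (use assms in \<open>auto simp: in_keys_iff\<close>)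

lemma monom_eval_add: "monom_eval \<theta> (m + n) = monom_eval \<theta> m * monom_eval \<theta> n"
proof -
  let ?S = "Poly_Mapping.keys m \<union> Poly_Mapping.keys n"
  show ?thesis
    using keys_add[of m n]
    by (simp add: monom_eval_superset[of ?S] lookup_add power_add prod.distrib)
qed

lemma monom_eval_single: "monom_eval \<theta> (Poly_Mapping.single v k) = \<theta> v ^ k"
  by (simp add: monom_eval_def)

text \<open>The target is the monoid algebra of an arbitrary commutative monoid. For the monoid of
  multisets of sets, a monomial in the eta becomes a basis vector.\<close>

definition poly_subst ::
  "('v \<Rightarrow> 'm::comm_monoid_add \<Rightarrow>\<^sub>0 rat) \<Rightarrow> 'v rat_mpoly \<Rightarrow> 'm \<Rightarrow>\<^sub>0 rat" where
  "poly_subst \<theta> p =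
     (\<Sum>m\<in>Poly_Mapping.keys p. Poly_Mapping.single 0 (Poly_Mapping.lookup p m) * monom_eval \<theta> m)"

lemma poly_subst_0 [simp]: "poly_subst \<theta> 0 = 0" by (simp add: poly_subst_def)

lemma poly_subst_add: "poly_subst \<theta> (p + q) = poly_subst \<theta> p + poly_subst \<theta> q"
  unfolding poly_subst_def by (rule setsum_keys_plus_distrib) (simp_all add: single_add distrib_right)

lemma poly_subst_single: "poly_subst \<theta> (Poly_Mapping.single m a) = Poly_Mapping.single 0 a * monom_eval \<theta> m"
  by (simp add: poly_subst_def)

lemma poly_subst_mult:
  fixes \<theta> :: "'v \<Rightarrow> 'm::comm_monoid_add \<Rightarrow>\<^sub>0 rat"
  shows "poly_subst \<theta> (p * q) = poly_subst \<theta> p * poly_subst \<theta> q"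
proof (induction p rule: poly_mapping_add_induct)
  case (single k a)
  show ?case
  proof (induction q rule: poly_mapping_add_induct)
    case (single l b)
    have "poly_subst \<theta> (Poly_Mapping.single k a * Poly_Mapping.single l b) =
        Poly_Mapping.single 0 (a * b) * (monom_eval \<theta> k * monom_eval \<theta> l)"
      by (simp add: mult_single poly_subst_single monom_eval_add)
    also have "Poly_Mapping.single 0 (a * b) = Poly_Mapping.single (0 :: 'm) a * Poly_Mapping.single 0 b"
      by (simp add: mult_single)
    finally show ?case by (simp only: poly_subst_single mult_ac)
  qed (simp_all add: poly_subst_add distrib_left)
qed (simp_all add: poly_subst_add distrib_right)

lemma poly_subst_uminus: "poly_subst \<theta> (- p) = - poly_subst \<theta> p"
  using poly_subst_add[of \<theta> p "- p"] by (simp add: eq_neg_iff_add_eq_0 add.commute)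

lemma poly_subst_diff: "poly_subst \<theta> (p - q) = poly_subst \<theta> p - poly_subst \<theta> q"
  using poly_subst_add[of \<theta> p "- q"] by (simp add: poly_subst_uminus)

lemma poly_subst_sum: "poly_subst \<theta> (sum f A) = (\<Sum>a\<in>A. poly_subst \<theta> (f a))"
  by (induction A rule: infinite_finite_induct) (simp_all add: poly_subst_add)

lemma poly_subst_Var [simp]: "poly_subst \<theta> (Var v) = \<theta> v"
  by (simp add: Var_def poly_subst_single monom_eval_single)

lemma poly_subst_Const [simp]: "poly_subst \<theta> (Const c) = Poly_Mapping.single 0 c"
  by (simp add: Const_def poly_subst_single monom_eval_def)

section \<open>The degree map given by Hall's condition\<close>

text \<open>Each set without \<open>j\<close> is paired with the one obtained by inserting
  \<open>j\<close>, whose sign is opposite. A Moebius sum thus becomes a combination of differences,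
  to which the exchange properties of the degree apply.\<close>

lemma sum_supersets_split:
  fixes g :: "'a set \<Rightarrow> 'b::comm_ring_1"
  assumes "finite E" "j \<in> E" "j \<notin> F" "F \<subseteq> E"
  shows "(\<Sum>G | F \<subseteq> G \<and> G \<subseteq> E. (-1) ^ card (G - F) * g G) =
     (\<Sum>G | F \<subseteq> G \<and> G \<subseteq> E - {j}. (-1) ^ card (G - F) * (g G - g (insert j G)))"
proof -
  let ?S = "{G. F \<subseteq> G \<and> G \<subseteq> E - {j}}"
  have fin: "finite ?S" using assms(1) by (auto intro: finite_subset[of _ "Pow E"])
  have eq: "{G. F \<subseteq> G \<and> G \<subseteq> E} = ?S \<union> insert j ` ?S"
  proof (intro equalityI subsetI)
    fix G assume G: "G \<in> {G. F \<subseteq> G \<and> G \<subseteq> E}"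
    show "G \<in> ?S \<union> insert j ` ?S"
    proof (cases "j \<in> G")
      case True
      then have "G = insert j (G - {j})" by auto
      moreover have "G - {j} \<in> ?S" using G assms by auto
      ultimately show ?thesis by (intro UnI2 image_eqI[of _ _ "G - {j}"])
    qed (use G in auto)
  qed (use assms in auto)
  have inj: "inj_on (insert j) ?S" by (auto simp: inj_on_def)
  have "(\<Sum>G | F \<subseteq> G \<and> G \<subseteq> E. (-1) ^ card (G - F) * g G) =
      (\<Sum>G\<in>?S. (-1) ^ card (G - F) * g G) + (\<Sum>G\<in>insert j ` ?S. (-1) ^ card (G - F) * g G)"
    unfolding eq by (rule sum.union_disjoint) (use fin in auto)
  also have "(\<Sum>G\<in>insert j ` ?S. (-1) ^ card (G - F) * g G) =
      (\<Sum>G\<in>?S. (-1) ^ card (insert j G - F) * g (insert j G))"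
    by (simp add: sum.reindex[OF inj])
  also have "\<dots> = (\<Sum>G\<in>?S. - ((-1) ^ card (G - F) * g (insert j G)))"
  proof (rule sum.cong[OF refl])
    fix G assume G: "G \<in> ?S"
    then have "finite (G - F)" "j \<notin> G" using assms(1) finite_subset[of G E] by blast+
    moreover have "insert j G - F = insert j (G - F)" using assms(3) by auto
    ultimately show "(-1) ^ card (insert j G - F) * g (insert j G) = - ((-1) ^ card (G - F) * g (insert j G))"
      by simp
  qed
  finally show ?thesis by (simp add: right_diff_distrib sum_subtractf sum_negf)
qed

lemma sum_supersets_alternating:
  assumes "finite E" "F \<subseteq> E"
  shows "(\<Sum>G | F \<subseteq> G \<and> G \<subseteq> E. (-1) ^ card (G - F)) = (of_bool (F = E) :: 'b::comm_ring_1)"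
proof (cases "F = E")
  case True
  then have "{G. F \<subseteq> G \<and> G \<subseteq> E} = {E}" by auto
  then show ?thesis using True by simp
next
  case False
  then obtain j where "j \<in> E" "j \<notin> F" using assms by auto
  from sum_supersets_split[OF assms(1) this assms(2), of "\<lambda>_. 1 :: 'b"] show ?thesis using False by simp
qed

lemma sum_subsets_alternating:
  assumes "finite G" "A \<subseteq> G"
  shows "(\<Sum>F | A \<subseteq> F \<and> F \<subseteq> G. (-1) ^ card (G - F)) = (of_bool (A = G) :: 'b::comm_ring_1)"
proof -
  have "(\<Sum>F | A \<subseteq> F \<and> F \<subseteq> G. (-1) ^ card (G - F)) =
      (\<Sum>F | A \<subseteq> F \<and> F \<subseteq> G. (-1) ^ card (G - A) * (-1) ^ card (F - A) :: 'b)"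
  proof (rule sum.cong[OF refl])
    fix F assume F: "F \<in> {F. A \<subseteq> F \<and> F \<subseteq> G}"
    then have "G - A = (G - F) \<union> (F - A)" by auto
    moreover have "finite F" using F assms finite_subset by auto
    ultimately have "card (G - A) = card (G - F) + card (F - A)"
      using assms(1) by (simp add: card_Un_disjoint Int_def)
    moreover have square: "(-1) ^ k * (-1) ^ k = (1 :: 'b)" for k
      by (simp flip: power_mult_distrib)
    ultimately show "(-1) ^ card (G - F) = ((-1) ^ card (G - A) * (-1) ^ card (F - A) :: 'b)"
      using square by (simp add: power_add mult.assoc)
  qed
  also have "\<dots> = (-1) ^ card (G - A) * of_bool (A = G)"
    using sum_supersets_alternating[OF assms, where 'b = 'b] by (simp add: sum_distrib_left[symmetric])
  finally show ?thesis by auto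
qed

text \<open>Hall's condition in complementary form: instead of unions of subfamilies it tests, for
  each \<open>U\<close>, the number of members inside \<open>U\<close>. This number is supermodular
  in \<open>U\<close>.\<close>

definition hall :: "'a set \<Rightarrow> 'a set multiset \<Rightarrow> bool" where
  "hall E Q \<longleftrightarrow> (\<forall>U\<subseteq>E. size (filter_mset (\<lambda>A. A \<subseteq> U) Q) \<le> card U)"

lemma hall_add_mset: "hall E (add_mset A Q) \<longleftrightarrow>
    hall E Q \<and> (\<forall>U. A \<subseteq> U \<and> U \<subseteq> E \<longrightarrow> size (filter_mset (\<lambda>A. A \<subseteq> U) Q) < card U)"
proof -
  let ?N = "\<lambda>U Q. size (filter_mset (\<lambda>A. A \<subseteq> U) Q)"
  have "?N U (add_mset A Q) \<le> card U \<longleftrightarrow> ?N U Q \<le> card U \<and> (A \<subseteq> U \<longrightarrow> ?N U Q < card U)" for U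
    by (cases "A \<subseteq> U") auto
  then show ?thesis unfolding hall_def by blast
qed

locale hall_degree =
  fixes E :: "'a set" and d :: nat
  assumes finite_E: "finite E" and d_le: "d \<le> card E"
begin

definition hall_val :: "'a set multiset \<Rightarrow> rat" where
  "hall_val Q = of_bool (size Q = d \<and> hall E Q)"

definition deg :: "('a set multiset \<Rightarrow>\<^sub>0 rat) \<Rightarrow> rat" where
  "deg = lin hall_val"

text \<open>The radical of the pairing given by \<open>deg\<close> of a product. Quantifying over
  multiples makes it an ideal and lets \<open>deg\<close>, which sees only size \<open>d\<close>,
  detect elements of smaller degree.\<close>

definition null :: "('a set multiset \<Rightarrow>\<^sub>0 rat) \<Rightarrow> bool" where
  "null p \<longleftrightarrow> (\<forall>q. deg (q * p) = 0)"

text \<open>The image of \<open>\<eta>\<^sub>A\<close>: all sets of cardinality at least \<open>d\<close> span the flat \<open>E\<close>, and \<open>\<eta>\<close> of the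
  empty set is \<open>0\<close>. The image \<open>flat_gen F\<close> of \<open>x\<^sub>F\<close> is found from it by Moebius inversion.\<close>

definition gen :: "'a set \<Rightarrow> 'a set multiset \<Rightarrow>\<^sub>0 rat" where
  "gen A = (if A = {} then 0 else Poly_Mapping.single {#if card A < d then A else E#} 1)"

definition flat_gen :: "'a set \<Rightarrow> 'a set multiset \<Rightarrow>\<^sub>0 rat" where
  "flat_gen F = - (\<Sum>G | F \<subseteq> G \<and> G \<subseteq> E. (-1) ^ card (G - F) * gen G)"

definition pflats :: "'a set set" where
  "pflats = {F. F \<subseteq> E \<and> card F < d}"

lemma finite_pflats: "finite pflats"
  by (rule finite_subset[of _ "Pow E"]) (auto simp: pflats_def finite_E)

lemma null_0 [simp]: "null 0" by (simp add: null_def deg_def)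

lemma null_add: "null p \<Longrightarrow> null q \<Longrightarrow> null (p + q)"
  by (simp add: null_def deg_def distrib_left lin_add)

lemma null_mult: "null p \<Longrightarrow> null (r * p)"
  unfolding null_def by (simp add: mult.assoc[symmetric])

lemma null_uminus: "null p \<Longrightarrow> null (- p)"
  by (simp add: null_def deg_def lin_uminus)

lemma null_sum: "(\<And>a. a \<in> A \<Longrightarrow> null (f a)) \<Longrightarrow> null (sum f A)"
  by (induction A rule: infinite_finite_induct) (simp_all add: null_add)

lemma null_if_monomials:
  assumes "\<And>w. deg (Poly_Mapping.single w 1 * p) = 0"
  shows "null p"
  unfolding null_def
proof
  fix q show "deg (q * p) = 0"
  proof (induction q rule: poly_mapping_add_induct)
    case (single k a)
    have "Poly_Mapping.single k a * p = Poly_Mapping.single 0 a * (Poly_Mapping.single k 1 * p)"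
      by (simp add: mult_single flip: mult.assoc)
    then have "deg (Poly_Mapping.single k a * p) = a * deg (Poly_Mapping.single k 1 * p)"
      by (simp only: deg_def lin_single_mult add_0)
    then show ?case using assms[of k] by simp
  qed (simp_all add: distrib_right deg_def lin_add)
qed

text \<open>The witness is \<open>U = {}\<close>; this is consistent with
  \<open>gen {} = 0\<close>.\<close>

lemma hall_empty: "{} \<in># Q \<Longrightarrow> \<not> hall E Q"
proof
  assume Q: "{} \<in># Q" and hall: "hall E Q"
  have "size (filter_mset (\<lambda>A. A \<subseteq> {}) Q) = 0"
    using hall[unfolded hall_def, rule_format, of "{}"] by simp
  then have "filter_mset (\<lambda>A. A \<subseteq> {}) Q = {#}" by (simp only: size_eq_0_iff_empty)
  moreover have "{} \<in># filter_mset (\<lambda>A. A \<subseteq> {}) Q" using Q by simp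
  ultimately have "{} \<in># ({#} :: 'a set multiset)" by (simp only:)
  then show False by simp
qed

text \<open>A set \<open>U\<close> above \<open>A\<close> has at least \<open>d\<close> elements
  while \<open>Q\<close> has fewer than \<open>d\<close> members, so the condition at
  \<open>U\<close> is automatic. Hence the degree cannot tell spanning sets apart, and
  \<open>gen\<close> may replace them by \<open>E\<close>.\<close>

lemma hall_add_large:
  assumes "size Q < d" "A \<subseteq> E" "d \<le> card A"
  shows "hall E (add_mset A Q) \<longleftrightarrow> hall E Q"
proof -
  have "size (filter_mset (\<lambda>A. A \<subseteq> U) Q) < card U" if "A \<subseteq> U" "U \<subseteq> E" for U
  proof -
    have "card A \<le> card U" by (rule card_mono[OF finite_subset[OF that(2) finite_E] that(1)])
    moreover have "size (filter_mset (\<lambda>A. A \<subseteq> U) Q) \<le> size Q"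
      by (simp add: size_mset_mono multiset_filter_subset)
    ultimately show ?thesis using assms by linarith
  qed
  then show ?thesis unfolding hall_add_mset by auto
qed

text \<open>The normalizations inside \<open>gen\<close> are invisible to \<open>deg\<close>, so
  that computations may use arbitrary subsets of \<open>E\<close> instead of flats.\<close>

lemma deg_gen:
  assumes "A \<subseteq> E"
  shows "deg (Poly_Mapping.single w 1 * gen A) = hall_val (add_mset A w)"
proof (cases "A = {}")
  case True then show ?thesis by (simp add: gen_def deg_def hall_val_def hall_empty)
next
  case False
  show ?thesis
  proof (cases "card A < d")
    case True
    with False show ?thesis by (simp add: gen_def deg_def mult_single)
  next
    case big: False
    have "hall_val (add_mset E w) = hall_val (add_mset A w)"
    proof (cases "size w + 1 = d")
      case True
      then have "size w < d" by simp
      then show ?thesis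
        using hall_add_large[of w A] hall_add_large[of w E] assms big d_le by (simp add: hall_val_def)
    qed (simp add: hall_val_def)
    then show ?thesis using False big by (simp add: gen_def deg_def mult_single)
  qed
qed

lemma deg_gen2:
  assumes "A \<subseteq> E" "B \<subseteq> E"
  shows "deg (Poly_Mapping.single w 1 * (gen A * gen B)) = hall_val (add_mset A (add_mset B w))"
proof (cases "B = {}")
  case True
  then have "hall_val (add_mset A (add_mset B w)) = 0" by (simp add: hall_val_def hall_empty)
  then show ?thesis using True by (simp add: gen_def deg_def)
next
  case False
  then obtain B' where B': "gen B = Poly_Mapping.single {#B'#} 1" by (auto simp: gen_def)
  have "deg (Poly_Mapping.single w 1 * (gen A * gen B)) = deg (Poly_Mapping.single (add_mset B' w) 1 * gen A)"
    unfolding B' by (simp add: mult_ac(2)[of "gen A"] mult.assoc[symmetric] mult_single)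
  also have "\<dots> = hall_val (add_mset A (add_mset B' w))" by (rule deg_gen[OF assms(1)])
  also have "\<dots> = deg (Poly_Mapping.single (add_mset A w) 1 * gen B)"
    unfolding B' by (simp add: deg_def mult_single add_mset_commute)
  also have "\<dots> = hall_val (add_mset A (add_mset B w))"
    by (simp add: deg_gen[OF assms(2)] add_mset_commute)
  finally show ?thesis .
qed

text \<open>Room for \<open>k\<close> further members in every set above \<open>X\<close>.\<close>

definition slack :: "nat \<Rightarrow> 'a set multiset \<Rightarrow> 'a set \<Rightarrow> bool" where
  "slack k w X \<longleftrightarrow> (\<forall>U. X \<subseteq> U \<and> U \<subseteq> E \<longrightarrow> size (filter_mset (\<lambda>A. A \<subseteq> U) w) + k \<le> card U)"

lemma slack_mono: "slack k w X \<Longrightarrow> X \<subseteq> Y \<Longrightarrow> slack k w Y"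
  unfolding slack_def by auto

lemma hall_add2: "hall E (add_mset A (add_mset B w)) \<longleftrightarrow>
    hall E w \<and> slack 1 w A \<and> slack 1 w B \<and> slack 2 w (A \<union> B)"
proof -
  have "hall E (add_mset A (add_mset B w)) \<longleftrightarrow>
     hall E w \<and> slack 1 w B \<and> (\<forall>U. A \<subseteq> U \<and> U \<subseteq> E \<longrightarrow> size (filter_mset (\<lambda>A. A \<subseteq> U) (add_mset B w)) < card U)"
    by (simp add: hall_add_mset slack_def Suc_le_eq)
  also have "(\<forall>U. A \<subseteq> U \<and> U \<subseteq> E \<longrightarrow> size (filter_mset (\<lambda>A. A \<subseteq> U) (add_mset B w)) < card U) \<longleftrightarrow>
     slack 1 w A \<and> slack 2 w (A \<union> B)" (is "?L \<longleftrightarrow> _")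
  proof (intro iffI conjI)
    assume L: ?L
    show "slack 1 w A"
      unfolding slack_def
    proof (intro allI impI)
      fix U assume "A \<subseteq> U \<and> U \<subseteq> E"
      with L have "size (filter_mset (\<lambda>A. A \<subseteq> U) (add_mset B w)) < card U" by blast
      then show "size (filter_mset (\<lambda>A. A \<subseteq> U) w) + 1 \<le> card U" by (cases "B \<subseteq> U") simp_all
    qed
    show "slack 2 w (A \<union> B)"
      unfolding slack_def
    proof (intro allI impI)
      fix U assume U: "A \<union> B \<subseteq> U \<and> U \<subseteq> E"
      with L have "size (filter_mset (\<lambda>A. A \<subseteq> U) (add_mset B w)) < card U" by blast
      then show "size (filter_mset (\<lambda>A. A \<subseteq> U) w) + 2 \<le> card U" using U by simp
    qed
  next
    assume S: "slack 1 w A \<and> slack 2 w (A \<union> B)"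
    show ?L
    proof (intro allI impI)
      fix U assume U: "A \<subseteq> U \<and> U \<subseteq> E"
      show "size (filter_mset (\<lambda>A. A \<subseteq> U) (add_mset B w)) < card U"
      proof (cases "B \<subseteq> U")
        case True
        then have "size (filter_mset (\<lambda>A. A \<subseteq> U) w) + 2 \<le> card U" using S U unfolding slack_def by simp
        then show ?thesis using True by simp
      next
        case False
        have "size (filter_mset (\<lambda>A. A \<subseteq> U) w) + 1 \<le> card U" using S U unfolding slack_def by blast
        then show ?thesis using False by simp
      qed
    qed
  qed
  finally show ?thesis by auto
qed

lemma size_filter_subset_supermodular:
  "size (filter_mset (\<lambda>A. A \<subseteq> U) w) + size (filter_mset (\<lambda>A. A \<subseteq> W) w) \<le>
   size (filter_mset (\<lambda>A. A \<subseteq> U \<union> W) w) + size (filter_mset (\<lambda>A. A \<subseteq> U \<inter> W) w)"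
  by (induction w) auto

text \<open>If both fail, there are saturated sets \<open>U\<close> above \<open>A\<close> and
  \<open>W\<close> above \<open>B\<close>. Cardinality is modular and the member count supermodular,
  so together with Hall's condition at \<open>U \<inter> W\<close> the set
  \<open>U \<union> W\<close> has no room for two more members.\<close>

lemma slack_cases:
  assumes "hall E w" "slack 2 w (A \<union> B)"
  shows "slack 1 w A \<or> slack 1 w B"
proof (rule ccontr)
  let ?N = "\<lambda>U. size (filter_mset (\<lambda>A. A \<subseteq> U) w)"
  assume "\<not> ?thesis"
  then obtain U W where U: "A \<subseteq> U" "U \<subseteq> E" "card U \<le> ?N U" and W: "B \<subseteq> W" "W \<subseteq> E" "card W \<le> ?N W"
    unfolding slack_def by (auto simp: not_less Suc_le_eq)
  have fin: "finite U" "finite W" using finite_subset[OF _ finite_E] U(2) W(2) by simp_all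
  have "?N (U \<union> W) + 2 \<le> card (U \<union> W)" using assms(2) U W unfolding slack_def by (meson Un_mono Un_least)
  moreover have "U \<inter> W \<subseteq> E" using U(2) by auto
  then have "?N (U \<inter> W) \<le> card (U \<inter> W)" using assms(1) unfolding hall_def by blast
  moreover have "card (U \<union> W) + card (U \<inter> W) = card U + card W" using card_Un_Int[OF fin] by simp
  ultimately show False using U(3) W(3) size_filter_subset_supermodular[of U w W] by linarith
qed

text \<open>Inserting \<open>i\<close> into a superset of \<open>A\<close> raises its cardinality by
  at most one and loses no members, so room for two above \<open>insert i A\<close> leaves room for
  one above \<open>A\<close>.\<close>

lemma slack_insert:
  assumes "hall E w" "slack 2 w (insert i A)" "i \<in> E"
  shows "slack 1 w A"
proof (rule ccontr)
  let ?N = "\<lambda>U. size (filter_mset (\<lambda>A. A \<subseteq> U) w)"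
  assume "\<not> ?thesis"
  then obtain U where U: "A \<subseteq> U" "U \<subseteq> E" "card U \<le> ?N U"
    unfolding slack_def by (auto simp: not_less Suc_le_eq)
  have fin: "finite U" using finite_subset[OF _ finite_E] U(2) by simp
  have "?N (insert i U) + 2 \<le> card (insert i U)"
    using assms(2,3) U unfolding slack_def by (meson insert_mono insert_subset)
  moreover have "?N U \<le> ?N (insert i U)" by (induction w) auto
  moreover have "card (insert i U) \<le> Suc (card U)" by (rule card_insert_le_m1) auto
  ultimately show False using U(3) by linarith
qed

text \<open>All four pairs have the same union, so the condition with room for two is common to them
  and the mixed difference factors into one difference for each single set. By
  \<open>slack_cases\<close> one of \<open>A\<close> and \<open>B\<close> has room for one, hence so
  does its enlargement, and the corresponding factor is zero.\<close>

lemma null_gen_exchange: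
  assumes "A \<subseteq> E" "B \<subseteq> E" "i \<in> A" "j \<in> B"
  shows "null ((gen A - gen (insert j A)) * (gen B - gen (insert i B)))"
proof (rule null_if_monomials)
  fix w
  have ij: "i \<in> E" "j \<in> E" using assms by auto
  have un: "A \<union> insert i B = A \<union> B" "insert j A \<union> B = A \<union> B" "insert j A \<union> insert i B = A \<union> B"
    using assms by auto
  have "deg (Poly_Mapping.single w 1 * ((gen A - gen (insert j A)) * (gen B - gen (insert i B)))) =
      deg (Poly_Mapping.single w 1 * (gen A * gen B)) - deg (Poly_Mapping.single w 1 * (gen A * gen (insert i B)))
      - (deg (Poly_Mapping.single w 1 * (gen (insert j A) * gen B))
         - deg (Poly_Mapping.single w 1 * (gen (insert j A) * gen (insert i B))))"
    unfolding deg_def lin_diff[symmetric] by (simp add: algebra_simps)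
  also have "\<dots> = hall_val (add_mset A (add_mset B w)) - hall_val (add_mset A (add_mset (insert i B) w))
      - (hall_val (add_mset (insert j A) (add_mset B w)) - hall_val (add_mset (insert j A) (add_mset (insert i B) w)))"
    using assms ij by (simp add: deg_gen2)
  also have "\<dots> = 0"
  proof (cases "hall E w \<and> slack 2 w (A \<union> B)")
    case True
    then have "slack 1 w A \<or> slack 1 w B" using slack_cases by blast
    moreover have "slack 1 w A \<Longrightarrow> slack 1 w (insert j A)" "slack 1 w B \<Longrightarrow> slack 1 w (insert i B)"
      using slack_mono by blast+
    ultimately show ?thesis unfolding hall_val_def hall_add2 un by auto
  next
    case False
    then show ?thesis unfolding hall_val_def hall_add2 un by auto
  qed
  finally show "deg (Poly_Mapping.single w 1 * ((gen A - gen (insert j A)) * (gen B - gen (insert i B)))) = 0" .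
qed

text \<open>The two pairs have the same union. When it has room for two, \<open>slack_insert\<close>
  gives room for one above \<open>A\<close>, hence above \<open>insert i A\<close>, and the two
  values agree.\<close>

lemma null_gen_singleton:
  assumes "A \<subseteq> E" "i \<in> E"
  shows "null (gen {i} * (gen A - gen (insert i A)))"
proof (rule null_if_monomials)
  fix w
  have un: "{i} \<union> A = insert i A" "{i} \<union> insert i A = insert i A" by auto
  have "deg (Poly_Mapping.single w 1 * (gen {i} * (gen A - gen (insert i A)))) =
      deg (Poly_Mapping.single w 1 * (gen {i} * gen A)) - deg (Poly_Mapping.single w 1 * (gen {i} * gen (insert i A)))"
    unfolding deg_def lin_diff[symmetric] by (simp add: algebra_simps)
  also have "\<dots> = hall_val (add_mset {i} (add_mset A w)) - hall_val (add_mset {i} (add_mset (insert i A) w))"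
    using assms by (simp add: deg_gen2)
  also have "\<dots> = 0"
    using slack_insert[of w i A] slack_mono[of 1 w A "insert i A"] assms
    unfolding hall_val_def hall_add2 un by auto
  finally show "deg (Poly_Mapping.single w 1 * (gen {i} * (gen A - gen (insert i A)))) = 0" .
qed

lemma flat_gen_split:
  assumes "F \<subseteq> E" "j \<in> E" "j \<notin> F"
  shows "flat_gen F = - (\<Sum>G | F \<subseteq> G \<and> G \<subseteq> E - {j}. (-1) ^ card (G - F) * (gen G - gen (insert j G)))"
  unfolding flat_gen_def by (subst sum_supersets_split[OF finite_E assms(2,3,1)]) simp

text \<open>The element \<open>j\<close> splits the sum for \<open>F\<close> and \<open>i\<close>
  the one for \<open>F'\<close>. Every \<open>A\<close> above \<open>F\<close> contains
  \<open>i\<close> and every \<open>B\<close> above \<open>F'\<close> contains \<open>j\<close>, as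
  the exchange property requires.\<close>

lemma null_incomparable:
  assumes F: "F \<subseteq> E" and F': "F' \<subseteq> E" and ij: "i \<in> F" "i \<notin> F'" "j \<in> F'" "j \<notin> F"
  shows "null (flat_gen F * flat_gen F')"
proof -
  have "flat_gen F * flat_gen F' =
     (\<Sum>A | F \<subseteq> A \<and> A \<subseteq> E - {j}. \<Sum>B | F' \<subseteq> B \<and> B \<subseteq> E - {i}.
        ((-1) ^ card (A - F) * (-1) ^ card (B - F')) * ((gen A - gen (insert j A)) * (gen B - gen (insert i B))))"
    using flat_gen_split[OF F, of j] flat_gen_split[OF F', of i] F F' ij
    by (simp add: subset_iff sum_product mult_ac)
  also have "null \<dots>"
    by (intro null_sum null_mult null_gen_exchange) (use ij in auto)
  finally show ?thesis .
qed

lemma null_singleton_flat: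
  assumes F: "F \<subseteq> E" and i: "i \<in> E" "i \<notin> F"
  shows "null (gen {i} * flat_gen F)"
proof -
  have "gen {i} * flat_gen F = - (\<Sum>A | F \<subseteq> A \<and> A \<subseteq> E - {i}. (-1) ^ card (A - F) * (gen {i} * (gen A - gen (insert i A))))"
    unfolding flat_gen_split[OF F i] by (simp add: sum_distrib_left mult_ac)
  also have "null \<dots>"
    by (intro null_uminus null_sum null_mult null_gen_singleton) (use i in auto)
  finally show ?thesis .
qed

text \<open>As \<open>F\<close> is not \<open>E\<close>, the signs add up to zero and every
  \<open>gen G\<close> may be replaced by \<open>gen G - gen E\<close>; this vanishes for sets with
  at least \<open>d\<close> elements.\<close>

lemma flat_gen_truncated:
  assumes "F \<in> pflats"
  shows "flat_gen F = (\<Sum>G | F \<subseteq> G \<and> G \<in> pflats. (-1) ^ card (G - F) * (gen E - gen G))"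
proof -
  have F: "F \<subseteq> E" "F \<noteq> E" using assms d_le by (auto simp: pflats_def)
  have fin: "finite {G. F \<subseteq> G \<and> G \<subseteq> E}" using finite_E by (auto intro: finite_subset[of _ "Pow E"])
  have "(\<Sum>G | F \<subseteq> G \<and> G \<subseteq> E. (-1) ^ card (G - F) * (gen E - gen G)) = flat_gen F"
    using sum_supersets_alternating[OF finite_E F(1), where 'b = "'a set multiset \<Rightarrow>\<^sub>0 rat"] F(2)
    by (simp add: flat_gen_def right_diff_distrib sum_subtractf sum_distrib_right[symmetric])
  moreover have "(\<Sum>G | F \<subseteq> G \<and> G \<subseteq> E. (-1) ^ card (G - F) * (gen E - gen G)) =
     (\<Sum>G | F \<subseteq> G \<and> G \<in> pflats. (-1) ^ card (G - F) * (gen E - gen G))"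
  proof (rule sum.mono_neutral_right[OF fin])
    show "\<forall>G\<in>{G. F \<subseteq> G \<and> G \<subseteq> E} - {G. F \<subseteq> G \<and> G \<in> pflats}. (-1) ^ card (G - F) * (gen E - gen G) = 0"
    proof
      fix G assume G: "G \<in> {G. F \<subseteq> G \<and> G \<subseteq> E} - {G. F \<subseteq> G \<and> G \<in> pflats}"
      then have "\<not> card G < d" "G \<subseteq> E" by (auto simp: pflats_def)
      moreover have "card F < d" using assms by (simp add: pflats_def)
      ultimately have "G \<noteq> {}" "E \<noteq> {}" by auto
      then have "gen G = gen E" using \<open>\<not> card G < d\<close> d_le by (simp add: gen_def)
      then show "(-1) ^ card (G - F) * (gen E - gen G) = 0" by simp
    qed
  qed (auto simp: pflats_def)
  ultimately show ?thesis by simp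
qed

text \<open>Moebius inversion: after the sums are exchanged, the alternating sum over all
  \<open>F\<close> between \<open>A\<close> and \<open>G\<close> leaves only \<open>G = A\<close>.
  If \<open>A\<close> is not a proper flat nothing is left, and
  \<open>gen A = gen E\<close>.\<close>

lemma sum_flat_gen_above:
  assumes "A \<subseteq> E" "0 < d"
  shows "(\<Sum>F | F \<in> pflats \<and> A \<subseteq> F. flat_gen F) = gen E - gen A"
proof -
  have fin: "finite {F. F \<in> pflats \<and> P F}" for P using finite_pflats by simp
  have fin2: "finite {G. F \<subseteq> G \<and> G \<in> pflats}" for F using finite_pflats by simp
  have fin3: "finite G" if "G \<in> pflats" for G using that finite_E finite_subset by (auto simp: pflats_def)
  have fin4: "finite {F. A \<subseteq> F \<and> F \<subseteq> G}" if "G \<in> pflats" for G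
    using fin3[OF that] by (auto intro: finite_subset[of _ "Pow G"])
  have "(\<Sum>F | F \<in> pflats \<and> A \<subseteq> F. flat_gen F) =
     (\<Sum>F | F \<in> pflats \<and> A \<subseteq> F. \<Sum>G | F \<subseteq> G \<and> G \<in> pflats. (-1) ^ card (G - F) * (gen E - gen G))"
    by (rule sum.cong) (auto simp: flat_gen_truncated)
  also have "\<dots> = (\<Sum>G | G \<in> pflats \<and> A \<subseteq> G. \<Sum>F | A \<subseteq> F \<and> F \<subseteq> G. (-1) ^ card (G - F) * (gen E - gen G))"
  proof -
    have "(\<Sum>p\<in>(SIGMA F:{F. F \<in> pflats \<and> A \<subseteq> F}. {G. F \<subseteq> G \<and> G \<in> pflats}).
          (-1) ^ card (snd p - fst p) * (gen E - gen (snd p))) =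
        (\<Sum>p\<in>(SIGMA G:{G. G \<in> pflats \<and> A \<subseteq> G}. {F. A \<subseteq> F \<and> F \<subseteq> G}).
          (-1) ^ card (fst p - snd p) * (gen E - gen (fst p)))"
    proof (rule sum.reindex_bij_witness[of _ prod.swap prod.swap])
      fix p assume "p \<in> (SIGMA F:{F. F \<in> pflats \<and> A \<subseteq> F}. {G. F \<subseteq> G \<and> G \<in> pflats})"
      then show "prod.swap p \<in> (SIGMA G:{G. G \<in> pflats \<and> A \<subseteq> G}. {F. A \<subseteq> F \<and> F \<subseteq> G})" by auto
    next
      fix p assume p: "p \<in> (SIGMA G:{G. G \<in> pflats \<and> A \<subseteq> G}. {F. A \<subseteq> F \<and> F \<subseteq> G})"
      obtain G F where "p = (G, F)" by (cases p) auto
      moreover from this p have "G \<in> pflats" "A \<subseteq> F" "F \<subseteq> G" by auto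
      moreover from this have "card F \<le> card G" using fin3 card_mono by blast
      ultimately show "prod.swap p \<in> (SIGMA F:{F. F \<in> pflats \<and> A \<subseteq> F}. {G. F \<subseteq> G \<and> G \<in> pflats})"
        by (auto simp: pflats_def)
    qed auto
    then show ?thesis using fin fin2 fin4 by (simp add: sum.Sigma case_prod_unfold)
  qed
  also have "\<dots> = (\<Sum>G | G \<in> pflats \<and> A \<subseteq> G. of_bool (A = G) * (gen E - gen G))"
    by (rule sum.cong[OF refl], subst sum_distrib_right[symmetric], subst sum_subsets_alternating)
       (auto simp: fin3)
  also have "\<dots> = gen E - gen A"
  proof (cases "A \<in> pflats")
    case True
    have "(\<Sum>G | G \<in> pflats \<and> A \<subseteq> G. of_bool (A = G) * (gen E - gen G)) =
        (\<Sum>G\<in>{A}. of_bool (A = G) * (gen E - gen G))"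
      by (rule sum.mono_neutral_right) (use True fin in auto)
    then show ?thesis by simp
  next
    case False
    then have "(\<Sum>G | G \<in> pflats \<and> A \<subseteq> G. of_bool (A = G) * (gen E - gen G)) = 0"
      by (intro sum.neutral) auto
    moreover have "\<not> card A < d" using False assms by (simp add: pflats_def)
    then have "A \<noteq> {}" "E \<noteq> {}" using assms by auto
    then have "gen A = gen E" using \<open>\<not> card A < d\<close> d_le by (simp add: gen_def)
    ultimately show ?thesis by simp
  qed
  finally show ?thesis .
qed

lemma sum_flat_gen_not_above:
  assumes "A \<subseteq> E" "0 < d"
  shows "(\<Sum>F | F \<in> pflats \<and> \<not> A \<subseteq> F. flat_gen F) = gen A"
proof -
  have "(\<Sum>F\<in>pflats. flat_gen F) = (\<Sum>F | F \<in> pflats \<and> A \<subseteq> F. flat_gen F) + (\<Sum>F | F \<in> pflats \<and> \<not> A \<subseteq> F. flat_gen F)"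
    using sum.Int_Diff[OF finite_pflats, of flat_gen "{F. A \<subseteq> F}"]
    by (simp add: Int_def set_diff_eq)
  moreover have "(\<Sum>F\<in>pflats. flat_gen F) = gen E"
    using sum_flat_gen_above[of "{}"] assms by (simp add: gen_def)
  ultimately show ?thesis using sum_flat_gen_above[OF assms] by simp
qed

end

section \<open>Test elements\<close>

definition mset_key :: "nat \<Rightarrow> 'a set multiset \<Rightarrow> nat" where
  "mset_key K Q = (\<Sum>A\<in>#Q. K ^ card A)"

lemma lin_one [simp]: "lin c 1 = c 0"
  using lin_single[of c 0 1] by simp

lemma mset_key_add: "mset_key K (P + Q) = mset_key K P + mset_key K Q"
  by (simp add: mset_key_def)

lemma mset_key_replicate: "mset_key K (replicate_mset a E) = a * K ^ card E"
  by (simp add: mset_key_def)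

lemma mset_split_top: "G = filter_mset (\<lambda>A. A \<noteq> E) G + replicate_mset (count G E) E"
  by (rule multiset_eqI) auto

text \<open>Fewer than \<open>K\<close> members other than \<open>E\<close>, each of weight at most
  \<open>K ^ (card E - 1)\<close>, weigh less than a single copy of \<open>E\<close>, so the
  multiplicity of \<open>E\<close> decides first.\<close>

lemma mset_key_less_of_count_less:
  assumes fin: "finite E" and G: "\<And>A. A \<in># G \<Longrightarrow> A \<subseteq> E" and sz: "size G < K"
    and cnt: "count G E < count Q E"
  shows "mset_key K G < mset_key K Q"
proof -
  let ?R = "filter_mset (\<lambda>A. A \<noteq> E) G"
  have "mset_key K ?R < K ^ card E"
  proof (cases "?R = {#}")
    case True then show ?thesis using sz unfolding True mset_key_def by simp
  next
    case False
    then obtain A where "A \<in># ?R" by blast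
    then have "A \<subset> E" using G by auto
    then have pos: "0 < card E" using psubset_card_mono[OF fin] by fastforce
    have le: "K ^ card A \<le> K ^ (card E - 1)" if "A \<in># ?R" for A
    proof -
      have "A \<subset> E" using that G by auto
      then have "card A < card E" by (rule psubset_card_mono[OF fin])
      then show ?thesis using sz by (intro power_increasing) auto
    qed
    have "mset_key K ?R \<le> (\<Sum>A\<in>#?R. K ^ (card E - 1))"
      unfolding mset_key_def by (rule sum_mset_mono) (rule le)
    also have "\<dots> = size ?R * K ^ (card E - 1)" by simp
    also have "\<dots> < K * K ^ (card E - 1)"
    proof -
      have "size ?R \<le> size G" by (simp add: size_mset_mono multiset_filter_subset)
      then have "size ?R < K" using sz by linarith
      moreover have "0 < K ^ (card E - 1)" using sz by simp
      ultimately show ?thesis by (rule mult_strict_right_mono)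
    qed
    also have "\<dots> = K ^ card E" using pos by (simp flip: power_Suc)
    finally show ?thesis .
  qed
  then have "mset_key K G < K ^ card E + count G E * K ^ card E"
    by (subst mset_split_top[of G E]) (simp add: mset_key_add mset_key_replicate)
  also have "\<dots> = Suc (count G E) * K ^ card E" by simp
  also have "\<dots> \<le> count Q E * K ^ card E" using cnt by (intro mult_le_mono1) simp
  also have "\<dots> \<le> mset_key K Q"
    by (subst (2) mset_split_top[of Q E]) (simp add: mset_key_add mset_key_replicate)
  finally show ?thesis .
qed

text \<open>The degree of the product of \<open>G\<close> with \<open>t\<close>, without the test on
  the size; it is applied when the monomials of \<open>t\<close> have complementary size. This frees
  it from \<open>d\<close>, which changes when a recursion passes to a smaller ground set.\<close>

definition hall_pair :: "'a set \<Rightarrow> 'a set multiset \<Rightarrow> ('a set multiset \<Rightarrow>\<^sub>0 rat) \<Rightarrow> rat" where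
  "hall_pair E G t = lin (\<lambda>w. of_bool (hall E (G + w))) t"

abbreviation sub_count :: "'a set \<Rightarrow> 'a set multiset \<Rightarrow> nat" where
  "sub_count U Q \<equiv> size (filter_mset (\<lambda>A. A \<subseteq> U) Q)"

text \<open>Copies of \<open>E\<close> are counted only at \<open>U = E\<close>, where the condition
  bounds the total size. At other \<open>U\<close> only \<open>U \<inter> L\<close> matters, since
  all members of \<open>Q\<close> lie in \<open>L\<close>.\<close>

lemma hall_add_tops:
  assumes fin: "finite E" and L: "L \<subset> E" and m: "card L + m \<le> card E"
    and Q: "\<And>A. A \<in># Q \<Longrightarrow> A \<subseteq> L" "size Q = card L"
  shows "hall E (Q + replicate_mset m E) \<longleftrightarrow> hall L Q"
proof
  assume h: "hall E (Q + replicate_mset m E)"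
  show "hall L Q"
    unfolding hall_def
  proof (intro allI impI)
    fix U assume U: "U \<subseteq> L"
    then have "sub_count U (Q + replicate_mset m E) \<le> card U"
      using h L unfolding hall_def by (meson psubset_imp_subset subset_trans)
    then show "sub_count U Q \<le> card U" by simp
  qed
next
  assume h: "hall L Q"
  show "hall E (Q + replicate_mset m E)"
    unfolding hall_def
  proof (intro allI impI)
    fix U assume U: "U \<subseteq> E"
    show "sub_count U (Q + replicate_mset m E) \<le> card U"
    proof (cases "U = E")
      case True
      have "sub_count U (Q + replicate_mset m E) \<le> size (Q + replicate_mset m E)"
        by (rule size_mset_mono) (rule multiset_filter_subset)
      then show ?thesis using True m Q(2) by simp
    next
      case False
      then have "\<not> E \<subseteq> U" using U by auto
      then have "filter_mset (\<lambda>A. A \<subseteq> U) (replicate_mset m E) = {#}" by (induction m) auto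
      moreover have "filter_mset (\<lambda>A. A \<subseteq> U) Q = filter_mset (\<lambda>A. A \<subseteq> U \<inter> L) Q"
        by (rule filter_mset_cong) (use Q(1) in auto)
      ultimately have "sub_count U (Q + replicate_mset m E) = sub_count (U \<inter> L) Q" by simp
      also have "\<dots> \<le> card (U \<inter> L)" by (rule h[unfolded hall_def, rule_format]) simp
      also have "\<dots> \<le> card U" by (rule card_mono) (use U fin finite_subset in auto)
      finally show ?thesis .
    qed
  qed
qed

lemma hall_replicate_top:
  assumes "finite E" "m \<le> card E"
  shows "hall E (replicate_mset m E)"
  unfolding hall_def
proof (intro allI impI)
  fix U assume U: "U \<subseteq> E"
  show "sub_count U (replicate_mset m E) \<le> card U"
  proof (cases "U = E")
    case True
    have "sub_count U (replicate_mset m E) \<le> size (replicate_mset m E)"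
      by (rule size_mset_mono) (rule multiset_filter_subset)
    then show ?thesis using True assms by simp
  next
    case False
    then have "\<not> E \<subseteq> U" using U by auto
    then have "filter_mset (\<lambda>A. A \<subseteq> U) (replicate_mset m E) = {#}" by (induction m) auto
    then show ?thesis by (simp only: size_empty le0)
  qed
qed

text \<open>If \<open>hall\<close> distinguishes the two sets \<open>E\<close> and \<open>L\<close>, some \<open>U \<supseteq> L\<close> is already saturated,
  which forces many elements of \<open>G\<close> below \<open>U\<close>.\<close>

lemma hall_distinguish:
  assumes fin: "finite E" and L: "L \<subset> E"
    and G: "size G = j' + a"
    and w: "\<And>A. A \<in># w \<Longrightarrow> A \<subseteq> L" "size w + j' = card L"
    and h: "hall E (add_mset E (G + w + replicate_mset c E))"
    and nh: "\<not> hall E (add_mset L (G + w + replicate_mset c E))"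
  shows "count G E < a \<or> (count G E = a \<and> size (filter_mset (\<lambda>A. A \<subseteq> L) G) = j')"
proof -
  let ?q = "G + w + replicate_mset c E"
  from h have hq: "hall E ?q" and top: "sub_count E ?q < card E" by (simp_all add: hall_add_mset)
  from nh hq obtain U where U: "L \<subseteq> U" "U \<subseteq> E" "card U \<le> sub_count U ?q"
    by (auto simp: hall_add_mset not_less)
  have "U \<noteq> E" using U(3) top by auto
  then have EU: "\<not> E \<subseteq> U" using U(2) by auto
  have 1: "filter_mset (\<lambda>A. A \<subseteq> U) (replicate_mset c E) = {#}" using EU by (induction c) auto
  have 2: "filter_mset (\<lambda>A. A \<subseteq> U) w = w" using w(1) U(1) by (simp add: filter_mset_eq_conv) auto
  have finU: "finite U" using finite_subset[OF U(2) fin] .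
  have LU: "card L \<le> card U" by (rule card_mono[OF finU U(1)])
  have N: "card U \<le> sub_count U G + size w" using U(3) 1 2 by simp
  have "filter_mset (\<lambda>A. A \<subseteq> U) G + replicate_mset (count G E) E \<subseteq># G"
  proof (rule mset_subset_eqI)
    fix A show "count (filter_mset (\<lambda>A. A \<subseteq> U) G + replicate_mset (count G E) E) A \<le> count G A"
      using EU by auto
  qed
  then have sz: "sub_count U G + count G E \<le> j' + a" using size_mset_mono G by fastforce
  have "count G E \<le> a" using sz N LU w(2) by linarith
  moreover have "size (filter_mset (\<lambda>A. A \<subseteq> L) G) = j'" if "count G E = a"
  proof -
    have "card U = card L" using sz N LU w(2) that by linarith
    then have "U = L" using card_subset_eq[OF finU U(1)] by simp
    then show ?thesis using sz N w(2) that by simp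
  qed
  ultimately show ?thesis by auto
qed

text \<open>Multiplication by \<open>(\<eta>\<^sub>E - \<eta>\<^sub>L) \<eta>\<^sub>E\<^sup>c\<close>.\<close>

definition top_shift :: "nat \<Rightarrow> 'a set \<Rightarrow> 'a set \<Rightarrow> ('a set multiset \<Rightarrow>\<^sub>0 rat) \<Rightarrow> ('a set multiset \<Rightarrow>\<^sub>0 rat)" where
  "top_shift c E L t = Poly_Mapping.single (add_mset E (replicate_mset c E)) 1 * t
     - Poly_Mapping.single (add_mset L (replicate_mset c E)) 1 * t"

lemma hall_pair_top_shift:
  "hall_pair E G (top_shift c E L t) =
   lin (\<lambda>w. of_bool (hall E (add_mset E (G + w + replicate_mset c E))) -
            of_bool (hall E (add_mset L (G + w + replicate_mset c E)))) t"
proof -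
  have "lin f t - lin g t = lin (\<lambda>w. f w - g w) t" for f g :: "'a set multiset \<Rightarrow> rat"
    by (simp add: lin_def sum_subtractf right_diff_distrib)
  then show ?thesis
    by (simp only: hall_pair_def top_shift_def lin_diff lin_single_mult mult_1_left) (simp add: ac_simps)
qed

lemma keys_top_shift:
  assumes "k \<in> Poly_Mapping.keys (top_shift c E L t)"
  obtains w B where "w \<in> Poly_Mapping.keys t" "k = add_mset B (replicate_mset c E) + w" "B = E \<or> B = L"
proof -
  have "k \<in> Poly_Mapping.keys (Poly_Mapping.single (add_mset E (replicate_mset c E)) 1 * t) \<or>
     k \<in> Poly_Mapping.keys (Poly_Mapping.single (add_mset L (replicate_mset c E)) 1 * t)"
  proof (rule ccontr)
    assume "\<not> ?thesis"
    then show False using assms by (simp add: top_shift_def in_keys_iff lookup_minus)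
  qed
  then show ?thesis
  proof
    assume "k \<in> Poly_Mapping.keys (Poly_Mapping.single (add_mset E (replicate_mset c E)) 1 * t)"
    then show ?thesis using that[of _ E] keys_mult[of "Poly_Mapping.single (add_mset E (replicate_mset c E)) (1::rat)" t]
      by fastforce
  next
    assume "k \<in> Poly_Mapping.keys (Poly_Mapping.single (add_mset L (replicate_mset c E)) 1 * t)"
    then show ?thesis using that[of _ L] keys_mult[of "Poly_Mapping.single (add_mset L (replicate_mset c E)) (1::rat)" t]
      by fastforce
  qed
qed

lemma lin_cong: "(\<And>k. k \<in> Poly_Mapping.keys t \<Longrightarrow> f k = g k) \<Longrightarrow> lin f t = lin g t"
  by (simp add: lin_def cong: sum.cong)

text \<open>The term with \<open>E\<close> reduces to Hall's condition on \<open>L\<close>. The term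
  with \<open>L\<close> vanishes: \<open>card L\<close> members already lie inside \<open>L\<close>,
  and one more violates the condition at \<open>U = L\<close>.\<close>

lemma hall_pair_top_shift_reduce:
  assumes fin: "finite E" and L: "L \<subset> E" and m: "card L + (c + 1 + a) \<le> card E"
    and G: "\<And>A. A \<in># G \<Longrightarrow> A \<subseteq> L" "size G = j'"
    and t: "\<And>w A. w \<in> Poly_Mapping.keys t \<Longrightarrow> A \<in># w \<Longrightarrow> A \<subseteq> L"
       "\<And>w. w \<in> Poly_Mapping.keys t \<Longrightarrow> size w + j' = card L"
  shows "hall_pair E (G + replicate_mset a E) (top_shift c E L t) = hall_pair L G t"
  unfolding hall_pair_top_shift hall_pair_def[of L]
proof (rule lin_cong)
  fix w assume w: "w \<in> Poly_Mapping.keys t"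
  have sub: "A \<subseteq> L" if "A \<in># G + w" for A using that G(1) t(1)[OF w] by auto
  have sz: "size (G + w) = card L" using t(2)[OF w] G(2) by simp
  have e: "add_mset E (G + replicate_mset a E + w + replicate_mset c E) = G + w + replicate_mset (c + 1 + a) E"
    by (rule multiset_eqI) auto
  have "hall E (add_mset E (G + replicate_mset a E + w + replicate_mset c E)) \<longleftrightarrow> hall L (G + w)"
    unfolding e by (rule hall_add_tops[OF fin L m sub sz])
  moreover have "\<not> hall E (add_mset L (G + replicate_mset a E + w + replicate_mset c E))"
  proof
    assume "hall E (add_mset L (G + replicate_mset a E + w + replicate_mset c E))"
    then have "sub_count L (G + replicate_mset a E + w + replicate_mset c E) < card L"
      using L by (simp add: hall_add_mset)
    moreover have "filter_mset (\<lambda>A. A \<subseteq> L) (G + w) = G + w"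
      unfolding filter_mset_eq_conv using sub by auto
    then have "sub_count L (G + w) = card L" using sz by (simp only:)
    ultimately show False by simp
  qed
  ultimately show "of_bool (hall E (add_mset E (G + replicate_mset a E + w + replicate_mset c E))) -
       of_bool (hall E (add_mset L (G + replicate_mset a E + w + replicate_mset c E))) =
       (of_bool (hall L (G + w)) :: rat)" by simp
qed

lemma lin_nonzero_key: "lin f t \<noteq> 0 \<Longrightarrow> \<exists>k\<in>Poly_Mapping.keys t. f k \<noteq> 0"
  unfolding lin_def by (metis (no_types, lifting) mult_zero_right sum.neutral)

text \<open>The product of these test elements with the normal monomials is unitriangular for the order
  given by \<open>mset_key\<close>: comparing keys with a large base is comparing, from the largest cardinality
  downwards, the number of members of that cardinality.\<close>

theorem triangular_test_element:
  assumes "finite E" "d \<le> card E" "Q \<in> normal_msets d E" "d = 0 \<longrightarrow> E = {}"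
  shows "\<exists>t. (\<forall>w\<in>Poly_Mapping.keys t. size w + size Q = d \<and> (\<forall>A\<in>#w. A \<subseteq> E)) \<and>
     hall_pair E Q t = 1 \<and>
     (\<forall>G K. size G = size Q \<longrightarrow> size Q < K \<longrightarrow> (\<forall>A\<in>#G. A \<subseteq> E) \<longrightarrow> hall_pair E G t \<noteq> 0 \<longrightarrow>
        G = Q \<or> mset_key K G < mset_key K Q)"
  using assms
proof (induction E arbitrary: d Q rule: finite_psubset_induct)
  case (psubset E)
  note fin = psubset.hyps and dE = psubset.prems(1) and Qn = psubset.prems(2)
  show ?case
  proof (cases "d = 0")
    case True
    then have "E = {}" using psubset.prems by simp
    then have "Q = {#}" using Qn by (simp add: normal_msets_empty)
    then show ?thesis using \<open>E = {}\<close> True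
      by (intro exI[of _ "Poly_Mapping.single {#} 1"]) (simp add: hall_pair_def hall_def)
  next
    case False
    then have d: "0 < d" by simp
    define Q' where "Q' = filter_mset (\<lambda>A. A \<noteq> E) Q"
    define L where "L = \<Union>(set_mset Q')"
    define a where "a = count Q E"
    note S = normal_msets_split[OF fin dE d Qn, folded Q'_def, folded L_def a_def]
    have L: "L \<subset> E" using S(1,2) dE by auto
    have finL: "finite L" using L fin finite_subset by blast
    have Q'n: "Q' \<in> normal_msets (card L) L" using S(3) by (simp add: normal_msets_to_def)
    have szQ: "size Q = size Q' + a" using S(5) by simp
    show ?thesis
    proof (cases "L = {}")
      case True
      then have "set_mset Q' \<subseteq> {{}}" unfolding L_def by auto
      then have "Q' = {#}" using normal_msetsD(1)[OF Q'n] by (metis empty_subsetI set_mset_eq_empty_iff subset_singletonD insertI1)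
      then have Q: "Q = replicate_mset a E" using S(5) by simp
      have ad: "a \<le> d" using S(4) True by (simp add: top_mult_def)
      \<comment> \<open>No member lies below \<open>E\<close>, so the test element is a power of the
        top element, of the complementary degree \<open>d - a\<close>.\<close>
      let ?t = "Poly_Mapping.single (replicate_mset (d - a) E) (1 :: rat)"
      have "replicate_mset a E + replicate_mset (d - a) E = replicate_mset d E"
        using ad by (intro multiset_eqI) simp
      then have one: "hall_pair E Q ?t = 1"
        using hall_replicate_top[OF fin dE] by (simp add: hall_pair_def Q)
      have "G = Q \<or> mset_key K G < mset_key K Q"
        if G: "size G = size Q" "size Q < K" "\<forall>A\<in>#G. A \<subseteq> E" for G K
      proof (cases "count G E < a")
        case True
        then show ?thesis using mset_key_less_of_count_less[OF fin, of G K Q] G Q by simp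
      next
        case False
        \<comment> \<open>\<open>G\<close> has at least \<open>a\<close> copies of \<open>E\<close>
          and size \<open>a\<close>, so nothing else fits.\<close>
        have "replicate_mset a E \<subseteq># G" using False by (simp add: count_le_replicate_mset_subset_eq[symmetric])
        then have "G = Q" using G(1) Q by (metis mset_subset_size size_replicate_mset subset_mset.le_imp_less_or_eq less_irrefl)
        then show ?thesis ..
      qed
      then show ?thesis using one ad Q by (intro exI[of _ ?t]) auto
    next
      case False
      have cL: "card L \<noteq> 0" using False finL by simp
      \<comment> \<open>The exponent that completes the degree: \<open>card L\<close> from the
        pairing on \<open>L\<close>, one from the difference, \<open>a\<close> from \<open>Q\<close>
        and \<open>c\<close> further copies of \<open>E\<close> add up to \<open>d\<close>. The
        bound on the multiplicity \<open>a\<close> ensures that the subtraction does not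
        truncate.\<close>
      define c where "c = d - card L - 1 - a"
      have cc: "card L + (c + 1 + a) = d" using S(2,4) cL by (simp add: top_mult_def c_def)
      \<comment> \<open>The recursion continues in the Boolean matroid on \<open>L\<close>, of rank
        \<open>card L\<close>.\<close>
      obtain t where T: "(\<forall>w\<in>Poly_Mapping.keys t. size w + size Q' = card L \<and> (\<forall>A\<in>#w. A \<subseteq> L)) \<and>
         hall_pair L Q' t = 1 \<and>
         (\<forall>G K. size G = size Q' \<longrightarrow> size Q' < K \<longrightarrow> (\<forall>A\<in>#G. A \<subseteq> L) \<longrightarrow> hall_pair L G t \<noteq> 0 \<longrightarrow>
            G = Q' \<or> mset_key K G < mset_key K Q')"
        by (rule exE[OF psubset.IH[OF L order_refl Q'n]]) (use cL in simp)
      have t1: "size w + size Q' = card L" if "w \<in> Poly_Mapping.keys t" for w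
        using T that by simp
      have t2: "A \<subseteq> L" if "w \<in> Poly_Mapping.keys t" "A \<in># w" for w A
        using T that by simp
      have t3: "hall_pair L Q' t = 1" using T by simp
      note t4 = T[THEN conjunct2, THEN conjunct2, rule_format]
      have red: "hall_pair E (G + replicate_mset a E) (top_shift c E L t) = hall_pair L G t"
        if "\<And>A. A \<in># G \<Longrightarrow> A \<subseteq> L" "size G = size Q'" for G
        by (rule hall_pair_top_shift_reduce[OF fin L _ that t2 t1]) (use cc dE in auto)
      have Q'L: "A \<subseteq> L" if "A \<in># Q'" for A using that unfolding L_def by auto
      have one: "hall_pair E Q (top_shift c E L t) = 1"
        using red[OF Q'L refl] t3 S(5) by simp
      have keys: "size w + size Q = d \<and> (\<forall>A\<in>#w. A \<subseteq> E)" if w: "w \<in> Poly_Mapping.keys (top_shift c E L t)" for w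
      proof -
        obtain v B where v: "v \<in> Poly_Mapping.keys t" "w = add_mset B (replicate_mset c E) + v" "B = E \<or> B = L"
          by (rule keys_top_shift[OF w])
        have "size w = c + 1 + size v" using v(2) by simp
        then have "size w + size Q = d" using t1[OF v(1)] szQ cc by linarith
        moreover have "\<forall>A\<in>#w. A \<subseteq> E" using v(2,3) t2[OF v(1)] L by auto
        ultimately show ?thesis by simp
      qed
      have tri: "G = Q \<or> mset_key K G < mset_key K Q"
        if G: "size G = size Q" "size Q < K" "\<forall>A\<in>#G. A \<subseteq> E" and nz: "hall_pair E G (top_shift c E L t) \<noteq> 0" for G K
      proof -
        from nz obtain w where w: "w \<in> Poly_Mapping.keys t"
          "of_bool (hall E (add_mset E (G + w + replicate_mset c E))) -
            of_bool (hall E (add_mset L (G + w + replicate_mset c E))) \<noteq> (0 :: rat)"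
          unfolding hall_pair_top_shift using lin_nonzero_key by blast
        \<comment> \<open>Inside \<open>E\<close> only \<open>E\<close> itself lies above
          \<open>E\<close>, so adding \<open>E\<close> is the weakest demand. A nonzero difference
          therefore means that \<open>E\<close> is accepted and \<open>L\<close> rejected.\<close>
        have mono: "hall E (add_mset E (G + w + replicate_mset c E))"
          if "hall E (add_mset L (G + w + replicate_mset c E))"
        proof -
          have "sub_count E (G + w + replicate_mset c E) < card E" "hall E (G + w + replicate_mset c E)"
            using that L by (simp_all add: hall_add_mset)
          then show ?thesis unfolding hall_add_mset by (metis subset_antisym)
        qed
        have hh: "hall E (add_mset E (G + w + replicate_mset c E))"
          "\<not> hall E (add_mset L (G + w + replicate_mset c E))"
          using w(2) mono by (cases "hall E (add_mset L (G + w + replicate_mset c E))"; simp)+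
        have "count G E < a \<or> (count G E = a \<and> size (filter_mset (\<lambda>A. A \<subseteq> L) G) = size Q')"
          by (rule hall_distinguish[OF fin L _ t2[OF w(1)] t1[OF w(1)] hh]) (use G(1) szQ in auto)
        then show ?thesis
        proof
          assume "count G E < a"
          then show ?thesis using mset_key_less_of_count_less[OF fin, of G K Q] G by (simp add: a_def)
        next
          assume as: "count G E = a \<and> size (filter_mset (\<lambda>A. A \<subseteq> L) G) = size Q'"
          let ?GL = "filter_mset (\<lambda>A. A \<subseteq> L) G"
          have "?GL + replicate_mset a E \<subseteq># G"
          proof (rule mset_subset_eqI)
            fix A show "count (?GL + replicate_mset a E) A \<le> count G A"
              using L as by auto
          qed
          moreover have "size (?GL + replicate_mset a E) = size G" using as G(1) szQ by simp
          ultimately have GG: "G = ?GL + replicate_mset a E"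
            by (metis mset_subset_size subset_mset.le_imp_less_or_eq less_irrefl)
          have "hall_pair L ?GL t \<noteq> 0"
            using nz red[of ?GL] as GG by simp
          then have "?GL = Q' \<or> mset_key K ?GL < mset_key K Q'"
            using as G(2) szQ by (intro t4) auto
          then show ?thesis
          proof
            assume "?GL = Q'"
            then show ?thesis using GG S(5) by simp
          next
            assume "mset_key K ?GL < mset_key K Q'"
            then have "mset_key K (?GL + replicate_mset a E) < mset_key K (Q' + replicate_mset a E)"
              by (simp add: mset_key_add)
            then show ?thesis using GG S(5) by simp
          qed
        qed
      qed
      show ?thesis
        by (intro exI[of _ "top_shift c E L t"] conjI ballI allI impI)
           (use keys one tri in auto)
    qed
  qed
qed

section \<open>Spanning the augmented Chow ring\<close>

lemma mono_degree_superset: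
  assumes "finite S" "Poly_Mapping.keys m \<subseteq> S"
  shows "mono_degree m = (\<Sum>v\<in>S. Poly_Mapping.lookup m v)"
  unfolding mono_degree_def by (rule sum.mono_neutral_left) (use assms in \<open>auto simp: in_keys_iff\<close>)

lemma mono_degree_add: "mono_degree (m + m') = mono_degree m + mono_degree m'"
proof -
  let ?S = "Poly_Mapping.keys m \<union> Poly_Mapping.keys m'"
  show ?thesis using keys_add[of m m'] by (simp add: mono_degree_superset[of ?S] lookup_add sum.distrib)
qed

lemma mono_degree_single [simp]: "mono_degree (Poly_Mapping.single v k) = k"
  by (simp add: mono_degree_def)

text \<open>The condition \<open>d0\<close> says that there are no loops: for
  \<open>d = 0 < n\<close> every element is one, and the Hilbert series is taken after their
  deletion.\<close>

locale uniform_chow =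
  fixes d n :: nat
  assumes dn: "d \<le> n" and d0: "d = 0 \<Longrightarrow> n = 0"
begin

abbreviation M :: "nat matroid" where "M \<equiv> uniform_matroid d n"
definition E :: "nat set" where "E = {1..n}"
abbreviation P :: "nat chow_var rat_mpoly ring" where "P \<equiv> chow_poly_ring M"
abbreviation C :: "nat chow_var rat_mpoly set" where "C \<equiv> carrier (chow_poly_ring M)"
abbreviation I :: "nat chow_var rat_mpoly set" where "I \<equiv> chow_ideal M"
abbreviation XV :: "nat set \<Rightarrow> nat chow_var rat_mpoly" where "XV F \<equiv> Var (XVar F)"
abbreviation YV :: "nat \<Rightarrow> nat chow_var rat_mpoly" where "YV i \<equiv> Var (YVar i)"

lemma card_E [simp]: "card E = n" by (simp add: E_def)

sublocale hall_degree E d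
  by standard (use dn in \<open>auto simp: E_def\<close>)

lemma ground_M: "ground M = E" by (simp add: uniform_matroid_def E_def)

lemma proper_flats_M: "proper_flats M = pflats"
  unfolding proper_flats_uniform[OF dn] pflats_def by (simp add: E_def)

lemma C_def: "C = {p. \<forall>m\<in>Poly_Mapping.keys p. Poly_Mapping.keys m \<subseteq> XVar ` pflats \<union> YVar ` E}"
  by (simp add: chow_poly_ring_def rat_poly_ring_def ground_M proper_flats_M)

lemma P_simps: "monoid.mult P = (*)" "one P = 1" "zero P = 0" "add P = (+)"
  by (simp_all add: chow_poly_ring_def rat_poly_ring_def)

lemma cring_P: "cring P"
  unfolding chow_poly_ring_def by (rule cring_rat_poly_ring)

sublocale P: cring P by (rule cring_P)

lemma C_0: "0 \<in> C" and C_1: "1 \<in> C" and C_add: "p \<in> C \<Longrightarrow> q \<in> C \<Longrightarrow> p + q \<in> C"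
  and C_mult: "p \<in> C \<Longrightarrow> q \<in> C \<Longrightarrow> p * q \<in> C"
  using P.zero_closed P.one_closed P.a_closed[of p q] P.m_closed[of p q] by (simp_all add: P_simps)

lemma C_uminus: "p \<in> C \<Longrightarrow> - p \<in> C" by (simp add: C_def)

lemma C_diff: "p \<in> C \<Longrightarrow> q \<in> C \<Longrightarrow> p - q \<in> C"
  using C_add[of p "- q"] C_uminus by simp

lemma C_sum: "(\<And>a. a \<in> A \<Longrightarrow> f a \<in> C) \<Longrightarrow> sum f A \<in> C"
  by (induction A rule: infinite_finite_induct) (simp_all add: C_0 C_add)

lemma C_power: "p \<in> C \<Longrightarrow> p ^ k \<in> C"
  by (induction k) (simp_all add: C_1 C_mult)

lemma C_Const: "Const c \<in> C" by (simp add: C_def Const_def)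

lemma C_X: "F \<in> pflats \<Longrightarrow> XV F \<in> C" by (simp add: C_def Var_def)

lemma C_Y: "i \<in> E \<Longrightarrow> YV i \<in> C" by (simp add: C_def Var_def)

lemma a_inv_P: "p \<in> C \<Longrightarrow> a_inv P p = - p"
  by (rule P.minus_equality) (simp_all add: P_simps C_uminus)

lemma gens_C: "chow_linear_rels M \<union> chow_product_rels M \<subseteq> C"
  unfolding chow_linear_rels_def chow_product_rels_def ground_M proper_flats_M
  by (auto intro!: C_diff C_mult C_sum C_X C_Y)

lemma ideal_I: "ideal I P"
  unfolding chow_ideal_def by (rule P.genideal_ideal[OF gens_C])

lemma gens_I: "chow_linear_rels M \<union> chow_product_rels M \<subseteq> I"
  unfolding chow_ideal_def by (rule P.genideal_self[OF gens_C])

lemma I_C: "p \<in> I \<Longrightarrow> p \<in> C"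
  by (rule ideal.Icarr[OF ideal_I])

lemma I_add: "p \<in> I \<Longrightarrow> q \<in> I \<Longrightarrow> p + q \<in> I"
  using additive_subgroup.a_closed[OF ideal.axioms(1)[OF ideal_I], of p q] by (simp add: P_simps)

lemma I_mult: "r \<in> C \<Longrightarrow> p \<in> I \<Longrightarrow> r * p \<in> I"
  using ideal.I_l_closed[OF ideal_I, of p r] by (simp add: P_simps)

lemma I_mult': "r \<in> C \<Longrightarrow> p \<in> I \<Longrightarrow> p * r \<in> I"
  using I_mult[of r p] by (simp add: mult.commute)

lemma I_0: "0 \<in> I"
  using additive_subgroup.zero_closed[OF ideal.axioms(1)[OF ideal_I]] by (simp add: P_simps)

lemma I_uminus: "p \<in> I \<Longrightarrow> - p \<in> I"
  using I_mult[of "- 1" p] C_uminus[OF C_1] by simp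

lemma I_diff: "p \<in> I \<Longrightarrow> q \<in> I \<Longrightarrow> p - q \<in> I"
  using I_add[of p "- q"] I_uminus by simp

lemma I_sum: "(\<And>a. a \<in> A \<Longrightarrow> f a \<in> I) \<Longrightarrow> sum f A \<in> I"
  by (induction A rule: infinite_finite_induct) (simp_all add: I_0 I_add)

definition eta :: "nat set \<Rightarrow> nat chow_var rat_mpoly" where
  "eta A = (\<Sum>F | F \<in> pflats \<and> \<not> A \<subseteq> F. XV F)"

definition eta_prod :: "nat set multiset \<Rightarrow> nat chow_var rat_mpoly" where
  "eta_prod Q = (\<Prod>A\<in>#Q. eta A)"

lemma eta_C: "eta A \<in> C"
  unfolding eta_def by (rule C_sum) (simp add: C_X)

lemma eta_prod_add: "eta_prod (Q + R) = eta_prod Q * eta_prod R"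
  by (simp add: eta_prod_def)

lemma eta_prod_add_mset: "eta_prod (add_mset A R) = eta A * eta_prod R"
  by (simp add: eta_prod_def)

lemma eta_prod_replicate: "eta_prod (replicate_mset k A) = eta A ^ k"
  by (simp add: eta_prod_def)

lemma eta_prod_C: "eta_prod Q \<in> C"
  by (induction Q) (simp_all add: eta_prod_add_mset C_mult eta_C C_1, simp add: eta_prod_def C_1)

lemma eta_empty: "eta {} = 0" by (simp add: eta_def)

lemma eta_large:
  assumes "d \<le> card A" "A \<subseteq> E"
  shows "eta A = eta E"
proof -
  have no: "\<not> B \<subseteq> F" if "F \<in> pflats" "d \<le> card B" for F B
  proof
    assume "B \<subseteq> F"
    moreover have "finite F" using that(1) finite_E finite_subset by (auto simp: pflats_def)
    ultimately have "card B \<le> card F" by (simp add: card_mono)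
    then show False using that by (simp add: pflats_def)
  qed
  have "{F. F \<in> pflats \<and> \<not> A \<subseteq> F} = pflats" using no[of _ A] assms by auto
  moreover have "{F. F \<in> pflats \<and> \<not> E \<subseteq> F} = pflats" using no[of _ E] dn by auto
  ultimately show ?thesis by (simp add: eta_def)
qed

lemma eta_diff:
  "A \<subseteq> B \<Longrightarrow> eta B - eta A = (\<Sum>F | F \<in> pflats \<and> A \<subseteq> F \<and> \<not> B \<subseteq> F. XV F)"
proof -
  assume AB: "A \<subseteq> B"
  have fin: "finite {F. F \<in> pflats \<and> R F}" for R using finite_pflats by simp
  have "{F. F \<in> pflats \<and> \<not> B \<subseteq> F} = {F. F \<in> pflats \<and> A \<subseteq> F \<and> \<not> B \<subseteq> F} \<union> {F. F \<in> pflats \<and> \<not> A \<subseteq> F}"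
    using AB by auto
  then have "eta B = (\<Sum>F | F \<in> pflats \<and> A \<subseteq> F \<and> \<not> B \<subseteq> F. XV F) + eta A"
    unfolding eta_def by (simp only:) (rule sum.union_disjoint, use fin in auto)
  then show ?thesis by simp
qed

lemma rel_XX:
  assumes "F \<in> pflats" "G \<in> pflats" "\<not> F \<subseteq> G" "\<not> G \<subseteq> F"
  shows "XV F * XV G \<in> I"
  using assms gens_I unfolding chow_product_rels_def proper_flats_M by blast

lemma rel_YX:
  assumes "F \<in> pflats" "i \<in> E" "i \<notin> F"
  shows "YV i * XV F \<in> I"
  using assms gens_I unfolding chow_product_rels_def proper_flats_M ground_M by blast

lemma rel_Y:
  assumes "i \<in> E"
  shows "YV i - eta {i} \<in> I"
proof -
  have "YV i - eta {i} \<in> chow_linear_rels M"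
    using assms unfolding chow_linear_rels_def eta_def ground_M proper_flats_M by auto
  then show ?thesis using gens_I by auto
qed

text \<open>A flat that contains \<open>A\<close> but not \<open>A \<union> B\<close> does not
  contain \<open>B\<close>, and symmetrically; so every product of variables in the expansion
  belongs to two incomparable flats.\<close>

lemma rel_exchange: "(eta A - eta (A \<union> B)) * (eta B - eta (A \<union> B)) \<in> I"
proof -
  have "(eta (A \<union> B) - eta A) * (eta (A \<union> B) - eta B) \<in> I"
    unfolding eta_diff[OF Un_upper1] eta_diff[OF Un_upper2] sum_product
    by (intro I_sum rel_XX) auto
  then show ?thesis by (simp add: algebra_simps)
qed

text \<open>The variables of flats that contain \<open>A\<close> but not \<open>i\<close> are
  annihilated by \<open>YV i\<close>, hence modulo the ideal the difference is annihilated by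
  \<open>eta {i}\<close>. The exchange relation with the set \<open>{i}\<close> then replaces
  \<open>eta {i}\<close> by \<open>eta (insert i A)\<close>.\<close>

lemma rel_cover:
  assumes i: "i \<in> E"
  shows "(eta A - eta (insert i A)) * eta (insert i A) \<in> I"
proof -
  let ?D = "eta A - eta (insert i A)"
  have D: "?D \<in> C" by (intro C_diff eta_C)
  have 1: "?D * (eta {i} - eta (insert i A)) \<in> I" using rel_exchange[of A "{i}"] by simp
  have "YV i * (eta (insert i A) - eta A) \<in> I"
    unfolding eta_diff[OF subset_insertI] sum_distrib_left
    by (intro I_sum rel_YX) (use i in auto)
  then have "YV i * (eta (insert i A) - eta A) + (YV i - eta {i}) * ?D \<in> I"
    by (rule I_add) (rule I_mult'[OF D rel_Y[OF i]])
  then have 2: "- (YV i * (eta (insert i A) - eta A) + (YV i - eta {i}) * ?D) \<in> I" by (rule I_uminus)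
  have "?D * eta (insert i A) = - (YV i * (eta (insert i A) - eta A) + (YV i - eta {i}) * ?D)
      - ?D * (eta {i} - eta (insert i A))"
    by (simp add: algebra_simps)
  then show ?thesis using I_diff[OF 2 1] by simp
qed

text \<open>The elements of \<open>B - A\<close> are inserted one at a time, each at the cost of one
  power of \<open>eta B\<close>.\<close>

lemma rel_power:
  assumes "A \<subseteq> B" "B \<subseteq> E" "card (B - A) \<le> k"
  shows "(eta A - eta B) * eta B ^ k \<in> I"
  using assms
proof (induction k arbitrary: A)
  case 0
  have "finite (B - A)" using 0(2) finite_E finite_subset by blast
  then have "A = B" using 0 by auto
  then show ?case by (simp add: I_0)
next
  case (Suc k)
  show ?case
  proof (cases "A = B")
    case True then show ?thesis by (simp add: I_0)
  next
    case False
    then obtain i where i: "i \<in> B" "i \<notin> A" using Suc.prems by auto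
    let ?K = "insert i A"
    have fin: "finite (B - A)" using Suc.prems(2) finite_E finite_subset by blast
    have "B - ?K = (B - A) - {i}" by auto
    then have "card (B - ?K) \<le> k" using i fin Suc.prems(3) by simp
    then have IH: "(eta ?K - eta B) * eta B ^ k \<in> I" using Suc.IH[of ?K] Suc.prems i by simp
    have cov: "(eta A - eta ?K) * eta ?K \<in> I" by (rule rel_cover) (use i Suc.prems in auto)
    \<comment> \<open>In the sum of these three multiples of known relations \<open>eta ?K\<close>
      cancels, and the relation for \<open>A\<close>, \<open>B\<close> and \<open>Suc k\<close> is
      left.\<close>
    have "eta B ^ k * ((eta A - eta ?K) * eta ?K) - (eta A - eta ?K) * ((eta ?K - eta B) * eta B ^ k)
        + eta B * ((eta ?K - eta B) * eta B ^ k) \<in> I"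
      by (intro I_add I_diff I_mult IH cov C_power C_diff eta_C)
    then show ?thesis by (simp add: algebra_simps)
  qed
qed

text \<open>For \<open>B = E\<close> the rank difference may be smaller than
  \<open>card (B - A)\<close>. An intermediate set \<open>B'\<close> with exactly \<open>d\<close>
  elements has the same \<open>eta\<close> as \<open>E\<close> and requires only the exponent
  \<open>d - card A\<close>.\<close>

lemma rel_power_rank:
  assumes "A \<subseteq> B" "B \<subseteq> E" "card A < d" "card B < d \<or> B = E" "min (card B) d \<le> k + card A"
  shows "(eta A - eta B) * eta B ^ k \<in> I"
proof (cases "card B < d")
  case True
  have "card (B - A) = card B - card A"
    using assms(1) finite_subset[OF assms(1) finite_subset[OF assms(2) finite_E]] by (intro card_Diff_subset)
  then show ?thesis using rel_power[OF assms(1,2), of k] assms True by simp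
next
  case False
  then have B: "B = E" using assms by simp
  have "card A \<le> d" "d \<le> card E" using assms dn by simp_all
  then obtain B' where B': "A \<subseteq> B'" "B' \<subseteq> E" "card B' = d"
    using exists_subset_between[of A d E] assms B finite_E by blast
  have "card (B' - A) = card B' - card A"
    using B'(1) finite_subset[OF assms(1) finite_subset[OF assms(2) finite_E]] by (intro card_Diff_subset)
  then have "(eta A - eta B') * eta B' ^ k \<in> I" using rel_power[OF B'(1,2), of k] assms B B'(3) dn by simp
  moreover have "eta B' = eta B" using eta_large[of B'] B' B by simp
  ultimately show ?thesis by simp
qed

definition normals :: "nat \<Rightarrow> nat set multiset set" where
  "normals j = {Q \<in> normal_msets d E. size Q = j}"

lemma finite_normals: "finite (normals j)"
  unfolding normals_def using finite_normal_msets[OF finite_E] by simp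

definition spanned :: "nat \<Rightarrow> nat chow_var rat_mpoly \<Rightarrow> bool" where
  "spanned j p \<longleftrightarrow> (\<exists>c. p - (\<Sum>Q\<in>normals j. Const (c Q) * eta_prod Q) \<in> I)"

lemma Const_add: "Const (a + b) = Const a + Const b" and Const_mult: "Const (a * b) = Const a * Const b"
  and Const_0 [simp]: "Const 0 = 0" and Const_1 [simp]: "Const 1 = 1" and Const_uminus: "Const (- a) = - Const a"
  by (simp_all add: Const_def single_add mult_single single_uminus)

lemma spanned_cong: "p - q \<in> I \<Longrightarrow> spanned j q \<Longrightarrow> spanned j p"
  unfolding spanned_def
proof (erule exE)
  fix c assume "p - q \<in> I" "q - (\<Sum>Q\<in>normals j. Const (c Q) * eta_prod Q) \<in> I"
  then have "(p - q) + (q - (\<Sum>Q\<in>normals j. Const (c Q) * eta_prod Q)) \<in> I" by (rule I_add)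
  then show "\<exists>c. p - (\<Sum>Q\<in>normals j. Const (c Q) * eta_prod Q) \<in> I" by auto
qed

lemma spanned_0: "spanned j 0"
  unfolding spanned_def by (rule exI[of _ "\<lambda>_. 0"]) (simp add: I_0)

lemma spanned_I: "p \<in> I \<Longrightarrow> spanned j p"
  using spanned_cong[of p 0 j] spanned_0 by simp

lemma spanned_add:
  assumes "spanned j p" "spanned j q"
  shows "spanned j (p + q)"
proof -
  obtain c e where "p - (\<Sum>Q\<in>normals j. Const (c Q) * eta_prod Q) \<in> I"
    "q - (\<Sum>Q\<in>normals j. Const (e Q) * eta_prod Q) \<in> I"
    using assms unfolding spanned_def by auto
  then have "(p - (\<Sum>Q\<in>normals j. Const (c Q) * eta_prod Q)) + (q - (\<Sum>Q\<in>normals j. Const (e Q) * eta_prod Q)) \<in> I"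
    by (rule I_add)
  then have "p + q - (\<Sum>Q\<in>normals j. Const (c Q + e Q) * eta_prod Q) \<in> I"
    by (simp add: Const_add distrib_right sum.distrib algebra_simps)
  then show ?thesis unfolding spanned_def by (intro exI[of _ "\<lambda>Q. c Q + e Q"])
qed

lemma spanned_scale:
  assumes "spanned j p"
  shows "spanned j (Const a * p)"
proof -
  obtain c where "p - (\<Sum>Q\<in>normals j. Const (c Q) * eta_prod Q) \<in> I"
    using assms unfolding spanned_def by auto
  then have "Const a * (p - (\<Sum>Q\<in>normals j. Const (c Q) * eta_prod Q)) \<in> I"
    by (rule I_mult[OF C_Const])
  then have "Const a * p - (\<Sum>Q\<in>normals j. Const (a * c Q) * eta_prod Q) \<in> I"
    by (simp add: Const_mult right_diff_distrib sum_distrib_left mult.assoc)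
  then show ?thesis unfolding spanned_def by (intro exI[of _ "\<lambda>Q. a * c Q"])
qed

lemma spanned_uminus: "spanned j p \<Longrightarrow> spanned j (- p)"
  using spanned_scale[of j p "- 1"] by (simp add: Const_uminus)

lemma spanned_diff: "spanned j p \<Longrightarrow> spanned j q \<Longrightarrow> spanned j (p - q)"
  using spanned_add[of j p "- q"] spanned_uminus by simp

lemma spanned_sum: "(\<And>a. a \<in> A \<Longrightarrow> spanned j (f a)) \<Longrightarrow> spanned j (sum f A)"
  by (induction A rule: infinite_finite_induct) (simp_all add: spanned_0 spanned_add)

lemma spanned_normal:
  assumes "Q \<in> normals j"
  shows "spanned j (eta_prod Q)"
  unfolding spanned_def
proof (rule exI[of _ "\<lambda>R. if R = Q then 1 else 0"])
  have "(\<Sum>R\<in>normals j. Const (if R = Q then 1 else 0) * eta_prod R) = (\<Sum>R\<in>normals j. if R = Q then eta_prod R else 0)"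
    by (rule sum.cong) auto
  also have "\<dots> = eta_prod Q" using assms finite_normals by simp
  finally show "eta_prod Q - (\<Sum>R\<in>normals j. Const (if R = Q then 1 else 0) * eta_prod R) \<in> I"
    by (simp add: I_0)
qed

text \<open>Straightening: every rewriting step enlarges the members of the multiset.\<close>

lemma spanned_eta_prod:
  assumes "\<And>A. A \<in># Q \<Longrightarrow> A \<subseteq> E"
  shows "spanned (size Q) (eta_prod Q)"
  using assms
proof (induction "\<Sum>A\<in>#Q. n - card A" arbitrary: Q rule: less_induct)
  case less
  note sub = less.prems
  have lt: "n - card B < n - card A" if "A \<subset> B" "B \<subseteq> E" for A B
  proof -
    have "card A < card B" using that finite_E finite_subset psubset_card_mono by metis
    moreover have "card B \<le> n" using card_mono[OF finite_E that(2)] by simp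
    ultimately show ?thesis by simp
  qed
  have step: "spanned (size Q) (eta_prod R)"
    if "size R = size Q" "(\<Sum>A\<in>#R. n - card A) < (\<Sum>A\<in>#Q. n - card A)" "\<And>A. A \<in># R \<Longrightarrow> A \<subseteq> E" for R
    using less.hyps[OF that(2,3)] that(1) by simp
  \<comment> \<open>The cases before \<open>normal\<close> list the ways to violate normality; each
    is removed by one relation.\<close>
  consider (empty) "{} \<in># Q"
    | (large) A where "A \<in># Q" "d \<le> card A" "A \<noteq> E"
    | (incomparable) A B where "A \<in># Q" "B \<in># Q" "\<not> A \<subseteq> B" "\<not> B \<subseteq> A"
    | (high) A where "A \<in># Q" "A \<noteq> {}" "card A < d \<or> A = E" "min (card A) d < count Q A"
    | (pair) A B where "A \<in># Q" "B \<in># Q" "A \<subset> B" "card A < d" "card B < d \<or> B = E" "min (card B) d \<le> count Q B + card A"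
    | (normal) "Q \<in> normal_msets d E"
  proof (rule ccontr)
    assume no: "\<not> thesis"
    have fl: "A \<noteq> {} \<and> A \<subseteq> E \<and> (card A < d \<or> A = E)" if "A \<in># Q" for A
      using that sub[OF that] no empty large[of A] by (metis not_less)
    have "Q \<in> normal_msets d E"
    proof (rule normal_msetsI)
      show "A \<noteq> {} \<and> A \<subseteq> E \<and> (card A < d \<or> A = E)" if "A \<in># Q" for A using fl[OF that] .
      show "A \<subseteq> B \<or> B \<subseteq> A" if "A \<in># Q" "B \<in># Q" for A B using that no incomparable[of A B] by auto
      show "count Q A \<le> min (card A) d" if "A \<in># Q" for A using that fl[OF that] no high[of A] by (meson not_less)
      show "count Q B + card A < min (card B) d" if "A \<in># Q" "B \<in># Q" "A \<subset> B" for A B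
      proof -
        have "A \<noteq> E" using that fl by blast
        then have "card A < d" using fl[OF that(1)] by simp
        then show ?thesis using that fl[OF that(2)] no pair[of A B] by (meson not_less)
      qed
    qed
    then show False using no normal by blast
  qed
  then show ?case
  proof cases
    case empty
    then obtain R where "Q = add_mset {} R" by (rule mset_add)
    then show ?thesis by (simp add: eta_prod_add_mset eta_empty spanned_0)
  next
    case (large A)
    then obtain R where Q: "Q = add_mset A R" by (blast elim: mset_add)
    have AE: "A \<subset> E" using large sub by auto
    have "spanned (size Q) (eta_prod (add_mset E R))"
    proof (rule step)
      show "(\<Sum>A\<in>#add_mset E R. n - card A) < (\<Sum>A\<in>#Q. n - card A)" using lt[OF AE] Q by simp
      show "B \<subseteq> E" if "B \<in># add_mset E R" for B using that sub Q by auto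
    qed (use Q in simp)
    then show ?thesis using eta_large[OF large(2)] AE by (simp add: Q eta_prod_add_mset)
  next
    case (incomparable A B)
    have "A \<noteq> B" using incomparable by auto
    then obtain R where Q: "Q = add_mset A (add_mset B R)"
      using incomparable(1,2) by (metis insert_noteq_member mset_add)
    let ?U = "A \<union> B"
    have U: "A \<subset> ?U" "B \<subset> ?U" "?U \<subseteq> E" using incomparable sub Q by auto
    note ltU = lt[OF U(1,3)] lt[OF U(2,3)]
    have S: "spanned (size Q) (eta_prod (add_mset ?U (add_mset D R)))" if "D \<in> {A, B, ?U}" for D
    proof (rule step)
      show "(\<Sum>A\<in>#add_mset ?U (add_mset D R). n - card A) < (\<Sum>A\<in>#Q. n - card A)" using ltU that Q by auto
      show "H \<subseteq> E" if "H \<in># add_mset ?U (add_mset D R)" for H using that sub Q U(3) \<open>D \<in> {A, B, ?U}\<close> by auto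
    qed (use Q in simp)
    \<comment> \<open>The exchange relation expresses the product of \<open>eta A\<close> and
      \<open>eta B\<close> through three products that contain \<open>eta ?U\<close>, each of
      smaller measure.\<close>
    have "eta_prod R * ((eta A - eta ?U) * (eta B - eta ?U)) \<in> I"
      by (rule I_mult[OF eta_prod_C rel_exchange])
    then have "eta_prod Q - (eta_prod (add_mset ?U (add_mset A R)) + eta_prod (add_mset ?U (add_mset B R))
        - eta_prod (add_mset ?U (add_mset ?U R))) \<in> I"
      by (simp add: Q eta_prod_add_mset algebra_simps)
    then show ?thesis by (rule spanned_cong) (intro spanned_add spanned_diff S; simp)
  next
    case (high A)
    let ?k = "min (card A) d"
    have "0 < d"
    proof (rule ccontr)
      assume "\<not> 0 < d"
      then have "n = 0" using d0 by simp
      then have "E = {}" unfolding E_def by simp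
      then show False using high(2) sub[OF high(1)] by simp
    qed
    have "replicate_mset (Suc ?k) A \<subseteq># Q" using high(4) unfolding count_le_replicate_mset_subset_eq[symmetric] by (simp add: Suc_le_eq)
    then obtain R where Q: "Q = replicate_mset (Suc ?k) A + R" by (metis subset_mset.add_diff_inverse)
    \<comment> \<open>Since \<open>eta {}\<close> is \<open>0\<close>, the power relation over the
      empty set says that the power of \<open>eta A\<close> with exponent \<open>Suc ?k\<close> lies
      in the ideal.\<close>
    have "(eta {} - eta A) * eta A ^ ?k \<in> I"
      by (rule rel_power_rank) (use high sub \<open>0 < d\<close> in auto)
    then have "(- eta_prod R) * ((eta {} - eta A) * eta A ^ ?k) \<in> I"
      by (rule I_mult[OF C_uminus[OF eta_prod_C]])
    then have "eta_prod Q \<in> I"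
      by (simp add: Q eta_prod_add eta_prod_add_mset eta_prod_replicate eta_empty algebra_simps)
    then show ?thesis by (rule spanned_I)
  next
    case (pair A B)
    let ?k = "count Q B"
    have "add_mset A (replicate_mset ?k B) \<subseteq># Q"
    proof (rule mset_subset_eqI)
      fix D show "count (add_mset A (replicate_mset ?k B)) D \<le> count Q D"
        using pair(1,3) by (auto simp: Suc_le_eq count_greater_zero_iff)
    qed
    then obtain R where Q: "Q = add_mset A (replicate_mset ?k B) + R" by (metis subset_mset.add_diff_inverse)
    define k where "k = ?k"
    have Q': "Q = add_mset A (replicate_mset k B + R)" using Q by (simp add: k_def)
    have BE: "B \<subseteq> E" using sub pair by auto
    \<comment> \<open>Enough factors \<open>eta B\<close> are present for one factor
      \<open>eta A\<close> to be replaced by \<open>eta B\<close>.\<close>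
    have "(eta A - eta B) * eta B ^ k \<in> I"
      by (rule rel_power_rank) (use pair BE in \<open>auto simp: k_def\<close>)
    then have "eta_prod R * ((eta A - eta B) * eta B ^ k) \<in> I"
      by (rule I_mult[OF eta_prod_C])
    then have "eta_prod Q - eta_prod (add_mset B (replicate_mset k B + R)) \<in> I"
      by (simp add: Q' eta_prod_add eta_prod_add_mset eta_prod_replicate algebra_simps)
    moreover have "spanned (size Q) (eta_prod (add_mset B (replicate_mset k B + R)))"
    proof (rule step)
      show "(\<Sum>A\<in>#add_mset B (replicate_mset k B + R). n - card A) < (\<Sum>A\<in>#Q. n - card A)"
        unfolding Q' using lt[OF pair(3) BE] by simp
      show "H \<subseteq> E" if "H \<in># add_mset B (replicate_mset k B + R)" for H
        using that sub[of H] BE unfolding Q' by (auto split: if_splits)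
    qed (use Q' in simp)
    ultimately show ?thesis by (rule spanned_cong)
  next
    case normal
    then show ?thesis by (intro spanned_normal) (simp add: normals_def)
  qed
qed

text \<open>Quantifying over \<open>R\<close> builds in stability under multiplication by the eta,
  so that a monomial can be assembled one variable at a time.\<close>

definition spans :: "nat \<Rightarrow> nat chow_var rat_mpoly \<Rightarrow> bool" where
  "spans j p \<longleftrightarrow> (\<forall>R. (\<forall>A\<in>#R. A \<subseteq> E) \<longrightarrow> spanned (size R + j) (eta_prod R * p))"

lemma spans_spanned: "spans j p \<Longrightarrow> spanned j p"
  unfolding spans_def by (drule spec[of _ "{#}"]) (simp add: eta_prod_def)

lemma spans_1: "spans 0 1"
  unfolding spans_def using spanned_eta_prod by simp

lemma spans_eta:
  assumes "spans j p" "A \<subseteq> E"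
  shows "spans (Suc j) (eta A * p)"
  unfolding spans_def
proof (intro allI impI)
  fix R :: "nat set multiset" assume "\<forall>A\<in>#R. A \<subseteq> E"
  then have "\<forall>B\<in>#add_mset A R. B \<subseteq> E" using assms(2) by simp
  then have "spanned (size (add_mset A R) + j) (eta_prod (add_mset A R) * p)"
    using assms(1) unfolding spans_def by blast
  then show "spanned (size R + Suc j) (eta_prod R * (eta A * p))"
    by (simp add: eta_prod_add_mset mult_ac)
qed

lemma spans_diff: "spans j p \<Longrightarrow> spans j q \<Longrightarrow> spans j (p - q)"
  unfolding spans_def by (simp add: right_diff_distrib spanned_diff)

lemma spans_sum: "(\<And>a. a \<in> A \<Longrightarrow> spans j (f a)) \<Longrightarrow> spans j (sum f A)"
  unfolding spans_def by (simp add: sum_distrib_left spanned_sum)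

lemma spans_cong:
  assumes "p - q \<in> I" "spans j q"
  shows "spans j p"
  unfolding spans_def
proof (intro allI impI)
  fix R :: "nat set multiset" assume R: "\<forall>A\<in>#R. A \<subseteq> E"
  have "eta_prod R * (p - q) \<in> I" by (intro I_mult eta_prod_C assms)
  then have "eta_prod R * p - eta_prod R * q \<in> I" by (simp add: right_diff_distrib)
  then show "spanned (size R + j) (eta_prod R * p)"
    by (rule spanned_cong) (use assms(2) R in \<open>simp add: spans_def\<close>)
qed

lemma spans_Y:
  assumes "spans j p" "i \<in> E" "p \<in> C"
  shows "spans (Suc j) (YV i * p)"
proof (rule spans_cong)
  show "YV i * p - eta {i} * p \<in> I"
    using I_mult'[OF assms(3) rel_Y[OF assms(2)]] by (simp add: left_diff_distrib)
  show "spans (Suc j) (eta {i} * p)" by (rule spans_eta) (use assms in auto)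
qed

text \<open>The variables of all proper flats above \<open>F\<close> add up to
  \<open>eta E - eta F\<close>, so \<open>XV F\<close> is obtained from the eta and the variables of
  larger flats, by induction from the largest flats downwards.\<close>

lemma spans_X:
  assumes "spans j p" "F \<in> pflats"
  shows "spans (Suc j) (XV F * p)"
  using assms(2)
proof (induction "n - card F" arbitrary: F rule: less_induct)
  case less
  have FE: "F \<subseteq> E" "F \<noteq> E" using less.prems dn by (auto simp: pflats_def)
  have no: "\<not> E \<subseteq> G" if "G \<in> pflats" for G using that dn by (auto simp: pflats_def dest: subset_antisym)
  have fin: "finite {G. G \<in> pflats \<and> R G}" for R using finite_pflats by simp
  have "eta E - eta F = (\<Sum>G | G \<in> pflats \<and> F \<subseteq> G. XV G)"
    unfolding eta_diff[OF FE(1)] by (rule sum.cong) (use no in auto)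
  also have "{G. G \<in> pflats \<and> F \<subseteq> G} = insert F {G. G \<in> pflats \<and> F \<subset> G}" using less.prems by auto
  also have "(\<Sum>G\<in>insert F {G. G \<in> pflats \<and> F \<subset> G}. XV G) = XV F + (\<Sum>G | G \<in> pflats \<and> F \<subset> G. XV G)"
    by (rule sum.insert) (use fin in auto)
  finally have eq: "XV F = eta E - eta F - (\<Sum>G | G \<in> pflats \<and> F \<subset> G. XV G)" by simp
  have "XV F * p = eta E * p - eta F * p - (\<Sum>G | G \<in> pflats \<and> F \<subset> G. XV G * p)"
    by (subst eq) (simp add: left_diff_distrib sum_distrib_right)
  also have "spans (Suc j) \<dots>"
  proof (intro spans_diff spans_sum spans_eta assms(1))
    fix G assume "G \<in> {G. G \<in> pflats \<and> F \<subset> G}"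
    then have G: "G \<in> pflats" "F \<subset> G" by auto
    have "G \<subseteq> E" using G(1) by (simp add: pflats_def)
    have "card F < card G" by (rule psubset_card_mono[OF finite_subset[OF \<open>G \<subseteq> E\<close> finite_E] G(2)])
    moreover have "card G \<le> n" using card_mono[OF finite_E \<open>G \<subseteq> E\<close>] by simp
    ultimately show "spans (Suc j) (XV G * p)" by (intro less.hyps G(1)) simp
  qed (use FE in auto)
  finally show ?case .
qed

lemma spans_monomial:
  assumes "Poly_Mapping.keys m \<subseteq> XVar ` pflats \<union> YVar ` E"
  shows "spans (mono_degree m) (Poly_Mapping.single m 1)"
  using assms
proof (induction "mono_degree m" arbitrary: m)
  case 0
  then have "Poly_Mapping.lookup m v = 0" for v
    by (cases "v \<in> Poly_Mapping.keys m") (simp_all add: mono_degree_def in_keys_iff)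
  then have "m = 0" by (simp add: poly_mapping_eqI)
  then show ?case using spans_1 by (simp add: mono_degree_def)
next
  case (Suc k)
  have "Poly_Mapping.keys m \<noteq> {}" using Suc(2) by (auto simp: mono_degree_def)
  then obtain v where v: "v \<in> Poly_Mapping.keys m" by blast
  define m' where "m' = m - Poly_Mapping.single v 1"
  have m: "m = Poly_Mapping.single v 1 + m'"
  proof (rule poly_mapping_eqI)
    fix u show "Poly_Mapping.lookup m u = Poly_Mapping.lookup (Poly_Mapping.single v 1 + m') u"
      using v by (auto simp: m'_def lookup_add lookup_minus lookup_single when_def in_keys_iff)
  qed
  have "Poly_Mapping.keys m' \<subseteq> Poly_Mapping.keys m"
    by (auto simp: m'_def in_keys_iff lookup_minus)
  then have km: "Poly_Mapping.keys m' \<subseteq> XVar ` pflats \<union> YVar ` E" using Suc.prems by auto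
  have k: "k = mono_degree m'" using Suc(2) m by (simp add: mono_degree_add)
  have IH: "spans k (Poly_Mapping.single m' 1)" using Suc(1)[OF k km] k by simp
  have mC: "Poly_Mapping.single m' 1 \<in> C" using km by (simp add: C_def)
  have prod: "Poly_Mapping.single m 1 = Var v * Poly_Mapping.single m' 1"
    by (subst m) (simp add: Var_def mult_single)
  have "v \<in> XVar ` pflats \<union> YVar ` E" using v Suc.prems by auto
  then have "spans (Suc k) (Var v * Poly_Mapping.single m' 1)"
    using spans_X[OF IH] spans_Y[OF IH _ mC] by auto
  then show ?case using prod Suc(2) by simp
qed

theorem spanned_homogeneous:
  assumes "p \<in> C" "homogeneous j p"
  shows "spanned j p"
proof -
  have "p = (\<Sum>m\<in>Poly_Mapping.keys p. Const (Poly_Mapping.lookup p m) * Poly_Mapping.single m 1)"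
    by (subst poly_mapping_sum_single[of p]) (simp add: Const_def mult_single)
  also have "spanned j \<dots>"
  proof (intro spanned_sum spanned_scale)
    fix m assume m: "m \<in> Poly_Mapping.keys p"
    then have "spans (mono_degree m) (Poly_Mapping.single m 1)" by (intro spans_monomial) (use assms C_def in auto)
    then show "spanned j (Poly_Mapping.single m 1)"
      using spans_spanned assms(2) m unfolding homogeneous_def by metis
  qed
  finally show ?thesis .
qed

end

section \<open>Linear independence of the normal monomials\<close>

context uniform_chow
begin

text \<open>The image of \<open>YVar i\<close> is dictated by the linear relation, which then holds
  exactly; only the product relations need the radical of the degree pairing.\<close>

definition theta :: "nat chow_var \<Rightarrow> nat set multiset \<Rightarrow>\<^sub>0 rat" where
  "theta v = (case v of XVar F \<Rightarrow> flat_gen F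
     | YVar i \<Rightarrow> (\<Sum>F | F \<in> pflats \<and> i \<notin> F. flat_gen F))"

lemma theta_YVar:
  assumes "i \<in> E"
  shows "theta (YVar i) = gen {i}"
proof -
  have "n \<noteq> 0" using assms by (auto simp: E_def)
  then have "0 < d" using d0 by auto
  then show ?thesis using sum_flat_gen_not_above[of "{i}"] assms by (simp add: theta_def)
qed

lemma generators_null:
  assumes "p \<in> chow_linear_rels M \<union> chow_product_rels M"
  shows "null (poly_subst theta p)"
  using assms
proof
  assume "p \<in> chow_linear_rels M"
  then obtain i where "p = YV i - (\<Sum>F | F \<in> pflats \<and> i \<notin> F. XV F)"
    unfolding chow_linear_rels_def proper_flats_M by auto
  then have "poly_subst theta p = 0"
    by (simp add: poly_subst_diff poly_subst_sum theta_def)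
  then show ?thesis by simp
next
  assume "p \<in> chow_product_rels M"
  then consider (XX) F G where "p = XV F * XV G" "F \<in> pflats" "G \<in> pflats" "\<not> F \<subseteq> G" "\<not> G \<subseteq> F"
    | (YX) i F where "p = YV i * XV F" "F \<in> pflats" "i \<in> E" "i \<notin> F"
    unfolding chow_product_rels_def proper_flats_M ground_M by blast
  then show ?thesis
  proof cases
    case (XX F G)
    obtain i j where "i \<in> F" "i \<notin> G" "j \<in> G" "j \<notin> F" using XX by auto
    moreover have "F \<subseteq> E" "G \<subseteq> E" using XX by (simp_all add: pflats_def)
    ultimately have "null (flat_gen F * flat_gen G)" by (intro null_incomparable[of F G i j])
    then show ?thesis using XX by (simp add: poly_subst_mult theta_def)
  next
    case (YX i F)
    have "F \<subseteq> E" using YX by (simp add: pflats_def)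
    then have "null (gen {i} * flat_gen F)" using YX by (intro null_singleton_flat)
    moreover have "theta (XVar F) = flat_gen F" by (simp add: theta_def)
    ultimately show ?thesis using YX theta_YVar[of i] by (simp add: poly_subst_mult)
  qed
qed

lemma chow_ideal_null:
  assumes "p \<in> I"
  shows "null (poly_subst theta p)"
proof -
  let ?J = "{p \<in> C. null (poly_subst theta p)}"
  have "ideal ?J P"
  proof (rule idealI[OF P.ring_axioms])
    show "subgroup ?J (add_monoid P)"
    proof (rule P.add.subgroupI)
      show "?J \<noteq> {}" using C_0 by (auto intro!: exI[of _ 0])
      show "\<ominus>\<^bsub>P\<^esub> a \<in> ?J" if "a \<in> ?J" for a
        using that a_inv_P[of a] C_uminus[of a] null_uminus
        by (simp add: poly_subst_uminus)
      show "a \<oplus>\<^bsub>P\<^esub> b \<in> ?J" if "a \<in> ?J" "b \<in> ?J" for a b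
        using that C_add[of a b] by (simp add: P_simps poly_subst_add null_add)
    qed auto
    show "x \<otimes>\<^bsub>P\<^esub> a \<in> ?J" if "a \<in> ?J" "x \<in> C" for a x
      using that C_mult[of x a] by (simp add: P_simps poly_subst_mult null_mult)
    show "a \<otimes>\<^bsub>P\<^esub> x \<in> ?J" if "a \<in> ?J" "x \<in> C" for a x
      using that C_mult[of a x] null_mult[of "poly_subst theta a" "poly_subst theta x"]
      by (simp add: P_simps poly_subst_mult mult.commute)
  qed
  moreover have "chow_linear_rels M \<union> chow_product_rels M \<subseteq> ?J"
    using gens_C generators_null by auto
  ultimately have "I \<subseteq> ?J" unfolding chow_ideal_def by (rule P.genideal_minimal)
  then show ?thesis using assms by auto
qed

lemma poly_subst_eta:
  assumes "A \<subseteq> E" "0 < d"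
  shows "poly_subst theta (eta A) = gen A"
  using sum_flat_gen_not_above[OF assms] by (simp add: eta_def poly_subst_sum theta_def)

text \<open>Restricted to nonempty flats, because for these \<open>gen\<close> is the basis vector
  of the set itself.\<close>

lemma poly_subst_eta_prod:
  assumes "\<And>A. A \<in># Q \<Longrightarrow> A \<noteq> {} \<and> A \<subseteq> E \<and> (card A < d \<or> A = E)" "Q \<noteq> {#} \<Longrightarrow> 0 < d"
  shows "poly_subst theta (eta_prod Q) = Poly_Mapping.single Q 1"
  using assms
proof (induction Q)
  case empty
  have "poly_subst theta 1 = poly_subst theta (Const 1)" by simp
  also have "\<dots> = Poly_Mapping.single 0 1" by (rule poly_subst_Const)
  finally show ?case by (simp add: eta_prod_def)
next
  case (add A Q)
  have "gen A = Poly_Mapping.single {#A#} 1" using add.prems(1)[of A] by (auto simp: gen_def)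
  moreover have "poly_subst theta (eta_prod Q) = Poly_Mapping.single Q 1"
    using add.IH add.prems by auto
  ultimately show ?case
    using poly_subst_eta[of A] add.prems by (simp add: eta_prod_add_mset poly_subst_mult mult_single)
qed

lemma poly_subst_eta_prod_normal:
  assumes "Q \<in> normal_msets d E"
  shows "poly_subst theta (eta_prod Q) = Poly_Mapping.single Q 1"
proof (rule poly_subst_eta_prod)
  show "0 < d" if ne: "Q \<noteq> {#}"
  proof -
    obtain A where A: "A \<in># Q" using ne by (rule multiset_nonemptyE)
    then have "0 < count Q A" by (simp add: count_greater_zero_iff)
    moreover have "count Q A \<le> d" using normal_msetsD(4)[OF assms A] by simp
    ultimately show ?thesis by linarith
  qed
qed (rule normal_msetsD(1)[OF assms])

theorem normals_independent:
  assumes rel: "(\<Sum>Q\<in>normals j. Const (c Q) * eta_prod Q) \<in> I" and Q: "Q \<in> normals j"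
  shows "c Q = 0"
proof (rule ccontr)
  \<comment> \<open>The base exceeds the common size \<open>j\<close>, as the comparison of keys
    requires.\<close>
  let ?key = "mset_key (Suc j)"
  assume "c Q \<noteq> 0"
  \<comment> \<open>The test element of \<open>Q0\<close> pairs nontrivially only with
    \<open>Q0\<close> and with monomials of smaller key; by minimality the latter have coefficient
    \<open>0\<close>, so the pairing isolates \<open>c Q0\<close>.\<close>
  then obtain Q0 where Q0: "Q0 \<in> normals j" "c Q0 \<noteq> 0"
    and min: "\<And>R. R \<in> normals j \<Longrightarrow> c R \<noteq> 0 \<Longrightarrow> ?key Q0 \<le> ?key R"
    using ex_has_least_nat[of "\<lambda>R. R \<in> normals j \<and> c R \<noteq> 0" Q ?key] Q by auto
  have Q0n: "Q0 \<in> normal_msets d E" and Q0j: "size Q0 = j" using Q0 by (simp_all add: normals_def)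
  have "d = 0 \<longrightarrow> E = {}"
  proof
    assume "d = 0"
    then have "n = 0" by (rule d0)
    then show "E = {}" unfolding E_def by simp
  qed
  from triangular_test_element[OF finite_E d_le Q0n this]
  obtain t where t: "(\<forall>w\<in>Poly_Mapping.keys t. size w + size Q0 = d \<and> (\<forall>A\<in>#w. A \<subseteq> E)) \<and>
     hall_pair E Q0 t = 1 \<and>
     (\<forall>G K. size G = size Q0 \<longrightarrow> size Q0 < K \<longrightarrow> (\<forall>A\<in>#G. A \<subseteq> E) \<longrightarrow> hall_pair E G t \<noteq> 0 \<longrightarrow>
        G = Q0 \<or> mset_key K G < mset_key K Q0)" by (rule exE)
  note tri = t[THEN conjunct2, THEN conjunct2, rule_format]
  have pair: "deg (Poly_Mapping.single R 1 * t) = hall_pair E R t" if "size R = j" for R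
  proof -
    have "deg (Poly_Mapping.single R 1 * t) = lin (\<lambda>w. hall_val (R + w)) t"
      by (simp add: deg_def lin_single_mult)
    also have "\<dots> = hall_pair E R t"
      unfolding hall_pair_def
    proof (rule lin_cong)
      fix w assume "w \<in> Poly_Mapping.keys t"
      then have "size w + size Q0 = d" using t by simp
      then show "hall_val (R + w) = of_bool (hall E (R + w))"
        using that Q0j by (simp add: hall_val_def)
    qed
    finally show ?thesis .
  qed
  have "poly_subst theta (\<Sum>R\<in>normals j. Const (c R) * eta_prod R) =
      (\<Sum>R\<in>normals j. Poly_Mapping.single 0 (c R) * Poly_Mapping.single R 1)"
    unfolding poly_subst_sum
    by (rule sum.cong) (simp_all add: poly_subst_mult poly_subst_eta_prod_normal normals_def)
  then have "null (\<Sum>R\<in>normals j. Poly_Mapping.single 0 (c R) * Poly_Mapping.single R 1)"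
    using chow_ideal_null[OF rel] by simp
  then have "0 = deg (t * (\<Sum>R\<in>normals j. Poly_Mapping.single 0 (c R) * Poly_Mapping.single R 1))"
    unfolding null_def by simp
  also have "\<dots> = (\<Sum>R\<in>normals j. deg (Poly_Mapping.single 0 (c R) * (Poly_Mapping.single R 1 * t)))"
    unfolding deg_def lin_sum[symmetric] sum_distrib_left by (simp only: mult_ac)
  also have "\<dots> = (\<Sum>R\<in>normals j. c R * hall_pair E R t)"
  proof (rule sum.cong[OF refl])
    fix R assume "R \<in> normals j"
    then have "size R = j" by (simp add: normals_def)
    from pair[OF this] show "deg (Poly_Mapping.single 0 (c R) * (Poly_Mapping.single R 1 * t)) = c R * hall_pair E R t"
      unfolding deg_def by (simp only: lin_single_mult add_0)
  qed
  also have "\<dots> = (\<Sum>R\<in>{Q0}. c R * hall_pair E R t)"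
  proof (rule sum.mono_neutral_right[OF finite_normals])
    show "\<forall>R\<in>normals j - {Q0}. c R * hall_pair E R t = 0"
    proof
      fix R assume R: "R \<in> normals j - {Q0}"
      then have Rn: "R \<in> normal_msets d E" "size R = j" by (simp_all add: normals_def)
      show "c R * hall_pair E R t = 0"
      proof (rule ccontr)
        assume "c R * hall_pair E R t \<noteq> 0"
        then have nz: "c R \<noteq> 0" "hall_pair E R t \<noteq> 0" by auto
        have "R = Q0 \<or> ?key R < ?key Q0"
        proof (rule tri)
          show "A \<subseteq> E" if "A \<in># R" for A using normal_msetsD(1)[OF Rn(1) that] by simp
        qed (use Rn Q0j nz in simp_all)
        then show False using R min[of R] nz by auto
      qed
    qed
  qed (use Q0 in simp)
  also have "\<dots> = c Q0" using t by simp
  finally show False using Q0(2) by simp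
qed

section \<open>Graded pieces of the quotient ring and their dimension\<close>

lemma homogeneous_add: "homogeneous j p \<Longrightarrow> homogeneous j q \<Longrightarrow> homogeneous j (p + q)"
  unfolding homogeneous_def using keys_add[of p q] by auto

lemma homogeneous_sum: "(\<And>a. a \<in> A \<Longrightarrow> homogeneous j (f a)) \<Longrightarrow> homogeneous j (sum f A)"
  by (induction A rule: infinite_finite_induct) (simp_all add: homogeneous_add, simp_all add: homogeneous_def)

lemma homogeneous_mult:
  assumes "homogeneous j p" "homogeneous k q"
  shows "homogeneous (j + k) (p * q)"
  unfolding homogeneous_def
proof
  fix m assume "m \<in> Poly_Mapping.keys (p * q)"
  then obtain a b where "m = a + b" "a \<in> Poly_Mapping.keys p" "b \<in> Poly_Mapping.keys q"
    using keys_mult[of p q] by auto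
  then show "mono_degree m = j + k" using assms by (simp add: homogeneous_def mono_degree_add)
qed

lemma homogeneous_Const: "homogeneous 0 (Const a)"
  by (simp add: homogeneous_def Const_def mono_degree_def)

lemma homogeneous_eta: "homogeneous 1 (eta A)"
  unfolding eta_def by (rule homogeneous_sum) (simp add: homogeneous_def Var_def)

lemma homogeneous_eta_prod: "homogeneous (size Q) (eta_prod Q)"
proof (induction Q)
  case empty
  show ?case by (simp add: eta_prod_def homogeneous_def mono_degree_def)
next
  case (add A Q)
  then show ?case using homogeneous_mult[OF homogeneous_eta[of A] add] by (simp add: eta_prod_add_mset)
qed

abbreviation R :: "nat chow_var rat_mpoly set ring" where "R \<equiv> chow_ring M"
abbreviation cl :: "nat chow_var rat_mpoly \<Rightarrow> nat chow_var rat_mpoly set" where "cl \<equiv> chow_class M"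
abbreviation K :: "nat chow_var rat_mpoly set set" where "K \<equiv> chow_scalars M"

lemma cl_eq: "cl = (+>\<^bsub>P\<^esub>) I"
  by (rule ext) (simp add: chow_class_def)

lemma cl_hom: "ring_hom_ring P R cl"
  unfolding cl_eq chow_ring_def by (rule ideal.rcos_ring_hom_ring[OF ideal_I])

sublocale h: ring_hom_ring P R cl by (rule cl_hom)

lemma zero_R: "\<zero>\<^bsub>R\<^esub> = I"
  by (simp add: chow_ring_def FactRing_def)

lemma cl_zero_iff: "p \<in> C \<Longrightarrow> cl p = \<zero>\<^bsub>R\<^esub> \<longleftrightarrow> p \<in> I"
  unfolding zero_R chow_class_def
  using ideal.rcos_const_imp_mem[OF ideal_I] P.a_rcos_zero[OF ideal_I] by auto

lemma cl_cong:
  assumes "p \<in> C" "q \<in> C" "p - q \<in> I"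
  shows "cl p = cl q"
proof -
  have "cl p = cl ((p - q) \<oplus>\<^bsub>P\<^esub> q)" by (simp add: P_simps)
  also have "\<dots> = cl (p - q) \<oplus>\<^bsub>R\<^esub> cl q" by (rule h.hom_add) (use assms I_C in auto)
  also have "cl (p - q) = \<zero>\<^bsub>R\<^esub>" using assms cl_zero_iff I_C by blast
  finally show ?thesis using h.hom_closed[OF assms(2)] by simp
qed

text \<open>Independence in degree \<open>0\<close>, where the only normal monomial is the empty
  one. It makes the quotient nonzero, so that the copy of the rationals in it is a field.\<close>

lemma one_notin_I: "1 \<notin> I"
proof
  assume "1 \<in> I"
  moreover have "{#} \<in> normals 0"
    by (simp add: normals_def normal_msets_def chain_subset_def)
  moreover have "normals 0 = {{#}}" using calculation(2) by (auto simp: normals_def)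
  ultimately show False using normals_independent[of "\<lambda>_. 1" 0 "{#}"] by (simp add: eta_prod_def)
qed

lemma subfield_Const: "subfield (range Const) P"
proof (rule P.subfieldI)
  show "subcring (range Const) P"
  proof (rule P.subcringI', rule P.subringI)
    show "range Const \<subseteq> C" using C_Const by auto
    show "\<one>\<^bsub>P\<^esub> \<in> range Const" using Const_1 by (metis P_simps(2) rangeI)
    show "\<ominus>\<^bsub>P\<^esub> h \<in> range Const" if "h \<in> range Const" for h
      using that a_inv_P C_Const Const_uminus by (metis (no_types, lifting) imageE rangeI)
    show "h1 \<otimes>\<^bsub>P\<^esub> h2 \<in> range Const" if "h1 \<in> range Const" "h2 \<in> range Const" for h1 h2
      using that by (auto simp: P_simps simp flip: Const_mult)
    show "h1 \<oplus>\<^bsub>P\<^esub> h2 \<in> range Const" if "h1 \<in> range Const" "h2 \<in> range Const" for h1 h2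
      using that by (auto simp: P_simps simp flip: Const_add)
  qed
  show "Units (P\<lparr>carrier := range Const\<rparr>) = range Const - {\<zero>\<^bsub>P\<^esub>}"
  proof (intro equalityI subsetI)
    fix x assume "x \<in> Units (P\<lparr>carrier := range Const\<rparr>)"
    then obtain y where "x \<in> range Const" "y * x = 1" by (auto simp: Units_def P_simps)
    moreover from this have "x \<noteq> 0" by auto
    ultimately show "x \<in> range Const - {\<zero>\<^bsub>P\<^esub>}" by (simp add: P_simps)
  next
    fix x assume "x \<in> range Const - {\<zero>\<^bsub>P\<^esub>}"
    then have "x \<in> range Const" "x \<noteq> 0" by (simp_all add: P_simps)
    then obtain a where "x = Const a" by auto
    with \<open>x \<noteq> 0\<close> have a: "x = Const a" "a \<noteq> 0" by auto
    have "Const (1 / a) * Const a = 1" "Const a * Const (1 / a) = 1"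
      using a(2) by (simp_all flip: Const_mult)
    then show "x \<in> Units (P\<lparr>carrier := range Const\<rparr>)"
      using a(1) by (auto simp: Units_def P_simps)
  qed
qed

lemma subfield_K: "subfield K R"
proof -
  have "\<one>\<^bsub>R\<^esub> \<noteq> \<zero>\<^bsub>R\<^esub>"
    using one_notin_I cl_zero_iff[OF C_1] h.hom_one by (simp add: P_simps)
  then show ?thesis unfolding chow_scalars_def by (rule h.img_is_subfield(2)[OF subfield_Const])
qed

lemma combine_cl:
  assumes "length as = length qs"
  shows "h.S.combine (map (\<lambda>a. cl (Const a)) as) (map (\<lambda>Q. cl (eta_prod Q)) qs) =
     cl (\<Sum>(a, Q)\<leftarrow>zip as qs. Const a * eta_prod Q)"
  using assms
proof (induction as qs rule: list_induct2)
  case Nil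
  show ?case using h.hom_zero by (simp add: P_simps)
next
  case (Cons a as Q qs)
  have l: "(\<Sum>(a, Q)\<leftarrow>xs. Const a * eta_prod Q) \<in> C" for xs
    by (induction xs) (auto simp: C_0 C_add C_mult C_Const eta_prod_C)
  have "cl (Const a * eta_prod Q + (\<Sum>(a, Q)\<leftarrow>zip as qs. Const a * eta_prod Q)) =
      cl (Const a \<otimes>\<^bsub>P\<^esub> eta_prod Q \<oplus>\<^bsub>P\<^esub> (\<Sum>(a, Q)\<leftarrow>zip as qs. Const a * eta_prod Q))"
    by (simp add: P_simps)
  also have "\<dots> = cl (Const a) \<otimes>\<^bsub>R\<^esub> cl (eta_prod Q) \<oplus>\<^bsub>R\<^esub> cl (\<Sum>(a, Q)\<leftarrow>zip as qs. Const a * eta_prod Q)"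
    using l C_Const eta_prod_C by (simp add: h.hom_add h.hom_mult)
  finally show ?case using Cons.IH by simp
qed

lemma sum_list_zip_distinct:
  assumes "distinct qs"
  shows "(\<Sum>(a, Q)\<leftarrow>zip (map c qs) qs. Const a * eta_prod Q) = (\<Sum>Q\<in>set qs. Const (c Q) * eta_prod Q)"
proof -
  have "(\<Sum>(a, Q)\<leftarrow>zip (map c qs) qs. Const a * eta_prod Q) = (\<Sum>Q\<leftarrow>qs. Const (c Q) * eta_prod Q)"
    by (induction qs) simp_all
  then show ?thesis using assms by (simp add: sum_list_distinct_conv_sum_set)
qed

theorem dim_chow_graded: "ring.dim R K (chow_graded M j) = card (normals j)"
proof -
  obtain qs where qs: "set qs = normals j" "distinct qs"
    using finite_distinct_list[OF finite_normals] by blast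
  let ?Us = "map (\<lambda>Q. cl (eta_prod Q)) qs"
  have Us: "set ?Us \<subseteq> carrier R" using h.hom_closed[OF eta_prod_C] by auto
  have comb: "h.S.combine (map (\<lambda>Q. cl (Const (c Q))) qs) ?Us = cl (\<Sum>Q\<in>normals j. Const (c Q) * eta_prod Q)" for c
    using combine_cl[of "map c qs" qs] sum_list_zip_distinct[OF qs(2), of c] qs(1) by (simp add: comp_def)
  \<comment> \<open>Linear combinations in the quotient are formed from lists of scalars. As
    \<open>qs\<close> has no repetitions, such a list comes from a function on the normal multisets,
    the form in which spanning and independence are available.\<close>
  have coeffs: "\<exists>c. Ks = map (\<lambda>Q. cl (Const (c Q))) qs" if "set Ks \<subseteq> K" "length Ks = length qs" for Ks
  proof -
    have "\<forall>k\<in>set Ks. \<exists>a. k = cl (Const a)" using that(1) by (auto simp: chow_scalars_def)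
    then obtain f where f: "\<And>k. k \<in> set Ks \<Longrightarrow> k = cl (Const (f k))" by metis
    define c where "c Q = f (the (map_of (zip qs Ks) Q))" for Q
    have "Ks = map (\<lambda>Q. cl (Const (c Q))) qs"
    proof (rule nth_equalityI)
      fix i assume i: "i < length Ks"
      then have "map_of (zip qs Ks) (qs ! i) = Some (Ks ! i)"
        using map_of_zip_nth[OF that(2)[symmetric] qs(2)] by simp
      then show "Ks ! i = map (\<lambda>Q. cl (Const (c Q))) qs ! i"
        using f[of "Ks ! i"] i that(2) by (simp add: c_def)
    qed (use that in simp)
    then show ?thesis by blast
  qed
  have sumC: "(\<Sum>Q\<in>normals j. Const (c Q) * eta_prod Q) \<in> C" for c
    by (intro C_sum C_mult C_Const eta_prod_C)
  have "h.S.Span K ?Us = chow_graded M j"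
  proof (intro equalityI subsetI)
    fix x assume "x \<in> h.S.Span K ?Us"
    then obtain Ks where "set Ks \<subseteq> K" "length Ks = length qs" "x = h.S.combine Ks ?Us"
      unfolding h.S.Span_mem_iff_length_version[OF subfield_K Us] by auto
    moreover obtain c where "Ks = map (\<lambda>Q. cl (Const (c Q))) qs" using coeffs calculation by blast
    ultimately have "x = cl (\<Sum>Q\<in>normals j. Const (c Q) * eta_prod Q)" using comb by simp
    moreover have "homogeneous j (\<Sum>Q\<in>normals j. Const (c Q) * eta_prod Q)"
    proof (rule homogeneous_sum)
      fix Q assume "Q \<in> normals j"
      then show "homogeneous j (Const (c Q) * eta_prod Q)"
        using homogeneous_mult[OF homogeneous_Const[of "c Q"] homogeneous_eta_prod[of Q]] by (simp add: normals_def)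
    qed
    ultimately show "x \<in> chow_graded M j" unfolding chow_graded_def using sumC by auto
  next
    fix x assume "x \<in> chow_graded M j"
    then obtain p where p: "x = cl p" "p \<in> C" "homogeneous j p" unfolding chow_graded_def by auto
    then obtain c where "p - (\<Sum>Q\<in>normals j. Const (c Q) * eta_prod Q) \<in> I"
      using spanned_homogeneous unfolding spanned_def by blast
    then have "x = h.S.combine (map (\<lambda>Q. cl (Const (c Q))) qs) ?Us"
      using cl_cong[OF p(2) sumC] p(1) comb by simp
    moreover have "set (map (\<lambda>Q. cl (Const (c Q))) qs) \<subseteq> K" by (auto simp: chow_scalars_def)
    ultimately show "x \<in> h.S.Span K ?Us"
      unfolding h.S.Span_mem_iff_length_version[OF subfield_K Us] by (metis length_map)
  qed
  moreover have "h.S.independent K ?Us"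
  proof (rule ccontr)
    assume dep: "\<not> h.S.independent K ?Us"
    then have ne: "qs \<noteq> []" by auto
    obtain Ks where Ks: "length Ks = length ?Us" "h.S.combine Ks ?Us = \<zero>\<^bsub>R\<^esub>" "set Ks \<subseteq> K" "set Ks \<noteq> {\<zero>\<^bsub>R\<^esub>}"
      by (rule h.S.dependent_imp_non_trivial_combine[OF subfield_K Us dep])
    obtain c where c: "Ks = map (\<lambda>Q. cl (Const (c Q))) qs" using coeffs[OF Ks(3)] Ks(1) by auto
    have "(\<Sum>Q\<in>normals j. Const (c Q) * eta_prod Q) \<in> I"
      using Ks(2) cl_zero_iff[OF sumC] unfolding c comb by simp
    then have "c Q = 0" if "Q \<in> normals j" for Q using normals_independent that by blast
    then have "set Ks = (\<lambda>_. cl 0) ` set qs" using c qs(1) by (simp cong: image_cong)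
    then have "set Ks = {cl 0}" using ne by (simp add: image_constant_conv)
    then show False using Ks(4) h.hom_zero by (simp add: P_simps)
  qed
  ultimately have "h.S.dimension (length ?Us) K (chow_graded M j)" by (intro h.S.dimensionI[OF subfield_K])
  then have "h.S.dim K (chow_graded M j) = length ?Us"
    using h.S.dimI[OF subfield_K] by (simp add: over_def)
  then show ?thesis using qs distinct_card[OF qs(2)] by simp
qed

end

section \<open>Hilbert series of uniform matroids and the final identity\<close>

lemma fps_to_fls_sum: "fps_to_fls (sum f A) = (\<Sum>a\<in>A. fps_to_fls (f a))"
  for f :: "'b \<Rightarrow> 'a::comm_ring_1 fps"
  by (induction A rule: infinite_finite_induct) simp_all

lemma fps_of_cards:
  assumes "finite S"
  shows "fps_to_fls (Abs_fps (\<lambda>j. of_nat (card {Q \<in> S. size Q = j}) :: rat)) = (\<Sum>Q\<in>S. fls_X ^ size Q)"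
proof -
  have "Abs_fps (\<lambda>j. of_nat (card {Q \<in> S. size Q = j}) :: rat) = (\<Sum>Q\<in>S. fps_X ^ size Q)"
  proof (rule fps_ext)
    fix j
    have "(\<Sum>Q\<in>S. fps_X ^ size Q :: rat fps) $ j = (\<Sum>Q\<in>S. if size Q = j then 1 else 0)"
      by (auto simp: fps_sum_nth fps_X_power_nth intro!: sum.cong)
    also have "\<dots> = of_nat (card {Q \<in> S. size Q = j})"
      using assms by (simp add: sum.If_cases Int_def)
    finally show "Abs_fps (\<lambda>j. of_nat (card {Q \<in> S. size Q = j}) :: rat) $ j = (\<Sum>Q\<in>S. fps_X ^ size Q) $ j"
      by simp
  qed
  then show ?thesis by (simp add: fps_to_fls_sum fps_to_fls_power)
qed

lemma loops_uniform: "0 < d \<Longrightarrow> loops (uniform_matroid d n) = {}"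
  by (auto simp: loops_def uniform_matroid_def)

lemma delete_empty: "delete (uniform_matroid d n) {} = uniform_matroid d n"
  by (simp add: delete_def uniform_matroid_def)

lemma delete_loops_rank_0: "delete (uniform_matroid 0 n) (loops (uniform_matroid 0 n)) = uniform_matroid 0 0"
proof -
  have "loops (uniform_matroid 0 n) = {1..n}" by (auto simp: loops_def uniform_matroid_def)
  moreover have "{S. S \<subseteq> {1..n} \<and> card S \<le> 0 \<and> S \<inter> {1..n} = {}} = {S. S \<subseteq> {1..0::nat} \<and> card S \<le> 0}"
    by auto
  ultimately show ?thesis by (auto simp: delete_def uniform_matroid_def)
qed

theorem chow_hilbert_series_uniform:
  assumes "i \<le> n"
  shows "fps_to_fls (chow_hilbert_series (uniform_matroid i n)) =
    fls_X ^ i + (\<Sum>r<i. of_nat (n choose r) * eul_poly fls_X r * (\<Sum>k<i - r. fls_X ^ k))"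
proof (cases "i = 0")
  case False
  interpret uniform_chow i n by standard (use assms False in auto)
  have "chow_hilbert_series (uniform_matroid i n) = Abs_fps (\<lambda>j. of_nat (card {Q \<in> normal_msets i E. size Q = j}))"
    using False by (simp add: chow_hilbert_series_def Let_def loops_uniform delete_empty dim_chow_graded normals_def)
  then have "fps_to_fls (chow_hilbert_series (uniform_matroid i n)) = (\<Sum>Q\<in>normal_msets i E. fls_X ^ size Q)"
    using fps_of_cards[OF finite_normal_msets[OF finite_E]] by simp
  also have "\<dots> = fls_X ^ i + (\<Sum>r<i. of_nat (card E choose r) * eul_poly fls_X r * (\<Sum>k<i - r. fls_X ^ k))"
    by (rule normal_msets_hilbert[OF finite_E d_le]) (use False in simp)
  finally show ?thesis by simp
next
  case True
  \<comment> \<open>In rank \<open>0\<close> the deletion of all loops leaves the empty ground set,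
    whatever \<open>n\<close> is.\<close>
  interpret uniform_chow 0 0 by standard auto
  have E: "E = {}" unfolding E_def by simp
  have "chow_hilbert_series (uniform_matroid i n) = Abs_fps (\<lambda>j. of_nat (card {Q \<in> {{#} :: nat set multiset}. size Q = j}))"
    by (simp add: True chow_hilbert_series_def Let_def delete_loops_rank_0 dim_chow_graded normals_def E normal_msets_empty)
  then have "fps_to_fls (chow_hilbert_series (uniform_matroid i n)) = (\<Sum>Q\<in>{{#} :: nat set multiset}. fls_X ^ size Q)"
    using fps_of_cards[of "{{#} :: nat set multiset}"] by simp
  then show ?thesis using True by simp
qed

text \<open>For \<open>i < n\<close> the upper entry is a natural number, and natural binomials pass
  through \<open>fls_const\<close>. For \<open>i = n\<close> it is \<open>-1\<close>, but then
  \<open>d = n\<close> and the lower entry is \<open>0\<close>.\<close>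

lemma fls_const_gchoose:
  assumes "i \<le> d" "d \<le> n"
  shows "fls_const ((of_nat n - of_nat i - 1 :: rat) gchoose (d - i)) = (of_nat n - of_nat i - 1) gchoose (d - i)"
proof (cases "i = n")
  case True
  then show ?thesis using assms by simp
next
  case False
  then have "(of_nat n - of_nat i - 1 :: 'b::ring_1) = of_nat (n - i - 1)"
    using assms by (simp add: of_nat_diff)
  moreover have "(of_nat n - of_nat i - 1 :: rat) = of_nat (n - i - 1)"
    "(of_nat n - of_nat i - 1 :: rat fls) = of_nat (n - i - 1)"
    using assms False by (simp_all add: of_nat_diff)
  ultimately show ?thesis
    by (simp only: binomial_gbinomial[symmetric] fls_of_nat[symmetric])
qed

theorem theorem5p2:
  fixes d n :: nat
  assumes "d \<le> n"
  shows "fls_X ^ d * poly (map_poly fls_const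
             (h_polynomial (augmented_bergman (uniform_matroid d n)))) (inverse fls_X) =
         (\<Sum>i=0..d. fls_const ((of_nat n - of_nat i - 1) gchoose (d - i)) *
            fps_to_fls (chow_hilbert_series (uniform_matroid i n)))"
proof -
  have "fls_X ^ d * poly (map_poly fls_const
             (h_polynomial (augmented_bergman (uniform_matroid d n)))) (inverse fls_X) =
     (\<Sum>s\<le>d. of_nat (n choose s) * (fls_X - 1) ^ (d - s)) +
     (\<Sum>r<d. of_nat (n choose r) * chain_poly fls_X r * (fls_X - 1) ^ (d - r - 1))"
    by (rule reversed_h_polynomial_uniform[OF assms])
  also have "\<dots> = (\<Sum>i\<le>d. ((of_nat n - of_nat i - 1) gchoose (d - i)) *
      (fls_X ^ i + (\<Sum>r<i. of_nat (n choose r) * eul_poly fls_X r * (\<Sum>k<i - r. fls_X ^ k))))"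
    by (rule chain_sum_identity[OF eul_poly.simps chain_poly.simps fls_X_neq_1 assms])
  also have "\<dots> = (\<Sum>i\<le>d. fls_const ((of_nat n - of_nat i - 1) gchoose (d - i)) *
            fps_to_fls (chow_hilbert_series (uniform_matroid i n)))"
    by (rule sum.cong) (use assms in \<open>simp_all add: chow_hilbert_series_uniform fls_const_gchoose\<close>)
  finally show ?thesis by (simp only: atLeast0AtMost)
qed

end
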